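(* Let $A$ be a sectorial linear operator on a Banach space $\mathbb{X}$ generating a hyperbolic analytic semigroup $(T(t))_{t\ge0}$ with projections $P$, $Q=I-P$ and constant $\delta>0$. Let $0<\alpha<\beta<1$, let $\mathbb{X}_\alpha,\mathbb{X}_\beta$ be admissible intermediate spaces of orders $\alpha,\beta$, and let $B,C:\mathbb{X}_\alpha\to\mathbb{X}$ be bounded linear operators (with $D(A+B+C)\neq\{0\}$). Let $f:\mathbb{R}\times\mathbb{X}\to\mathbb{X}_\beta$ and $g:\mathbb{R}\times\mathbb{X}\to\mathbb{X}$ be pseudo almost periodic in $t\in\mathbb{R}$ uniformly in $u\in\mathbb{X}$, and suppose there is $K>0$ such that $\|f(t,u)-f(t,v)\|_\beta\le K\|u-v\|$ and $\|g(t,u)-g(t,v)\|\le K\|u-v\|$ for all $u,v\in\mathbb{X}$, $t\in\mathbb{R}$. Let $c,\gamma,M(\alpha),c(\alpha),k(\alpha)>0$ be constants for which $$\|T(t)Qx\|_\alpha\le c(\alpha)e^{\delta t}\|x\|\ (t\le0,\ x\in\mathbb{X}),\qquad \|T(t)Px\|_\alpha\le M(\alpha)t^{-\alpha}e^{-\gamma t}\|x\|\ (t>0,\ x\in\mathbb{X}),$$ $$\|AT(t)Qx\|_\alpha\le ce^{\delta t}\|x\|_\beta\ (t\le0,\ x\in\mathbb{X}_\beta),\qquad\|AT(t)Px\|_\alpha\le ct^{\beta-\alpha-1}e^{-\gamma t}\|x\|_\beta\ (t>0,\ x\in\mathbb{X}_\beta),$$ and $\|x\|_\alpha\le k(\alpha)\|x\|_\beta$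 for $x\in\mathbb{X}_\beta$. Put $\varpi=\max(\|B\|_{B(\mathbb{X}_\alpha,\mathbb{X})},\|C\|_{B(\mathbb{X}_\alpha,\mathbb{X})})$ and $$\Theta=K\varpi\left[k(\alpha)+\frac{c}{\delta}+c\,\frac{\Gamma(\beta-\alpha)}{\gamma^{\beta-\alpha}}+\frac{M(\alpha)\Gamma(1-\alpha)}{\gamma^{1-\alpha}}+\frac{c(\alpha)}{\delta}\right],$$ where $\Gamma(\cdot)$ is the gamma function. If $\Theta<1$, then the evolution equation $$\frac{d}{dt}\left[u(t)+f(t,Bu(t))\right]=Au(t)+g(t,Cu(t)),\quad t\in\mathbb{R},$$ has a unique pseudo almost periodic mild solution, i.e. there is exactly one mild solution $u$ belonging to $PAP(\mathbb{X}_\alpha)$.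
   Context: Sectorial: a linear operator $A:D(A)\subset\mathbb{X}\to\mathbb{X}$ (not necessarily densely defined) on a Banach space $(\mathbb{X},\|\cdot\|)$ is sectorial if there exist $\omega\in\mathbb{R}$, $\theta\in(\pi/2,\pi)$, $M>0$ with $\rho(A)\supset S_{\theta,\omega}:=\{\lambda\in\mathbb{C}:\lambda\ne\omega,\ |\arg(\lambda-\omega)|<\theta\}$ and $\|R(\lambda,A)\|\le M/|\lambda-\omega|$ for $\lambda\in S_{\theta,\omega}$. Such $A$ generates an analytic semigroup $(T(t))_{t\ge0}$ on $\mathbb{X}$. Hyperbolic: there exist a projection $P$ and constants $M,\delta>0$ such that each $T(t)$ commutes with $P$, $N(P)$ is invariant under $T(t)$, with $Q:=I-P$ the map $T(t):R(Q)\to R(Q)$ is invertible, and $\|T(t)Px\|\le Me^{-\delta t}\|x\|$ for $t\ge0$, $\|T(t)Qx\|\le Me^{\delta t}\|x\|$ for $t\le0$, where for $t\le 0$, $T(t):=(T(-t))^{-1}$ on $R(Q)$. This is equivalent to $\sigma(A)\cap i\mathbb{R}=\emptyset$. Admissible intermediate space of order $\alpha\in(0,1)$: a Banach space $(\mathbb{X}_\alpha,\|\cdot\|_\alpha)$ which is one of: $D((-A)^\alpha)$, the domain of the fractional power (in the cases where it is defined); the real interpolation space $D_A(\alpha,p)=(\mathbb{X},D(A))_{\alpha,p}$, $1\le p\le+\infty$, where $D_A(\alpha,\infty)=\{x\in\mathbb{X}:[x]_\alpha:=\sup_{0<t\le1}\|t^{1-\alpha}AT(t)x\|<\infty\}$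 with norm $\|x\|+[x]_\alpha$; the abstract Hölder space $D_A(\alpha):=\overline{D(A)}^{\|\cdot\|_\alpha}$ (closure of $D(A)$ in $D_A(\alpha,\infty)$); or the complex interpolation space $[\mathbb{X},D(A)]_\alpha$. All of these satisfy $D(A)\subset\mathbb{X}_\alpha\subset\mathbb{X}$ and $\|x\|_\alpha\le c_0\|x\|^{1-\alpha}\|x\|_A^\alpha$ for $x\in D(A)$, where $\|\cdot\|_A$ is the graph norm and $c_0>0$ a constant. Likewise for order $\beta$. For $\beta>\alpha$ one has the continuous embedding $\mathbb{X}_\beta\hookrightarrow\mathbb{X}_\alpha$. $B(\mathbb{Y},\mathbb{Z})$ is the space of bounded linear operators with the operator norm. Pseudo almost periodicity (for Banach spaces $\mathbb{Y},\mathbb{Z}$): $AP(\mathbb{Z})$ is the set of continuous $h:\mathbb{R}\to\mathbb{Z}$ such that for each $\varepsilon>0$ there is $l(\varepsilon)>0$ such that every interval of length $l(\varepsilon)$ contains $\tau$ with $\|h(t+\tau)-h(t)\|<\varepsilon$ for all $t\in\mathbb{R}$. $AP_0(\mathbb{Z})$ is the set of bounded continuous $h:\mathbb{R}\to\mathbb{Z}$ with $\lim_{r\to\infty}\frac1{2r}\int_{-r}^r\|h(s)\|ds=0$. $PAP(\mathbb{Z})$ is the set of bounded continuous functions of the form $h_1+h_2$ with $h_1\in AP(\mathbb{Z})$, $h_2\in AP_0(\mathbb{Z})$. A jointly continuous $F:\mathbb{R}\times\mathbb{Y}\to\mathbb{Z}$ is pseudo almost periodic in $t\in\mathbb{R}$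 uniformly in $y\in\mathbb{Y}$ if $F=G+\Phi$, where $G:\mathbb{R}\times\mathbb{Y}\to\mathbb{Z}$ is jointly continuous and for each $\varepsilon>0$ and compact $K'\subset\mathbb{Y}$ there is $l(\varepsilon)>0$ such that every interval of length $l(\varepsilon)$ contains $\tau$ with $\|G(t+\tau,y)-G(t,y)\|<\varepsilon$ for all $t\in\mathbb{R}$, $y\in K'$; and $\Phi:\mathbb{R}\times\mathbb{Y}\to\mathbb{Z}$ is jointly continuous and bounded with $\lim_{r\to\infty}\frac1{2r}\int_{-r}^r\|\Phi(t,y)\|dt=0$ uniformly in $y\in\mathbb{Y}$. Mild solution: a bounded continuous $u:\mathbb{R}\to\mathbb{X}_\alpha$ such that, for each $t\in\mathbb{R}$, $s\mapsto AT(t-s)Pf(s,Bu(s))$ is integrable on $(-\infty,t)$, $s\mapsto AT(t-s)Qf(s,Bu(s))$ is integrable on $(t,\infty)$, and $$u(t)=-f(t,Bu(t))-\int_{-\infty}^tAT(t-s)Pf(s,Bu(s))ds+\int_t^\infty AT(t-s)Qf(s,Bu(s))ds+\int_{-\infty}^tT(t-s)Pg(s,Cu(s))ds-\int_t^\infty T(t-s)Qg(s,Cu(s))ds.$$ *)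

theory Defs
  imports "HOL-Analysis.Analysis"
begin

section \<open>Complex Banach spaces\<close>

class scaleC =
  fixes scaleC :: "complex \<Rightarrow> 'a \<Rightarrow> 'a"  (infixr "*\<^sub>C" 75)

class complex_banach = banach + scaleC +
  assumes scaleC_add_right: "a *\<^sub>C (x + y) = a *\<^sub>C x + a *\<^sub>C y"
    and scaleC_add_left: "(a + b) *\<^sub>C x = a *\<^sub>C x + b *\<^sub>C x"
    and scaleC_scaleC: "a *\<^sub>C (b *\<^sub>C x) = (a * b) *\<^sub>C x"
    and scaleC_of_real: "complex_of_real r *\<^sub>C x = r *\<^sub>R x"
    and norm_scaleC: "norm (a *\<^sub>C x) = norm a * norm x"

instantiation complex :: complex_banach
begin

definition scaleC_complex :: "complex \<Rightarrow> complex \<Rightarrow> complex"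
  where "scaleC_complex a x = a * x"

instance
  by standard (simp_all add: scaleC_complex_def algebra_simps norm_mult scaleR_conv_of_real)

end

definition bounded_clinear :: "('a::complex_banach \<Rightarrow> 'b::complex_banach) \<Rightarrow> bool"
  where "bounded_clinear F \<longleftrightarrow> bounded_linear F \<and> (\<forall>a x. F (a *\<^sub>C x) = a *\<^sub>C F x)"

definition cdifferentiable_at :: "(complex \<Rightarrow> 'a::complex_banach) \<Rightarrow> complex \<Rightarrow> bool"
  where "cdifferentiable_at F z \<longleftrightarrow> (\<exists>d. (F has_derivative (\<lambda>h. h *\<^sub>C d)) (at z))"


section \<open>Sectorial operators and their semigroups\<close>

text \<open>An unbounded operator is given by its domain \<open>D\<close>, a linear subspace that need not be
  dense, and a total function \<open>A\<close> of which only the values on \<open>D\<close> matter.\<close>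

definition linear_operator :: "'x::complex_banach set \<Rightarrow> ('x \<Rightarrow> 'x) \<Rightarrow> bool"
  where "linear_operator D A \<longleftrightarrow>
    0 \<in> D \<and> (\<forall>x\<in>D. \<forall>y\<in>D. x + y \<in> D \<and> A (x + y) = A x + A y) \<and>
    (\<forall>a. \<forall>x\<in>D. a *\<^sub>C x \<in> D \<and> A (a *\<^sub>C x) = a *\<^sub>C A x)"

definition graph_norm :: "('x::complex_banach \<Rightarrow> 'x) \<Rightarrow> 'x \<Rightarrow> real"
  where "graph_norm A x = norm x + norm (A x)"

definition resolvent :: "'x::complex_banach set \<Rightarrow> ('x \<Rightarrow> 'x) \<Rightarrow> complex \<Rightarrow> 'x \<Rightarrow> 'x"
  where "resolvent D A \<mu> = inv_into D (\<lambda>x. \<mu> *\<^sub>C x - A x)"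

definition resolvent_set :: "'x::complex_banach set \<Rightarrow> ('x \<Rightarrow> 'x) \<Rightarrow> complex set"
  where "resolvent_set D A =
    {\<mu>. bij_betw (\<lambda>x. \<mu> *\<^sub>C x - A x) D UNIV \<and> bounded_clinear (resolvent D A \<mu>)}"

definition sector :: "real \<Rightarrow> real \<Rightarrow> complex set"
  where "sector \<theta> \<omega> = {\<mu>. \<mu> \<noteq> of_real \<omega> \<and> \<bar>Arg (\<mu> - of_real \<omega>)\<bar> < \<theta>}"

definition sectorial :: "'x::complex_banach set \<Rightarrow> ('x \<Rightarrow> 'x) \<Rightarrow> bool"
  where "sectorial D A \<longleftrightarrow> linear_operator D A \<and>
    (\<exists>\<omega> \<theta> M. pi / 2 < \<theta> \<and> \<theta> < pi \<and> 0 < M \<and>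
       sector \<theta> \<omega> \<subseteq> resolvent_set D A \<and>
       (\<forall>\<mu>\<in>sector \<theta> \<omega>. \<forall>x. norm (resolvent D A \<mu> x) \<le> M / norm (\<mu> - of_real \<omega>) * norm x))"

text \<open>Since \<open>D\<close> need not be dense, an analytic semigroup need not be strongly continuous at \<open>0\<close>,
  and it determines its generator through the Laplace transform (Arendt, Batty, Hieber and
  Neubrander, Vector-valued Laplace Transforms and Cauchy Problems, Section 3.7) rather than
  through a derivative at \<open>0\<close>.  For sectorial \<open>A\<close> the unique such \<open>T\<close> is the Dunford integral of
  \<open>exp (t \<mu>)\<close> times the resolvent.  \<open>S\<close> is the holomorphic extension of \<open>T\<close> to a sector;
  the values of \<open>T\<close> at negative times are irrelevant.\<close>

definition generates_analytic_semigroup ::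
    "'x::complex_banach set \<Rightarrow> ('x \<Rightarrow> 'x) \<Rightarrow> (real \<Rightarrow> 'x \<Rightarrow> 'x) \<Rightarrow> bool"
  where "generates_analytic_semigroup D A T \<longleftrightarrow>
    (\<forall>t\<ge>0. bounded_clinear (T t)) \<and>
    (\<forall>x. T 0 x = x) \<and>
    (\<forall>s\<ge>0. \<forall>t\<ge>0. \<forall>x. T (s + t) x = T s (T t x)) \<and>
    (\<exists>\<phi> S. 0 < \<phi> \<and> \<phi> \<le> pi / 2 \<and>
       (\<forall>t>0. S (complex_of_real t) = T t) \<and>
       (\<forall>z\<in>sector \<phi> 0. bounded_clinear (S z) \<and> (\<forall>x. cdifferentiable_at (\<lambda>w. S w x) z)) \<and>
       (\<forall>\<psi>. 0 < \<psi> \<and> \<psi> < \<phi> \<longrightarrow>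
          (\<exists>C. \<forall>z\<in>sector \<psi> 0. norm z \<le> 1 \<longrightarrow> (\<forall>x. norm (S z x) \<le> C * norm x)))) \<and>
    (\<exists>w. \<forall>\<mu>>w. complex_of_real \<mu> \<in> resolvent_set D A \<and>
       (\<forall>x. ((\<lambda>t. exp (- \<mu> * t) *\<^sub>R T t x) has_integral resolvent D A (of_real \<mu>) x) {0..}))"

definition compl_proj :: "('x::complex_banach \<Rightarrow> 'x) \<Rightarrow> 'x \<Rightarrow> 'x"
  where "compl_proj P x = x - P x"

text \<open>The extension of \<open>T\<close> to negative times, meaningful on the range of \<open>Q\<close> only.\<close>

definition group_ext ::
    "(real \<Rightarrow> 'x::complex_banach \<Rightarrow> 'x) \<Rightarrow> ('x \<Rightarrow> 'x) \<Rightarrow> real \<Rightarrow> 'x \<Rightarrow> 'x"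
  where "group_ext T Q t = (if 0 \<le> t then T t else inv_into (range Q) (T (- t)))"

definition hyperbolic ::
    "(real \<Rightarrow> 'x::complex_banach \<Rightarrow> 'x) \<Rightarrow> ('x \<Rightarrow> 'x) \<Rightarrow> real \<Rightarrow> bool"
  where "hyperbolic T P \<delta> \<longleftrightarrow>
    bounded_clinear P \<and> (\<forall>x. P (P x) = P x) \<and> 0 < \<delta> \<and>
    (\<forall>t\<ge>0. \<forall>x. T t (P x) = P (T t x)) \<and>
    (\<forall>t\<ge>0. T t ` {x. P x = 0} \<subseteq> {x. P x = 0}) \<and>
    (\<forall>t\<ge>0. bij_betw (T t) (range (compl_proj P)) (range (compl_proj P))) \<and>
    (\<exists>M>0. (\<forall>t\<ge>0. \<forall>x. norm (T t (P x)) \<le> M * exp (- \<delta> * t) * norm x) \<and>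
       (\<forall>t\<le>0. \<forall>x. norm (group_ext T (compl_proj P) t (compl_proj P x))
                    \<le> M * exp (\<delta> * t) * norm x))"


section \<open>Intermediate spaces\<close>

subsection \<open>Domains of fractional powers\<close>

text \<open>Fractional powers are taken for positive operators \<open>- A\<close>: for \<open>0 < \<alpha> < 1\<close> the operator
  \<open>neg_frac_power D A \<alpha>\<close> is the bounded injective negative power of order \<open>- \<alpha>\<close> of \<open>- A\<close>
  in Balakrishnan's representation, and the power of order \<open>\<alpha>\<close> is its inverse.\<close>

definition frac_powers_defined :: "'x::complex_banach set \<Rightarrow> ('x \<Rightarrow> 'x) \<Rightarrow> bool"
  where "frac_powers_defined D A \<longleftrightarrow>
    (\<exists>M. \<forall>\<mu>\<ge>0. complex_of_real \<mu> \<in> resolvent_set D A \<and>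
       (\<forall>x. norm (resolvent D A (of_real \<mu>) x) \<le> M / (1 + \<mu>) * norm x))"

definition neg_frac_power :: "'x::complex_banach set \<Rightarrow> ('x \<Rightarrow> 'x) \<Rightarrow> real \<Rightarrow> 'x \<Rightarrow> 'x"
  where "neg_frac_power D A \<alpha> x =
    (sin (pi * \<alpha>) / pi) *\<^sub>R
      integral {0<..} (\<lambda>\<mu>. \<mu> powr (- \<alpha>) *\<^sub>R resolvent D A (complex_of_real \<mu>) x)"

definition frac_power_domain :: "'x::complex_banach set \<Rightarrow> ('x \<Rightarrow> 'x) \<Rightarrow> real \<Rightarrow> 'x set"
  where "frac_power_domain D A \<alpha> = range (neg_frac_power D A \<alpha>)"

definition frac_power :: "'x::complex_banach set \<Rightarrow> ('x \<Rightarrow> 'x) \<Rightarrow> real \<Rightarrow> 'x \<Rightarrow> 'x"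
  where "frac_power D A \<alpha> = inv_into UNIV (neg_frac_power D A \<alpha>)"

subsection \<open>Real interpolation spaces, finite second index\<close>

definition K_functional ::
    "'x::complex_banach set \<Rightarrow> ('x \<Rightarrow> 'x) \<Rightarrow> real \<Rightarrow> 'x \<Rightarrow> real"
  where "K_functional D A t x = (INF b\<in>D. norm (x - b) + t * graph_norm A b)"

definition real_interp_integrand ::
    "'x::complex_banach set \<Rightarrow> ('x \<Rightarrow> 'x) \<Rightarrow> real \<Rightarrow> real \<Rightarrow> 'x \<Rightarrow> real \<Rightarrow> real"
  where "real_interp_integrand D A \<alpha> p x t = (t powr (- \<alpha>) * K_functional D A t x) powr p / t"

definition real_interp_space ::
    "'x::complex_banach set \<Rightarrow> ('x \<Rightarrow> 'x) \<Rightarrow> real \<Rightarrow> real \<Rightarrow> 'x set"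
  where "real_interp_space D A \<alpha> p =
    {x. set_integrable lborel {0<..} (real_interp_integrand D A \<alpha> p x)}"

definition real_interp_norm ::
    "'x::complex_banach set \<Rightarrow> ('x \<Rightarrow> 'x) \<Rightarrow> real \<Rightarrow> real \<Rightarrow> 'x \<Rightarrow> real"
  where "real_interp_norm D A \<alpha> p x =
    (LINT t:{0<..}|lborel. real_interp_integrand D A \<alpha> p x t) powr (1 / p)"

subsection \<open>Real interpolation spaces with second index infinity, and abstract Hoelder spaces\<close>

definition D_infty ::
    "('x::complex_banach \<Rightarrow> 'x) \<Rightarrow> (real \<Rightarrow> 'x \<Rightarrow> 'x) \<Rightarrow> real \<Rightarrow> 'x set"
  where "D_infty A T \<alpha> =
    {x. bdd_above ((\<lambda>t. norm (t powr (1 - \<alpha>) *\<^sub>R A (T t x))) ` {0<..1})}"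

definition D_infty_norm ::
    "('x::complex_banach \<Rightarrow> 'x) \<Rightarrow> (real \<Rightarrow> 'x \<Rightarrow> 'x) \<Rightarrow> real \<Rightarrow> 'x \<Rightarrow> real"
  where "D_infty_norm A T \<alpha> x =
    norm x + (SUP t\<in>{0<..1}. norm (t powr (1 - \<alpha>) *\<^sub>R A (T t x)))"

definition D_holder ::
    "'x::complex_banach set \<Rightarrow> ('x \<Rightarrow> 'x) \<Rightarrow> (real \<Rightarrow> 'x \<Rightarrow> 'x) \<Rightarrow> real \<Rightarrow> 'x set"
  where "D_holder D A T \<alpha> =
    {x \<in> D_infty A T \<alpha>. \<forall>\<epsilon>>0. \<exists>y\<in>D. D_infty_norm A T \<alpha> (x - y) < \<epsilon>}"

subsection \<open>Complex interpolation spaces\<close>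

text \<open>Calderon's space of admissible functions for the couple of the ambient space and \<open>D\<close>
  with the graph norm.  A function into \<open>D\<close> is continuous (bounded) for the graph norm if and
  only if it and its composition with \<open>A\<close> are continuous (bounded).\<close>

definition calderon_space ::
    "'x::complex_banach set \<Rightarrow> ('x \<Rightarrow> 'x) \<Rightarrow> (complex \<Rightarrow> 'x) set"
  where "calderon_space D A =
    {F. continuous_on {z. 0 \<le> Re z \<and> Re z \<le> 1} F \<and>
        bounded (F ` {z. 0 \<le> Re z \<and> Re z \<le> 1}) \<and>
        (\<forall>z. 0 < Re z \<and> Re z < 1 \<longrightarrow> cdifferentiable_at F z) \<and>
        (\<forall>s. F (Complex 1 s) \<in> D) \<and>
        continuous_on UNIV (\<lambda>s. A (F (Complex 1 s))) \<and>
        bounded (range (\<lambda>s. A (F (Complex 1 s))))}"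

definition calderon_norm :: "('x::complex_banach \<Rightarrow> 'x) \<Rightarrow> (complex \<Rightarrow> 'x) \<Rightarrow> real"
  where "calderon_norm A F =
    max (SUP s. norm (F (Complex 0 s))) (SUP s. graph_norm A (F (Complex 1 s)))"

definition complex_interp_space ::
    "'x::complex_banach set \<Rightarrow> ('x \<Rightarrow> 'x) \<Rightarrow> real \<Rightarrow> 'x set"
  where "complex_interp_space D A \<alpha> = (\<lambda>F. F (complex_of_real \<alpha>)) ` calderon_space D A"

definition complex_interp_norm ::
    "'x::complex_banach set \<Rightarrow> ('x \<Rightarrow> 'x) \<Rightarrow> real \<Rightarrow> 'x \<Rightarrow> real"
  where "complex_interp_norm D A \<alpha> x =
    (INF F\<in>{F \<in> calderon_space D A. F (complex_of_real \<alpha>) = x}. calderon_norm A F)"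

subsection \<open>Admissible intermediate spaces\<close>

text \<open>A Banach space continuously included in \<open>'x\<close> is represented by a type \<open>'a\<close> together
  with its inclusion map \<open>\<iota>\<close>.  The interpolation norms have several customary versions, which
  are equivalent but not equal (K-method, trace method, semigroup; graph norm or homogeneous norm
  on the domain of a fractional power), so a norm is prescribed up to equivalence only.\<close>

definition realizes ::
    "('a::complex_banach \<Rightarrow> 'x::complex_banach) \<Rightarrow> 'x set \<Rightarrow> ('x \<Rightarrow> real) \<Rightarrow> bool"
  where "realizes \<iota> V N \<longleftrightarrow> bounded_clinear \<iota> \<and> inj \<iota> \<and> range \<iota> = V \<and>
    (\<exists>c\<^sub>1>0. \<exists>c\<^sub>2>0. \<forall>x. c\<^sub>1 * N (\<iota> x) \<le> norm x \<and> norm x \<le> c\<^sub>2 * N (\<iota> x))"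

definition admissible ::
    "'x::complex_banach set \<Rightarrow> ('x \<Rightarrow> 'x) \<Rightarrow> (real \<Rightarrow> 'x \<Rightarrow> 'x) \<Rightarrow> real \<Rightarrow>
     ('a::complex_banach \<Rightarrow> 'x) \<Rightarrow> bool"
  where "admissible D A T \<alpha> \<iota> \<longleftrightarrow>
    frac_powers_defined D A \<and>
      realizes \<iota> (frac_power_domain D A \<alpha>) (\<lambda>x. norm (frac_power D A \<alpha> x)) \<or>
    (\<exists>p\<ge>1. realizes \<iota> (real_interp_space D A \<alpha> p) (real_interp_norm D A \<alpha> p)) \<or>
    realizes \<iota> (D_infty A T \<alpha>) (D_infty_norm A T \<alpha>) \<or>
    realizes \<iota> (D_holder D A T \<alpha>) (D_infty_norm A T \<alpha>) \<or>
    realizes \<iota> (complex_interp_space D A \<alpha>) (complex_interp_norm D A \<alpha>)"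

text \<open>The element \<open>y\<close> of the ambient space lies in the included space, with norm there at
  most \<open>r\<close>.\<close>

definition norm_le_in ::
    "('a::complex_banach \<Rightarrow> 'x::complex_banach) \<Rightarrow> 'x \<Rightarrow> real \<Rightarrow> bool"
  where "norm_le_in \<iota> y r \<longleftrightarrow> (\<exists>z. \<iota> z = y \<and> norm z \<le> r)"


section \<open>Pseudo almost periodicity\<close>

definition AP :: "(real \<Rightarrow> 'z::banach) set"
  where "AP = {h. continuous_on UNIV h \<and>
    (\<forall>\<epsilon>>0. \<exists>l>0. \<forall>a. \<exists>\<tau>\<in>{a..a + l}. \<forall>t. norm (h (t + \<tau>) - h t) < \<epsilon>)}"

definition AP0 :: "(real \<Rightarrow> 'z::banach) set"
  where "AP0 = {h. continuous_on UNIV h \<and> bounded (range h) \<and>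
    ((\<lambda>r. 1 / (2 * r) * integral {- r..r} (\<lambda>s. norm (h s))) \<longlongrightarrow> 0) at_top}"

definition PAP :: "(real \<Rightarrow> 'z::banach) set"
  where "PAP = {h. continuous_on UNIV h \<and> bounded (range h) \<and>
    (\<exists>h\<^sub>1\<in>AP. \<exists>h\<^sub>2\<in>AP0. \<forall>t. h t = h\<^sub>1 t + h\<^sub>2 t)}"

definition AP_unif :: "(real \<Rightarrow> 'y::banach \<Rightarrow> 'z::banach) set"
  where "AP_unif = {G. continuous_on UNIV (\<lambda>(t, y). G t y) \<and>
    (\<forall>\<epsilon>>0. \<forall>K. compact K \<longrightarrow>
       (\<exists>l>0. \<forall>a. \<exists>\<tau>\<in>{a..a + l}. \<forall>t. \<forall>y\<in>K. norm (G (t + \<tau>) y - G t y) < \<epsilon>))}"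

definition AP0_unif :: "(real \<Rightarrow> 'y::banach \<Rightarrow> 'z::banach) set"
  where "AP0_unif = {\<Phi>. continuous_on UNIV (\<lambda>(t, y). \<Phi> t y) \<and>
    bounded (range (\<lambda>(t, y). \<Phi> t y)) \<and>
    uniform_limit UNIV (\<lambda>r y. 1 / (2 * r) * integral {- r..r} (\<lambda>t. norm (\<Phi> t y))) (\<lambda>y. 0) at_top}"

definition PAP_unif :: "(real \<Rightarrow> 'y::banach \<Rightarrow> 'z::banach) set"
  where "PAP_unif = {F. continuous_on UNIV (\<lambda>(t, y). F t y) \<and>
    (\<exists>G\<in>AP_unif. \<exists>\<Phi>\<in>AP0_unif. \<forall>t y. F t y = G t y + \<Phi> t y)}"


section \<open>Mild solutions\<close>

text \<open>The library's Bochner integral needs a separable target, so integrals of functions into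
  a general Banach space are Henstock-Kurzweil integrals, and integrable means that the function
  and its norm are integrable.  For continuous integrands on open intervals, such as those
  below, this is Bochner integrability, with the same integral.\<close>

definition norm_integrable_on :: "(real \<Rightarrow> 'x::banach) \<Rightarrow> real set \<Rightarrow> bool"
  where "norm_integrable_on h S \<longleftrightarrow> h integrable_on S \<and> (\<lambda>s. norm (h s)) integrable_on S"

text \<open>\<open>\<iota>\<^sub>\<alpha>\<close> and \<open>\<iota>\<^sub>\<beta>\<close> are the inclusions of the spaces in which \<open>u\<close> and \<open>f\<close> take their values;
  the integrals and the equation live in the ambient space.\<close>

definition mild_solution ::
    "('x::complex_banach \<Rightarrow> 'x) \<Rightarrow> (real \<Rightarrow> 'x \<Rightarrow> 'x) \<Rightarrow> ('x \<Rightarrow> 'x) \<Rightarrow>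
     ('a::complex_banach \<Rightarrow> 'x) \<Rightarrow> ('b::complex_banach \<Rightarrow> 'x) \<Rightarrow>
     ('a \<Rightarrow> 'x) \<Rightarrow> ('a \<Rightarrow> 'x) \<Rightarrow> (real \<Rightarrow> 'x \<Rightarrow> 'b) \<Rightarrow> (real \<Rightarrow> 'x \<Rightarrow> 'x) \<Rightarrow>
     (real \<Rightarrow> 'a) \<Rightarrow> bool"
  where "mild_solution A T P \<iota>\<^sub>\<alpha> \<iota>\<^sub>\<beta> B C f g u \<longleftrightarrow>
    (let Q = compl_proj P; T' = group_ext T Q in
     continuous_on UNIV u \<and> bounded (range u) \<and>
     (\<forall>t. norm_integrable_on (\<lambda>s. A (T (t - s) (P (\<iota>\<^sub>\<beta> (f s (B (u s))))))) {..<t} \<and>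
          norm_integrable_on (\<lambda>s. A (T' (t - s) (Q (\<iota>\<^sub>\<beta> (f s (B (u s))))))) {t<..} \<and>
          \<iota>\<^sub>\<alpha> (u t) =
            - \<iota>\<^sub>\<beta> (f t (B (u t)))
            - integral {..<t} (\<lambda>s. A (T (t - s) (P (\<iota>\<^sub>\<beta> (f s (B (u s)))))))
            + integral {t<..} (\<lambda>s. A (T' (t - s) (Q (\<iota>\<^sub>\<beta> (f s (B (u s)))))))
            + integral {..<t} (\<lambda>s. T (t - s) (P (g s (C (u s)))))
            - integral {t<..} (\<lambda>s. T' (t - s) (Q (g s (C (u s)))))))"

end

theory Submission
  imports Defs
begin

text \<open>The mild solutions in \<open>PAP\<close> are the fixed points of an operator \<open>\<Lambda>\<close> that is \<open>\<Theta>\<close>-Lipschitz for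
  the supremum norm. Each of its four integrals is a convolution with an operator-valued kernel
  that has an integrable norm bound. Such a convolution commutes with translations, hence
  preserves almost periodicity; it preserves vanishing means by Tonelli and dominated convergence.
  The space \<open>PAP\<close> is closed under uniform limits because the almost periodic part of a function is
  bounded by the supremum of the whole function: an almost periodic function whose norm has mean
  zero vanishes. The kernels are strongly continuous into the intermediate space because
  \<open>T(s) P = T(r) P T(s - r)\<close>, where only the fixed factor \<open>T(r) P\<close> has to map into that space.\<close>

section \<open>Integrals over half-lines\<close>

text \<open>Distances are measured in the norm of the space of order \<alpha>, so the integrals have
  to be formed there, although the equation is written in the ambient space and the orbits of
  \<open>T\<close> are known to be continuous only in the latter. Each kernel is therefore pulled
  back through \<open>inv \<iota>\<^sub>\<alpha>\<close>, integrated, and pushed forward again by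
  the bounded injection \<open>\<iota>\<^sub>\<alpha>\<close>. The bracket in \<Theta> is the bound
  of the embedding plus the integrals of the four kernel majorants; the singularities of order
  -\<alpha> and \<beta> - \<alpha> - 1 at 0 are integrable because \<alpha> < 1 and \<alpha> <
  \<beta>. Two obstacles shape the part on function spaces. Almost periods of different functions
  need not agree, so common ones have to be produced. And in a splitting of f into an almost
  periodic part and an ergodic part only f is Lipschitz, so the ergodic part cannot be followed
  along a moving argument; the argument is frozen at finitely many points of a compact range
  instead.\<close>

lemma has_integral_affine_UNIV:
  fixes f :: "real \<Rightarrow> 'a::banach"
  assumes f: "(f has_integral i) UNIV" and a: "a \<noteq> 0"
  shows "((\<lambda>x. f (a * x + b)) has_integral (1 / \<bar>a\<bar>) *\<^sub>R i) UNIV"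
  unfolding has_integral'[of _ _ UNIV]
proof (intro allI impI)
  fix e :: real assume e: "e > 0"
  then have "e * \<bar>a\<bar> > 0" using a by simp
  with f[unfolded has_integral'[of _ _ UNIV]]
  obtain R where R: "R > 0"
    and *: "\<And>u v. ball 0 R \<subseteq> cbox u v \<Longrightarrow>
      \<exists>z. (f has_integral z) (cbox u v) \<and> norm (z - i) < e * \<bar>a\<bar>"
    by (auto simp del: mem_ball)
  \<comment> \<open>With this radius |x| < \<open>R\<close> implies |(x - b) / a| <
    \<open>R'\<close>, so a box around \<open>ball 0 R'\<close> is mapped onto a box around
    \<open>ball 0 R\<close>.\<close>
  define R' where "R' = (R + \<bar>b\<bar>) / \<bar>a\<bar>"
  show "\<exists>R>0. \<forall>u v. ball 0 R \<subseteq> cbox u v \<longrightarrow>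
    (\<exists>z. ((\<lambda>x. if x \<in> UNIV then f (a * x + b) else 0) has_integral z) (cbox u v) \<and>
         norm (z - (1 / \<bar>a\<bar>) *\<^sub>R i) < e)"
  proof (intro exI[of _ R'] conjI allI impI)
    show "R' > 0" using R a by (simp add: R'_def add_pos_nonneg)
    fix u v :: real assume uv: "ball 0 R' \<subseteq> cbox u v"
    let ?g = "\<lambda>x. a * x + b"
    obtain p q where pq: "?g ` cbox u v = cbox p q"
      using interval_image_affinity_interval[of a b u v] by auto
    have "x \<in> ?g ` cbox u v" if "x \<in> ball 0 R" for x
    proof (rule image_eqI)
      show "x = ?g ((x - b) / a)" using a by simp
      have "\<bar>x - b\<bar> < R + \<bar>b\<bar>" using that by (simp add: dist_real_def)
      then have "\<bar>(x - b) / a\<bar> < R'" using a by (simp add: R'_def divide_strict_right_mono)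
      then have "(x - b) / a \<in> ball 0 R'" by (simp only: mem_ball dist_real_def diff_0 abs_minus_cancel)
      then show "(x - b) / a \<in> cbox u v" using uv by blast
    qed
    then have "ball 0 R \<subseteq> cbox p q" using pq by auto
    from *[OF this] obtain z where z: "(f has_integral z) (cbox p q)" "norm (z - i) < e * \<bar>a\<bar>"
      by blast
    have "(\<lambda>x. (1 / a) *\<^sub>R x + - ((1 / a) *\<^sub>R b)) ` cbox p q = cbox u v"
      unfolding pq[symmetric] image_image using a by (simp add: field_simps)
    with has_integral_affinity[OF z(1) a, of b]
    have "((\<lambda>x. f (?g x)) has_integral (1 / \<bar>a\<bar>) *\<^sub>R z) (cbox u v)" by simp
    moreover have "norm ((1 / \<bar>a\<bar>) *\<^sub>R z - (1 / \<bar>a\<bar>) *\<^sub>R i) = norm (z - i) / \<bar>a\<bar>"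
      unfolding scaleR_diff_right[symmetric] norm_scaleR by simp
    moreover from this have "norm ((1 / \<bar>a\<bar>) *\<^sub>R z - (1 / \<bar>a\<bar>) *\<^sub>R i) < e"
      using z(2) a by (simp add: pos_divide_less_eq)
    ultimately show "\<exists>z. ((\<lambda>x. if x \<in> UNIV then f (a * x + b) else 0) has_integral z) (cbox u v) \<and>
         norm (z - (1 / \<bar>a\<bar>) *\<^sub>R i) < e"
      by (intro exI[of _ "(1 / \<bar>a\<bar>) *\<^sub>R z"]) simp
  qed
qed

lemma has_integral_affine:
  fixes f :: "real \<Rightarrow> 'a::banach"
  assumes "(f has_integral i) S" "a \<noteq> 0"
  shows "((\<lambda>x. f (a * x + b)) has_integral (1 / \<bar>a\<bar>) *\<^sub>R i) {x. a * x + b \<in> S}"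
  using has_integral_affine_UNIV[of "\<lambda>x. if x \<in> S then f x else 0" i a b] assms
  by (simp add: has_integral_restrict_UNIV
      has_integral_restrict_UNIV[of "{x. a * x + b \<in> S}", symmetric])

lemma has_integral_reflect_below:
  fixes f :: "real \<Rightarrow> 'a::banach"
  assumes "(f has_integral i) {0<..}"
  shows "((\<lambda>s. f (t - s)) has_integral i) {..<t}"
proof -
  have "{x. - 1 * x + t \<in> {0<..}} = {..<t}" by auto
  with has_integral_affine[OF assms, of "-1" t] show ?thesis by simp
qed

lemma has_integral_shift_above:
  fixes f :: "real \<Rightarrow> 'a::banach"
  assumes "(f has_integral i) {0<..}"
  shows "((\<lambda>s. f (s - t)) has_integral i) {t<..}"
proof -
  have "{x. 1 * x + - t \<in> {0<..}} = {t<..}" by auto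
  with has_integral_affine[OF assms, of 1 "- t"] show ?thesis by simp
qed

lemma has_integral_Ioi_iff_Ici:
  fixes f :: "real \<Rightarrow> 'a::banach"
  shows "(f has_integral i) {a<..} \<longleftrightarrow> (f has_integral i) {a..}"
  by (rule has_integral_spike_set_eq; rule negligible_subset[of "{a}"]) auto

section \<open>Dominated integrability with a singular endpoint\<close>

text \<open>Bochner integration being unavailable for a general Banach space, integrability near the
  singular endpoint comes from the fundamental theorem of calculus, whose primitive only has to
  be continuous there.\<close>

lemma integrable_Icc_dominated:
  fixes f :: "real \<Rightarrow> 'a::banach"
  assumes f: "continuous_on {0<..} f"
    and m: "m integrable_on {0..b}"
    and le: "\<And>x. 0 < x \<Longrightarrow> norm (f x) \<le> m x"
    and b: "0 < b"
  shows "f integrable_on {0..b}"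
proof -
  define F where "F x = integral {x..b} f" for x
  define G where "G x = integral {x..b} m" for x
  have int_f: "f integrable_on {x..y}" if "0 < x" for x y
    by (intro integrable_continuous_interval continuous_on_subset[OF f]) (use that in auto)
  have int_m: "m integrable_on {x..y}" if "0 \<le> x" "y \<le> b" for x y
    by (rule integrable_on_subinterval[OF m]) (use that in auto)
  \<comment> \<open>Increments of \<open>F\<close> are controlled by increments of \<open>G\<close>,
    so \<open>F\<close> inherits the uniform continuity that \<open>G\<close> has on the compact
    interval.\<close>
  have FG: "norm (F x - F y) \<le> norm (G x - G y)" if "0 < x" "x \<le> y" "y \<le> b" for x y
  proof -
    have "F x - F y = integral {x..y} f"
      using Henstock_Kurzweil_Integration.integral_combine[where a = x and c = y and b = b and f = f] that int_f by (simp add: F_def algebra_simps)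
    moreover have "G x - G y = integral {x..y} m"
      using Henstock_Kurzweil_Integration.integral_combine[where a = x and c = y and b = b and f = m] that int_m by (simp add: G_def algebra_simps)
    moreover have "norm (integral {x..y} f) \<le> integral {x..y} m"
      using that by (intro integral_norm_bound_integral int_f int_m) (auto intro!: le)
    ultimately show ?thesis by simp
  qed
  have "continuous_on {0..b} G"
    unfolding G_def by (rule indefinite_integral_continuous_1'[OF m])
  then have "uniformly_continuous_on {0..b} G"
    by (rule compact_uniformly_continuous) simp
  \<comment> \<open>Uniform continuity is what allows \<open>F\<close> to be extended continuously
    to 0; the extension \<open>g\<close> is the primitive.\<close>
  then have "uniformly_continuous_on {0<..b} F"
    unfolding uniformly_continuous_on_def dist_norm
  proof (intro allI impI, elim allE impE)
    fix e :: real assume "e > 0" then show "e > 0" .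
    assume "\<exists>d>0. \<forall>x\<in>{0..b}. \<forall>x'\<in>{0..b}. norm (x' - x) < d \<longrightarrow> norm (G x' - G x) < e"
    then obtain d where d: "d > 0"
      "\<And>x x'. x \<in> {0..b} \<Longrightarrow> x' \<in> {0..b} \<Longrightarrow> norm (x' - x) < d \<Longrightarrow> norm (G x' - G x) < e"
      by blast
    have "norm (F x' - F x) < e" if "x \<in> {0<..b}" "x' \<in> {0<..b}" "norm (x' - x) < d" for x x'
    proof (cases "x \<le> x'")
      case True
      then show ?thesis using FG[of x x'] d(2)[of x x'] that by (simp add: norm_minus_commute)
    next
      case False
      then show ?thesis using FG[of x' x] d(2)[of x x'] that by simp
    qed
    then show "\<exists>d>0. \<forall>x\<in>{0<..b}. \<forall>x'\<in>{0<..b}. norm (x' - x) < d \<longrightarrow> norm (F x' - F x) < e"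
      using d(1) by blast
  qed
  then obtain g where g: "uniformly_continuous_on (closure {0<..b}) g"
    "\<And>x. x \<in> {0<..b} \<Longrightarrow> F x = g x"
    by (rule uniformly_continuous_on_extension_on_closure) (rule that; simp)
  have "((\<lambda>x. - f x) has_integral (g b - g 0)) {0..b}"
  proof (rule fundamental_theorem_of_calculus_interior_strong[where S = "{}"])
    show "continuous_on {0..b} g"
      using uniformly_continuous_imp_continuous[OF g(1)] b by simp
    fix x assume x: "x \<in> {0<..<b} - {}"
    \<comment> \<open>The left end x/2 stays away from the singularity. The variable of
      \<open>F\<close> is the lower limit of integration, hence the minus sign.\<close>
    have "(F has_vector_derivative - f x) (at x within {x/2..b})"
      unfolding F_def
      by (rule integral_has_vector_derivative')
         (use x in \<open>auto intro!: continuous_on_subset[OF f]\<close>)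
    then have "(F has_vector_derivative - f x) (at x)"
      using at_within_interior[of x "{x/2..b}"] x by (simp add: interior_atLeastAtMost_real)
    then show "(g has_vector_derivative - f x) (at x)"
      by (rule has_vector_derivative_transform_within_open[of _ _ _ "{0<..<b}"])
         (use x g(2) in auto)
  qed (use b in auto)
  from has_integral_neg[OF this] show ?thesis by auto
qed

text \<open>The Cauchy criterion over large boxes passes from \<open>m\<close> to \<open>f\<close>.
  Both functions are extended by 0 to the left, so their integrals over two boxes around 0 differ by
  one integral over the gap between the right ends, and there \<open>m\<close> dominates.\<close>

lemma integrable_Ioi_dominated:
  fixes f :: "real \<Rightarrow> 'a::banach"
  assumes f: "continuous_on {0<..} f"
    and m: "m integrable_on {0<..}"
    and le: "\<And>x. 0 < x \<Longrightarrow> norm (f x) \<le> m x"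
  shows "f integrable_on {0<..}"
proof -
  let ?f = "\<lambda>x. if x \<in> {0<..} then f x else 0"
  let ?m = "\<lambda>x. if x \<in> {0<..} then m x else 0"
  have m1: "\<And>a b. ?m integrable_on cbox a b" and
    m2: "\<And>e. e > 0 \<Longrightarrow> \<exists>R>0. \<forall>a b c d. ball 0 R \<subseteq> cbox a b \<and> ball 0 R \<subseteq> cbox c d \<longrightarrow>
      norm (integral (cbox a b) ?m - integral (cbox c d) ?m) < e"
    using m unfolding integrable_alt[of m] by blast+
  have f_pos: "?f integrable_on {0..b}" if "b > 0" for b
  proof -
    have "m integrable_on {0..b}"
      by (rule integrable_spike[OF m1[of 0 b, unfolded box_real], of "{0}"]) auto
    from integrable_Icc_dominated[OF f this le that] have "f integrable_on {0..b}" .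
    then show ?thesis
      by (rule integrable_spike[of _ _ "{0}"]) auto
  qed
  have f1: "?f integrable_on {a..b}" for a b
  proof -
    define n where "n = \<bar>a\<bar> + \<bar>b\<bar> + 1"
    have "?f integrable_on {- n..0}"
      by (rule integrable_eq[OF integrable_0]) auto
    then have "?f integrable_on {- n..n}"
      using f_pos[of n] by (intro Henstock_Kurzweil_Integration.integrable_combine[where a = "- n" and c = 0 and b = n]) (auto simp: n_def)
    then show ?thesis
      by (rule integrable_on_subinterval) (auto simp: n_def)
  qed
  have bound: "norm (integral {a..b} ?f - integral {c..d} ?f)
      \<le> norm (integral {a..b} ?m - integral {c..d} ?m)"
    if "a \<le> 0" "c \<le> 0" "0 \<le> b" "b \<le> d" for a b c d
  proof -
    have split: "integral {c..d} h - integral {a..b} h = integral {b..d} h"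
      if h: "\<And>x. x \<le> 0 \<Longrightarrow> h x = 0" "\<And>a b. h integrable_on {a..b}"
      for h :: "real \<Rightarrow> 'c::banach"
    proof -
      have *: "integral {a..b} h = integral {0..b} h" if "a \<le> 0" "0 \<le> b" for a b
      proof -
        have "integral {a..0} h = integral {a..0} (\<lambda>_. 0)"
          by (rule integral_cong) (use h(1) in auto)
        then show ?thesis using Henstock_Kurzweil_Integration.integral_combine[where a = a and c = 0 and b = b and f = h] that h(2) by simp
      qed
      show ?thesis
        unfolding *[OF \<open>a \<le> 0\<close> \<open>0 \<le> b\<close>] *[OF \<open>c \<le> 0\<close> order_trans[OF \<open>0 \<le> b\<close> \<open>b \<le> d\<close>]]
        using Henstock_Kurzweil_Integration.integral_combine[OF \<open>0 \<le> b\<close> \<open>b \<le> d\<close> h(2)]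
        by (simp add: algebra_simps)
    qed
    have ef: "integral {c..d} ?f - integral {a..b} ?f = integral {b..d} ?f"
      by (rule split) (use f1 in auto)
    have em: "integral {c..d} ?m - integral {a..b} ?m = integral {b..d} ?m"
      by (rule split) (use m1 in auto)
    have "norm (integral {b..d} ?f) \<le> integral {b..d} ?m"
      by (rule integral_norm_bound_integral) (use f1 m1 le in auto)
    also have "\<dots> \<le> norm (integral {b..d} ?m)" by simp
    finally show ?thesis
      unfolding norm_minus_commute[of "integral {a..b} ?f"]
        norm_minus_commute[of "integral {a..b} ?m"] ef em .
  qed
  show ?thesis
    unfolding integrable_alt[of f]
  proof (intro conjI allI impI)
    fix e :: real assume "e > 0"
    from m2[OF this] obtain R where R: "R > 0"
      "\<And>a b c d. ball 0 R \<subseteq> cbox a b \<Longrightarrow> ball 0 R \<subseteq> cbox c d \<Longrightarrow>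
        norm (integral (cbox a b) ?m - integral (cbox c d) ?m) < e"
      by blast
    show "\<exists>R>0. \<forall>a b c d. ball 0 R \<subseteq> cbox a b \<and> ball 0 R \<subseteq> cbox c d \<longrightarrow>
      norm (integral (cbox a b) ?f - integral (cbox c d) ?f) < e"
    proof (intro exI[of _ R] conjI allI impI R(1), elim conjE)
      fix a b c d :: real assume *: "ball 0 R \<subseteq> cbox a b" "ball 0 R \<subseteq> cbox c d"
      moreover have "(0::real) \<in> ball 0 R" using R(1) by simp
      ultimately have "0 \<in> cbox a b" "0 \<in> cbox c d" by blast+
      then have 0: "a \<le> 0" "0 \<le> b" "c \<le> 0" "0 \<le> d" by auto
      show "norm (integral (cbox a b) ?f - integral (cbox c d) ?f) < e"
      proof (cases "b \<le> d")
        case True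
        then show ?thesis using bound[of a c b d] R(2)[OF *] 0 by simp
      next
        case False
        then show ?thesis using bound[of c a d b] R(2)[OF *(2,1)] 0
          by (simp add: norm_minus_commute)
      qed
    qed
  qed (use f1 in simp)
qed

text \<open>Euler's integral after the substitution of \<gamma> t for t. The exponents a = 1 -
  \<alpha> and a = \<beta> - \<alpha> produce the two Gamma terms of \<Theta>.\<close>

lemma has_integral_powr_exp:
  fixes a \<gamma> :: real
  assumes a: "a > 0" and g: "\<gamma> > 0"
  shows "((\<lambda>t. t powr (a - 1) * exp (- \<gamma> * t)) has_integral Gamma a / \<gamma> powr a) {0<..}"
proof -
  have "((\<lambda>t. t powr (a - 1) / exp t) has_integral Gamma a) {0<..}"
    using Gamma_integral_real[OF a] by (simp add: has_integral_Ioi_iff_Ici)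
  from has_integral_affine[OF this, of \<gamma> 0]
  have "((\<lambda>t. (\<gamma> * t) powr (a - 1) / exp (\<gamma> * t)) has_integral Gamma a / \<gamma>) {0<..}"
    using g by (simp add: zero_less_mult_iff greaterThan_def)
  then have "((\<lambda>t. \<gamma> powr (1 - a) * ((\<gamma> * t) powr (a - 1) / exp (\<gamma> * t)))
      has_integral \<gamma> powr (1 - a) * (Gamma a / \<gamma>)) {0<..}"
    by (rule has_integral_mult_right)
  moreover have "\<gamma> powr (1 - a) * (Gamma a / \<gamma>) = Gamma a / \<gamma> powr a"
    using g by (simp add: powr_diff)
  moreover have "\<gamma> powr (1 - a) * ((\<gamma> * t) powr (a - 1) / exp (\<gamma> * t))
      = t powr (a - 1) * exp (- \<gamma> * t)" if "t \<in> {0<..}" for t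
    using that g by (simp add: powr_mult exp_minus field_simps flip: powr_add)
  ultimately show ?thesis
    by (metis (no_types, lifting) has_integral_eq)
qed

section \<open>Almost periodic functions\<close>

definition relatively_dense :: "real set \<Rightarrow> bool"
  where "relatively_dense E \<longleftrightarrow> (\<exists>l>0. \<forall>a. \<exists>\<tau>\<in>{a..a + l}. \<tau> \<in> E)"

text \<open>Up to an element of \<open>E\<close> and an error \<open>\<eta>\<close>, only finitely many translations are left;
  by the pigeonhole principle this makes two relatively dense sets meet often enough.\<close>

lemma relatively_dense_finite_net:
  assumes "relatively_dense E" "0 < \<eta>"
  shows "\<exists>F. finite F \<and> (\<forall>t. \<exists>s\<in>F. \<exists>x\<in>E. \<bar>t - s - x\<bar> \<le> \<eta>)"
proof -
  obtain l where l: "l > 0" "\<And>a. \<exists>\<tau>\<in>{a..a + l}. \<tau> \<in> E"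
    using assms(1) unfolding relatively_dense_def by blast
  define F where "F = (\<lambda>n. real n * \<eta>) ` {..nat \<lfloor>l / \<eta>\<rfloor>}"
  have "\<exists>s\<in>F. \<exists>x\<in>E. \<bar>t - s - x\<bar> \<le> \<eta>" for t
  proof -
    obtain x where x: "x \<in> {t - l..t - l + l}" "x \<in> E" using l(2) by blast
    define n where "n = nat \<lfloor>(t - x) / \<eta>\<rfloor>"
    have "(t - x) / \<eta> \<ge> 0" using x assms(2) by simp
    then have n: "real n \<le> (t - x) / \<eta>" "(t - x) / \<eta> < real n + 1"
      unfolding n_def by linarith+
    have "(t - x) / \<eta> \<le> l / \<eta>" using x assms(2) by (intro divide_right_mono) auto
    then have "n \<le> nat \<lfloor>l / \<eta>\<rfloor>" unfolding n_def by (intro nat_mono floor_mono)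
    then have "real n * \<eta> \<in> F" unfolding F_def by blast
    moreover have "\<bar>t - real n * \<eta> - x\<bar> \<le> \<eta>"
      using n assms(2) by (simp add: field_simps abs_le_iff)
    ultimately show ?thesis using x by blast
  qed
  then show ?thesis by (intro exI[of _ F]) (simp add: F_def)
qed

text \<open>Two relatively dense sets may be disjoint, so the conclusion concerns sets that also
  absorb differences and small shifts. Every \<open>t\<close> belongs to one of finitely many
  classes \<open>s\<close>, which record its offsets from both sets up to \<eta>/2. Subtracting a
  fixed member of the same class cancels the offsets and leaves, for both sets at once, a difference
  of two elements up to \<eta>; as there are finitely many fixed members, the result stays within a
  bounded distance of \<open>t\<close>.\<close>

lemma relatively_dense_Int:
  assumes E1: "relatively_dense E\<^sub>1" and E2: "relatively_dense E\<^sub>2" and \<eta>: "0 < \<eta>"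
    and 1: "\<And>x x' y. x \<in> E\<^sub>1 \<Longrightarrow> x' \<in> E\<^sub>1 \<Longrightarrow> \<bar>y\<bar> \<le> \<eta> \<Longrightarrow> x - x' + y \<in> E\<^sub>1'"
    and 2: "\<And>x x' y. x \<in> E\<^sub>2 \<Longrightarrow> x' \<in> E\<^sub>2 \<Longrightarrow> \<bar>y\<bar> \<le> \<eta> \<Longrightarrow> x - x' + y \<in> E\<^sub>2'"
  shows "relatively_dense (E\<^sub>1' \<inter> E\<^sub>2')"
proof -
  obtain F1 where F1: "finite F1" "\<And>t. \<exists>s\<in>F1. \<exists>x\<in>E\<^sub>1. \<bar>t - s - x\<bar> \<le> \<eta> / 2"
    using relatively_dense_finite_net[OF E1, of "\<eta> / 2"] \<eta> by auto
  obtain F2 where F2: "finite F2" "\<And>t. \<exists>s\<in>F2. \<exists>x\<in>E\<^sub>2. \<bar>t - s - x\<bar> \<le> \<eta> / 2"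
    using relatively_dense_finite_net[OF E2, of "\<eta> / 2"] \<eta> by auto
  define R where "R t s = ((\<exists>x\<in>E\<^sub>1. \<bar>t - fst s - x\<bar> \<le> \<eta> / 2) \<and> (\<exists>x\<in>E\<^sub>2. \<bar>t - snd s - x\<bar> \<le> \<eta> / 2))"
    for t :: real and s :: "real \<times> real"
  \<comment> \<open>An empty class receives an arbitrary value, which can only enlarge
    \<open>N\<close>. The classes used below contain \<open>t\<close>, so their \<open>rep\<close>
    is a genuine member.\<close>
  define rep where "rep s = (SOME t. R t s)" for s
  define N where "N = insert 0 ((\<lambda>s. \<bar>rep s\<bar>) ` (F1 \<times> F2))"
  \<comment> \<open>Starting from t = a + Max N, subtracting \<open>rep s\<close> lands between a
    and a + 2 Max N; the 1 makes \<open>l\<close> positive.\<close>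
  define l where "l = 2 * Max N + 1"
  have fin: "finite N" using F1(1) F2(1) by (simp add: N_def)
  have N0: "0 \<le> Max N" using fin by (intro Max_ge) (auto simp: N_def)
  have "\<exists>\<tau>\<in>{a..a + l}. \<tau> \<in> E\<^sub>1' \<inter> E\<^sub>2'" for a
  proof -
    define t where "t = a + Max N"
    obtain s where s: "s \<in> F1 \<times> F2" "R t s"
      using F1(2)[of t] F2(2)[of t] unfolding R_def by fastforce
    then have R: "R (rep s) s" unfolding rep_def by (metis someI)
    have "\<bar>rep s\<bar> \<le> Max N" using s fin by (intro Max_ge) (auto simp: N_def)
    then have "t - rep s \<in> {a..a + l}" by (auto simp: t_def l_def)
    moreover have "t - rep s \<in> E\<^sub>1'"
    proof -
      obtain x x' where x: "x \<in> E\<^sub>1" "x' \<in> E\<^sub>1" "\<bar>t - fst s - x\<bar> \<le> \<eta> / 2" "\<bar>rep s - fst s - x'\<bar> \<le> \<eta> / 2"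
        using s(2) R unfolding R_def by blast
      have "\<bar>t - rep s - (x - x')\<bar> \<le> \<eta>" using x(3,4) by linarith
      with x(1,2) have "x - x' + (t - rep s - (x - x')) \<in> E\<^sub>1'" by (rule 1)
      then show ?thesis by simp
    qed
    moreover have "t - rep s \<in> E\<^sub>2'"
    proof -
      obtain x x' where x: "x \<in> E\<^sub>2" "x' \<in> E\<^sub>2" "\<bar>t - snd s - x\<bar> \<le> \<eta> / 2" "\<bar>rep s - snd s - x'\<bar> \<le> \<eta> / 2"
        using s(2) R unfolding R_def by blast
      have "\<bar>t - rep s - (x - x')\<bar> \<le> \<eta>" using x(3,4) by linarith
      with x(1,2) have "x - x' + (t - rep s - (x - x')) \<in> E\<^sub>2'" by (rule 2)
      then show ?thesis by simp
    qed
    ultimately show ?thesis by blast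
  qed
  then show ?thesis
    unfolding relatively_dense_def using N0 by (intro exI[of _ l]) (auto simp: l_def)
qed

text \<open>Bohr's \<epsilon>-translation numbers, uniform over a parameter set: a singleton for
  functions of time alone, a compact set for functions in \<open>AP_unif\<close>.\<close>

definition translation_numbers ::
    "'i set \<Rightarrow> (real \<Rightarrow> 'i \<Rightarrow> 'z::real_normed_vector) \<Rightarrow> real \<Rightarrow> real set"
  where "translation_numbers I H \<epsilon> = {\<tau>. \<forall>t. \<forall>i\<in>I. norm (H (t + \<tau>) i - H t i) < \<epsilon>}"

text \<open>The second clause is uniform continuity in time, phrased as a supply of small
  translation numbers because that is the form of the shift \<open>y\<close> in
  \<open>relatively_dense_Int\<close>.\<close>

definition almost_periodic_on :: "'i set \<Rightarrow> (real \<Rightarrow> 'i \<Rightarrow> 'z::real_normed_vector) \<Rightarrow> bool"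
  where "almost_periodic_on I H \<longleftrightarrow> (\<forall>\<epsilon>>0. relatively_dense (translation_numbers I H \<epsilon>) \<and>
    (\<exists>\<eta>>0. \<forall>y. \<bar>y\<bar> \<le> \<eta> \<longrightarrow> y \<in> translation_numbers I H \<epsilon>))"

lemma translation_numbers_combine:
  assumes "x \<in> translation_numbers I H (\<epsilon> / 3)" "x' \<in> translation_numbers I H (\<epsilon> / 3)"
    "y \<in> translation_numbers I H (\<epsilon> / 3)"
  shows "x - x' + y \<in> translation_numbers I H \<epsilon>"
  unfolding translation_numbers_def
proof (intro CollectI allI ballI)
  fix t i assume i: "i \<in> I"
  \<comment> \<open>The shift is travelled through t, t + y, t + y - x' and t + y - x' + x, at a
    cost below \<epsilon>/3 per leg.\<close>
  have "norm (H (t - x' + y + x) i - H (t - x' + y) i) < \<epsilon> / 3"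
    "norm (H (t - x' + y + x') i - H (t - x' + y) i) < \<epsilon> / 3"
    "norm (H (t + y) i - H t i) < \<epsilon> / 3"
    using assms i unfolding translation_numbers_def by blast+
  then show "norm (H (t + (x - x' + y)) i - H t i) < \<epsilon>"
    using norm_triangle_ineq[of "H (t - x' + y + x) i - H (t - x' + y) i"
        "H (t - x' + y) i - H (t + y) i"]
      norm_triangle_ineq[of "H (t - x' + y + x) i - H (t + y) i" "H (t + y) i - H t i"]
    by (simp add: algebra_simps norm_minus_commute)
qed

lemma almost_periodic_on_common:
  assumes H: "almost_periodic_on I H" and G: "almost_periodic_on J G" and \<epsilon>: "0 < \<epsilon>"
  shows "relatively_dense (translation_numbers I H \<epsilon> \<inter> translation_numbers J G \<epsilon>)"
proof -
  have \<epsilon>3: "\<epsilon> / 3 > 0" using \<epsilon> by simp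
  obtain \<eta>1 where 1: "\<eta>1 > 0" "\<And>y. \<bar>y\<bar> \<le> \<eta>1 \<Longrightarrow> y \<in> translation_numbers I H (\<epsilon> / 3)"
    using H \<epsilon>3 unfolding almost_periodic_on_def by blast
  obtain \<eta>2 where 2: "\<eta>2 > 0" "\<And>y. \<bar>y\<bar> \<le> \<eta>2 \<Longrightarrow> y \<in> translation_numbers J G (\<epsilon> / 3)"
    using G \<epsilon>3 unfolding almost_periodic_on_def by blast
  show ?thesis
  proof (rule relatively_dense_Int[where \<eta> = "min \<eta>1 \<eta>2"])
    show "relatively_dense (translation_numbers I H (\<epsilon> / 3))"
      "relatively_dense (translation_numbers J G (\<epsilon> / 3))"
      using H G \<epsilon>3 unfolding almost_periodic_on_def by blast+
  qed (use 1 2 in \<open>auto intro!: translation_numbers_combine\<close>)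
qed

text \<open>An almost period carries any time into a window of fixed length, where joint continuity
  is uniform by compactness; two further errors of \<epsilon>/3 pay for going there and
  back.\<close>

lemma AP_unif_equicontinuous:
  assumes G: "G \<in> AP_unif" and K: "compact K" and \<epsilon>: "0 < \<epsilon>"
  shows "\<exists>d>0. \<forall>t t'. \<forall>y\<in>K. \<forall>y'\<in>K. \<bar>t - t'\<bar> < d \<longrightarrow> norm (y - y') < d \<longrightarrow>
    norm (G t y - G t' y') < \<epsilon>"
proof -
  have "\<epsilon> / 3 > 0" using \<epsilon> by simp
  then obtain l where l: "l > 0"
    "\<And>a. \<exists>\<tau>\<in>{a..a + l}. \<forall>t. \<forall>y\<in>K. norm (G (t + \<tau>) y - G t y) < \<epsilon> / 3"
    using G K unfolding AP_unif_def by blast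
  \<comment> \<open>The point t + \<tau> lies in [0, l]; the margin 1 leaves room for t' +
    \<tau>.\<close>
  have "continuous_on ({- 1..l + 1} \<times> K) (\<lambda>(t, y). G t y)"
    using G unfolding AP_unif_def by (auto intro: continuous_on_subset)
  then have "uniformly_continuous_on ({- 1..l + 1} \<times> K) (\<lambda>(t, y). G t y)"
    by (rule compact_uniformly_continuous) (intro compact_Times compact_Icc K)
  then obtain d where d: "d > 0" "\<And>p q. p \<in> {- 1..l + 1} \<times> K \<Longrightarrow> q \<in> {- 1..l + 1} \<times> K \<Longrightarrow>
      dist p q < d \<Longrightarrow> dist (case p of (t, y) \<Rightarrow> G t y) (case q of (t, y) \<Rightarrow> G t y) < \<epsilon> / 3"
    using \<open>\<epsilon> / 3 > 0\<close> unfolding uniformly_continuous_on_def by (metis dist_commute)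
  have "norm (G t y - G t' y') < \<epsilon>"
    if y: "y \<in> K" "y' \<in> K" and t: "\<bar>t - t'\<bar> < min 1 (d / 2)" and yy: "norm (y - y') < min 1 (d / 2)"
    for t t' y y'
  proof -
    obtain \<tau> where \<tau>: "\<tau> \<in> {- t..- t + l}" "\<And>t y. y \<in> K \<Longrightarrow> norm (G (t + \<tau>) y - G t y) < \<epsilon> / 3"
      using l(2) by blast
    have "dist (t + \<tau>, y) (t' + \<tau>, y') \<le> dist (t + \<tau>) (t' + \<tau>) + dist y y'"
      unfolding dist_Pair_Pair by (rule sqrt_sum_squares_le_sum) auto
    also have "\<dots> < d" using t yy by (simp add: dist_norm)
    finally have "dist (G (t + \<tau>) y) (G (t' + \<tau>) y') < \<epsilon> / 3"
      using d(2)[of "(t + \<tau>, y)" "(t' + \<tau>, y')"] \<tau>(1) t y by (auto simp: abs_less_iff)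
    moreover note \<tau>(2)[OF y(1), of t] \<tau>(2)[OF y(2), of t']
    ultimately show ?thesis
      using norm_triangle_ineq[of "G t y - G (t + \<tau>) y" "G (t + \<tau>) y - G (t' + \<tau>) y'"]
        norm_triangle_ineq[of "G t y - G (t' + \<tau>) y'" "G (t' + \<tau>) y' - G t' y'"]
      by (simp add: dist_norm norm_minus_commute)
  qed
  then show ?thesis using d(1) by (intro exI[of _ "min 1 (d / 2)"]) auto
qed

lemma AP_unif_almost_periodic_on:
  assumes G: "G \<in> AP_unif" and K: "compact K"
  shows "almost_periodic_on K G"
  unfolding almost_periodic_on_def
proof (intro allI impI conjI)
  fix \<epsilon> :: real assume \<epsilon>: "\<epsilon> > 0"
  have "\<exists>l>0. \<forall>a. \<exists>\<tau>\<in>{a..a + l}. \<forall>t. \<forall>y\<in>K. norm (G (t + \<tau>) y - G t y) < \<epsilon>"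
    using G K \<epsilon> by (simp add: AP_unif_def)
  then show "relatively_dense (translation_numbers K G \<epsilon>)"
    by (simp add: relatively_dense_def translation_numbers_def)
  obtain d where d: "d > 0" "\<And>t t' y y'. y \<in> K \<Longrightarrow> y' \<in> K \<Longrightarrow> \<bar>t - t'\<bar> < d \<Longrightarrow>
      norm (y - y') < d \<Longrightarrow> norm (G t y - G t' y') < \<epsilon>"
    using AP_unif_equicontinuous[OF G K \<epsilon>] by blast
  show "\<exists>\<eta>>0. \<forall>y. \<bar>y\<bar> \<le> \<eta> \<longrightarrow> y \<in> translation_numbers K G \<epsilon>"
    using d by (intro exI[of _ "d / 2"]) (auto simp: translation_numbers_def)
qed

text \<open>A dummy real parameter lets functions of time alone inherit the results on
  \<open>AP_unif\<close>.\<close>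

lemma AP_imp_AP_unif:
  assumes "h \<in> AP"
  shows "(\<lambda>t (y::real). h t) \<in> AP_unif"
  unfolding AP_unif_def
proof (intro CollectI conjI allI impI)
  show "continuous_on UNIV (\<lambda>(t, y::real). h t)"
    using assms unfolding AP_def case_prod_unfold
    by (auto intro!: continuous_on_compose2[of UNIV h] continuous_intros)
  fix \<epsilon> :: real and K :: "real set" assume "\<epsilon> > 0"
  with assms have "\<exists>l>0. \<forall>a. \<exists>\<tau>\<in>{a..a + l}. \<forall>t. norm (h (t + \<tau>) - h t) < \<epsilon>"
    by (simp add: AP_def)
  then show "\<exists>l>0. \<forall>a. \<exists>\<tau>\<in>{a..a + l}. \<forall>t. \<forall>y\<in>K. norm (h (t + \<tau>) - h t) < \<epsilon>"
    by meson
qed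

lemma AP_almost_periodic_on: "h \<in> AP \<Longrightarrow> almost_periodic_on {0::real} (\<lambda>t _. h t)"
  by (intro AP_unif_almost_periodic_on AP_imp_AP_unif compact_sing)

lemma AP_uniformly_continuous:
  assumes "h \<in> AP" "0 < \<epsilon>"
  shows "\<exists>d>0. \<forall>t t'. \<bar>t - t'\<bar> < d \<longrightarrow> norm (h t - h t') < \<epsilon>"
proof -
  obtain d where "d > 0" "\<forall>t t'. \<forall>y\<in>{0}. \<forall>y'\<in>{0::real}. \<bar>t - t'\<bar> < d \<longrightarrow> norm (y - y') < d \<longrightarrow>
      norm (h t - h t') < \<epsilon>"
    using AP_unif_equicontinuous[OF AP_imp_AP_unif[OF assms(1)], of "{0}" \<epsilon>] assms(2) by auto
  then show ?thesis by (intro exI[of _ d]) simp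
qed

section \<open>Closure properties of almost periodic functions\<close>

lemma AP_continuous: "h \<in> AP \<Longrightarrow> continuous_on UNIV h"
  by (simp add: AP_def)

lemma AP_I:
  assumes "continuous_on UNIV h"
    and "\<And>\<epsilon>. 0 < \<epsilon> \<Longrightarrow> \<exists>E. relatively_dense E \<and> (\<forall>\<tau>\<in>E. \<forall>t. norm (h (t + \<tau>) - h t) < \<epsilon>)"
  shows "h \<in> AP"
  unfolding AP_def relatively_dense_def
proof (intro CollectI conjI allI impI)
  fix \<epsilon> :: real assume "\<epsilon> > 0"
  with assms(2) obtain E where "relatively_dense E" "\<forall>\<tau>\<in>E. \<forall>t. norm (h (t + \<tau>) - h t) < \<epsilon>"
    by blast
  then show "\<exists>l>0. \<forall>a. \<exists>\<tau>\<in>{a..a + l}. \<forall>t. norm (h (t + \<tau>) - h t) < \<epsilon>"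
    unfolding relatively_dense_def by blast
qed (rule assms(1))

lemma AP_relatively_dense:
  assumes "h \<in> AP" "0 < \<epsilon>"
  shows "relatively_dense {\<tau>. \<forall>t. norm (h (t + \<tau>) - h t) < \<epsilon>}"
proof -
  have "\<exists>l>0. \<forall>a. \<exists>\<tau>\<in>{a..a + l}. \<forall>t. norm (h (t + \<tau>) - h t) < \<epsilon>"
    using assms by (simp add: AP_def)
  then show ?thesis by (simp add: relatively_dense_def)
qed

text \<open>Almost periods bring every value close to one taken on [0, l], so a finite net of the
  compact image of that interval is a coarser net of the whole range. Compactness is what makes the
  uniformity in \<open>AP_unif\<close> applicable along an orbit.\<close>

lemma AP_compact_closure_range:
  assumes h: "h \<in> AP"
  shows "compact (closure (range h))"
proof -
  have "\<exists>k. finite k \<and> closure (range h) \<subseteq> (\<Union>x\<in>k. ball x e)" if e: "e > 0" for e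
  proof -
    have "e / 3 > 0" using e by simp
    from AP_relatively_dense[OF h this] obtain l where
      l: "l > 0" "\<And>a. \<exists>\<tau>\<in>{a..a + l}. \<forall>t. norm (h (t + \<tau>) - h t) < e / 3"
      unfolding relatively_dense_def by blast
    have "compact (h ` {0..l})"
      using AP_continuous[OF h] by (intro compact_continuous_image) (auto intro: continuous_on_subset)
    then obtain k where k: "finite k" "h ` {0..l} \<subseteq> (\<Union>x\<in>k. ball x (e / 3))"
      using \<open>e / 3 > 0\<close> compact_eq_totally_bounded[of "h ` {0..l}"] by blast
    \<comment> \<open>Closed balls of an intermediate radius form a closed union, so the inclusion
      passes to the closure before the radius grows to \<open>e\<close>.\<close>
    have "range h \<subseteq> (\<Union>x\<in>k. cball x (2 * e / 3))"
    proof safe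
      fix t
      obtain \<tau> where \<tau>: "\<tau> \<in> {- t..- t + l}" "norm (h (t + \<tau>) - h t) < e / 3" using l(2) by blast
      then have "h (t + \<tau>) \<in> h ` {0..l}" by auto
      then obtain x where x: "x \<in> k" "dist x (h (t + \<tau>)) < e / 3" using k(2) by force
      then have "dist x (h t) \<le> 2 * e / 3"
        using \<tau>(2) dist_triangle[of x "h t" "h (t + \<tau>)"] by (simp add: dist_norm)
      then show "h t \<in> (\<Union>x\<in>k. cball x (2 * e / 3))" using x by auto
    qed
    moreover have "closed (\<Union>x\<in>k. cball x (2 * e / 3))" using k(1) by (intro closed_UN) auto
    ultimately have "closure (range h) \<subseteq> (\<Union>x\<in>k. cball x (2 * e / 3))" by (rule closure_minimal)
    also have "\<dots> \<subseteq> (\<Union>x\<in>k. ball x e)" using e by force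
    finally show ?thesis using k(1) by blast
  qed
  then show ?thesis
    unfolding compact_eq_totally_bounded by (simp add: complete_eq_closed)
qed

lemma AP_bounded: "h \<in> AP \<Longrightarrow> bounded (range h)"
  using bounded_subset[OF compact_imp_bounded[OF AP_compact_closure_range] closure_subset] .

text \<open>The two functions come with different almost periods;
  \<open>almost_periodic_on_common\<close> supplies enough that serve both.\<close>

lemma AP_add:
  assumes "h \<in> AP" "k \<in> AP"
  shows "(\<lambda>t. h t + k t) \<in> AP"
proof (rule AP_I)
  fix \<epsilon> :: real assume "\<epsilon> > 0"
  then have "\<epsilon> / 2 > 0" by simp
  note rd = almost_periodic_on_common[OF AP_almost_periodic_on[OF assms(1)]
      AP_almost_periodic_on[OF assms(2)] this]
  have "norm (h (t + \<tau>) + k (t + \<tau>) - (h t + k t)) < \<epsilon>"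
    if "norm (h (t + \<tau>) - h t) < \<epsilon> / 2" "norm (k (t + \<tau>) - k t) < \<epsilon> / 2" for t \<tau>
    using norm_add_less[OF that] by (simp add: algebra_simps)
  with rd show "\<exists>E. relatively_dense E \<and>
      (\<forall>\<tau>\<in>E. \<forall>t. norm (h (t + \<tau>) + k (t + \<tau>) - (h t + k t)) < \<epsilon>)"
    by (intro exI[of _ "_ \<inter> _"] conjI) (assumption, simp add: translation_numbers_def)
qed (intro continuous_intros AP_continuous assms)

lemma AP_lipschitz_comp:
  assumes h: "h \<in> AP" and L: "\<And>x y. norm (F x - F y) \<le> L * norm (x - y)"
  shows "(\<lambda>t. F (h t)) \<in> AP"
proof (rule AP_I)
  have L': "norm (F x - F y) \<le> (\<bar>L\<bar> + 1) * norm (x - y)" for x y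
    by (rule order_trans[OF L]) (intro mult_right_mono, auto)
  have "(\<bar>L\<bar> + 1)-lipschitz_on UNIV F"
    by (rule lipschitz_onI) (use L' in \<open>auto simp: dist_norm\<close>)
  then have "continuous_on UNIV F" by (rule lipschitz_on_continuous_on)
  then show "continuous_on UNIV (\<lambda>t. F (h t))"
    using AP_continuous[OF h] continuous_on_compose2[of UNIV F UNIV h] by auto
  fix \<epsilon> :: real assume "\<epsilon> > 0"
  then have \<epsilon>: "\<epsilon> / (\<bar>L\<bar> + 1) > 0" by (simp add: add_nonneg_pos)
  have "norm (F x - F y) < \<epsilon>" if "norm (x - y) < \<epsilon> / (\<bar>L\<bar> + 1)" for x y
    using L'[of x y] that by (simp add: field_simps add_nonneg_pos)
  with AP_relatively_dense[OF h \<epsilon>]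
  show "\<exists>E. relatively_dense E \<and> (\<forall>\<tau>\<in>E. \<forall>t. norm (F (h (t + \<tau>)) - F (h t)) < \<epsilon>)"
    by blast
qed

lemma AP_uniform_limit:
  assumes "\<And>\<epsilon>. 0 < \<epsilon> \<Longrightarrow> \<exists>g\<in>AP. \<forall>t. norm (h t - g t) \<le> \<epsilon>"
  shows "h \<in> AP"
proof -
  have *: "\<exists>g\<in>AP. \<forall>t. norm (h t - g t) < \<epsilon>" if \<epsilon>: "\<epsilon> > 0" for \<epsilon>
  proof -
    obtain g where "g \<in> AP" "\<forall>t. norm (h t - g t) \<le> \<epsilon> / 2"
      using assms[OF half_gt_zero[OF \<epsilon>]] by blast
    moreover have "\<epsilon> / 2 < \<epsilon>" using \<epsilon> by simp
    ultimately have "\<forall>t. norm (h t - g t) < \<epsilon>" using order_le_less_trans by blast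
    with \<open>g \<in> AP\<close> show ?thesis by (intro bexI[of _ g])
  qed
  have near: "norm (h t - h s) < \<epsilon>"
    if "norm (h t - g t) < \<epsilon> / 3" "norm (h s - g s) < \<epsilon> / 3" "norm (g t - g s) < \<epsilon> / 3" for g t s \<epsilon>
    using that norm_triangle_ineq[of "h t - g t" "g t - g s"]
      norm_triangle_ineq[of "h t - g s" "g s - h s"] by (simp add: norm_minus_commute)
  show ?thesis
  proof (rule AP_I)
    show "continuous_on UNIV h"
      unfolding continuous_on_iff dist_norm
    proof (intro ballI allI impI)
      fix s \<epsilon> :: real assume "\<epsilon> > 0"
      then have \<epsilon>: "\<epsilon> / 3 > 0" by simp
      obtain g where g: "g \<in> AP" "\<And>t. norm (h t - g t) < \<epsilon> / 3" using *[OF \<epsilon>] by blast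
      from AP_continuous[OF g(1)] \<epsilon> obtain d where "d > 0" "\<And>t. norm (t - s) < d \<Longrightarrow> norm (g t - g s) < \<epsilon> / 3"
        unfolding continuous_on_iff dist_norm by blast
      then show "\<exists>d>0. \<forall>t\<in>UNIV. norm (t - s) < d \<longrightarrow> norm (h t - h s) < \<epsilon>"
        using near g(2) by blast
    qed
    fix \<epsilon> :: real assume "\<epsilon> > 0"
    then have \<epsilon>: "\<epsilon> / 3 > 0" by simp
    obtain g where g: "g \<in> AP" "\<And>t. norm (h t - g t) < \<epsilon> / 3" using *[OF \<epsilon>] by blast
    show "\<exists>E. relatively_dense E \<and> (\<forall>\<tau>\<in>E. \<forall>t. norm (h (t + \<tau>) - h t) < \<epsilon>)"
      using AP_relatively_dense[OF g(1) \<epsilon>] near g(2) by blast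
  qed
qed

text \<open>Shift the time in \<open>G\<close> while the second argument stays at a point of the
  compact set \<open>K\<close>, then change that argument by equicontinuity. Both steps must use the
  same \<tau>, hence common translation numbers of \<open>G\<close> on \<open>K\<close> and of
  \<open>v\<close>.\<close>

lemma AP_unif_comp:
  assumes G: "G \<in> AP_unif" and v: "v \<in> AP"
  shows "(\<lambda>t. G t (v t)) \<in> AP"
proof (rule AP_I)
  have G': "continuous_on UNIV (\<lambda>(t, y). G t y)" using G by (simp add: AP_unif_def)
  show "continuous_on UNIV (\<lambda>t. G t (v t))"
    using continuous_on_compose2[OF G', of UNIV "\<lambda>t. (t, v t)"]
      continuous_on_Pair[OF continuous_on_id AP_continuous[OF v]] by simp
  define K where "K = closure (range v)"
  have K: "compact K" unfolding K_def by (rule AP_compact_closure_range[OF v])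
  have vK: "v t \<in> K" for t unfolding K_def by (rule subsetD[OF closure_subset]) simp
  fix \<epsilon> :: real assume "\<epsilon> > 0"
  then have \<epsilon>: "\<epsilon> / 2 > 0" by simp
  obtain d where d: "d > 0" "\<And>t t' y y'. y \<in> K \<Longrightarrow> y' \<in> K \<Longrightarrow> \<bar>t - t'\<bar> < d \<Longrightarrow>
      norm (y - y') < d \<Longrightarrow> norm (G t y - G t' y') < \<epsilon> / 2"
    using AP_unif_equicontinuous[OF G K \<epsilon>] by blast
  \<comment> \<open>The entry \<open>d\<close> serves the shift of \<open>v\<close>, the entry
    \<epsilon>/2 the shift of \<open>G\<close>.\<close>
  have pos: "min d (\<epsilon> / 2) > 0" using d(1) \<epsilon> by simp
  note rd = almost_periodic_on_common[OF AP_unif_almost_periodic_on[OF G K] AP_almost_periodic_on[OF v] pos]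
  have "norm (G (t + \<tau>) (v (t + \<tau>)) - G t (v t)) < \<epsilon>"
    if "norm (G (t + \<tau>) (v (t + \<tau>)) - G t (v (t + \<tau>))) < \<epsilon> / 2" "norm (v (t + \<tau>) - v t) < d" for t \<tau>
    using norm_add_less[OF that(1) d(2)[of "v (t + \<tau>)" "v t" t t]] that(2) d(1) vK by simp
  with rd vK show "\<exists>E. relatively_dense E \<and> (\<forall>\<tau>\<in>E. \<forall>t. norm (G (t + \<tau>) (v (t + \<tau>)) - G t (v t)) < \<epsilon>)"
    by (intro exI[of _ "_ \<inter> _"] conjI) (assumption, simp add: translation_numbers_def)
qed

section \<open>Ergodic perturbations\<close>

definition mean_over :: "(real \<Rightarrow> 'z::banach) \<Rightarrow> real \<Rightarrow> real"
  where "mean_over h r = 1 / (2 * r) * integral {- r..r} (\<lambda>s. norm (h s))"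

lemma AP0_iff: "h \<in> AP0 \<longleftrightarrow>
    continuous_on UNIV h \<and> bounded (range h) \<and> (mean_over h \<longlongrightarrow> 0) at_top"
  by (simp add: AP0_def mean_over_def[abs_def])

lemma mean_over_nonneg: "0 \<le> r \<Longrightarrow> 0 \<le> mean_over h r"
  unfolding mean_over_def by (cases "(\<lambda>s. norm (h s)) integrable_on {- r..r}")
    (simp_all add: integral_nonneg not_integrable_integral)

lemma mean_over_mono:
  assumes "continuous_on UNIV h" "continuous_on UNIV k" "\<And>t. norm (h t) \<le> norm (k t)" "0 \<le> r"
  shows "mean_over h r \<le> mean_over k r"
  unfolding mean_over_def
  by (intro mult_left_mono integral_le integrable_continuous_interval continuous_intros
      continuous_on_subset[OF assms(1)] continuous_on_subset[OF assms(2)]) (use assms in auto)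

lemma mean_over_add_le:
  assumes "continuous_on UNIV h" "continuous_on UNIV k" "0 \<le> r"
  shows "mean_over (\<lambda>t. h t + k t) r \<le> mean_over h r + mean_over k r"
proof -
  note cont = continuous_on_subset[OF assms(1)] continuous_on_subset[OF assms(2)]
  have "integral {- r..r} (\<lambda>t. norm (h t + k t)) \<le> integral {- r..r} (\<lambda>t. norm (h t) + norm (k t))"
    by (intro integral_le integrable_continuous_interval continuous_intros cont norm_triangle_ineq) auto
  also have "\<dots> = integral {- r..r} (\<lambda>t. norm (h t)) + integral {- r..r} (\<lambda>t. norm (k t))"
    by (intro Henstock_Kurzweil_Integration.integral_add integrable_continuous_interval continuous_intros cont) auto
  finally show ?thesis
    using assms(3) unfolding mean_over_def distrib_left[symmetric] by (intro mult_left_mono) auto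
qed

lemma mean_over_const: "0 < r \<Longrightarrow> mean_over (\<lambda>_. c :: real) r = \<bar>c\<bar>"
  by (simp add: mean_over_def)

lemma AP0_continuous: "h \<in> AP0 \<Longrightarrow> continuous_on UNIV h"
  and AP0_bounded: "h \<in> AP0 \<Longrightarrow> bounded (range h)"
  and AP0_mean: "h \<in> AP0 \<Longrightarrow> (mean_over h \<longlongrightarrow> 0) at_top"
  by (simp_all add: AP0_iff)

text \<open>The majorant may change with \<epsilon>. This accommodates finite nets and uniform
  limits, where a finer approximation brings a different ergodic term.\<close>

lemma AP0_dominated:
  assumes h: "continuous_on UNIV h"
    and dom: "\<And>\<epsilon>. 0 < \<epsilon> \<Longrightarrow> \<exists>\<phi>. \<phi> \<in> (AP0 :: (real \<Rightarrow> real) set) \<and> (\<forall>t. norm (h t) \<le> \<epsilon> + \<phi> t)"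
  shows "h \<in> AP0"
  unfolding AP0_iff
proof (intro conjI h)
  obtain \<phi> where \<phi>: "\<phi> \<in> (AP0 :: (real \<Rightarrow> real) set)" "\<And>t. norm (h t) \<le> 1 + \<phi> t"
    using dom[of 1] by auto
  obtain M where "\<And>t. norm (\<phi> t) \<le> M" using AP0_bounded[OF \<phi>(1)] unfolding bounded_iff by auto
  then have "norm (h t) \<le> 1 + M" for t using \<phi>(2)[of t] by (smt (verit) real_norm_def)
  then show "bounded (range h)" unfolding bounded_iff by blast
  show "(mean_over h \<longlongrightarrow> 0) at_top"
  proof (rule tendstoI)
    fix e :: real assume e: "e > 0"
    then obtain \<phi> where \<phi>: "\<phi> \<in> (AP0 :: (real \<Rightarrow> real) set)" "\<And>t. norm (h t) \<le> e / 2 + \<phi> t"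
      using dom[of "e / 2"] by auto
    have "e / 2 > 0" using e by simp
    with AP0_mean[OF \<phi>(1)] have "\<forall>\<^sub>F r in at_top. dist (mean_over \<phi> r) 0 < e / 2" by (rule tendstoD)
    with eventually_gt_at_top[of 0] show "\<forall>\<^sub>F r in at_top. dist (mean_over h r) 0 < e"
    proof eventually_elim
      fix r :: real assume r: "0 < r" "dist (mean_over \<phi> r) 0 < e / 2"
      have "mean_over h r \<le> mean_over (\<lambda>t. e / 2 + \<phi> t) r"
        by (rule mean_over_mono)
          (use h AP0_continuous[OF \<phi>(1)] \<phi>(2) r in \<open>auto intro!: continuous_intros order_trans[OF \<phi>(2)]\<close>)
      also have "\<dots> \<le> mean_over (\<lambda>_. e / 2) r + mean_over \<phi> r"
        by (rule mean_over_add_le) (use AP0_continuous[OF \<phi>(1)] r in auto)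
      also have "\<dots> < e" using r e by (simp add: mean_over_const dist_real_def)
      finally show "dist (mean_over h r) 0 < e"
        using mean_over_nonneg[of r h] r by (simp add: dist_real_def)
    qed
  qed
qed

lemma AP0_norm: "h \<in> AP0 \<Longrightarrow> (\<lambda>t. norm (h t)) \<in> AP0"
  by (auto simp: AP0_def bounded_iff intro!: continuous_intros)

lemma AP0_add:
  assumes "h \<in> AP0" "k \<in> AP0"
  shows "(\<lambda>t. h t + k t) \<in> AP0"
  unfolding AP0_iff
proof (intro conjI)
  show "continuous_on UNIV (\<lambda>t. h t + k t)"
    by (intro continuous_intros AP0_continuous assms)
  show "bounded (range (\<lambda>t. h t + k t))"
    by (intro bounded_plus_comp AP0_bounded assms)
  have "((\<lambda>r. mean_over h r + mean_over k r) \<longlongrightarrow> 0) at_top"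
    using tendsto_add[OF AP0_mean[OF assms(1)] AP0_mean[OF assms(2)]] by simp
  then show "(mean_over (\<lambda>t. h t + k t) \<longlongrightarrow> 0) at_top"
  proof (rule tendsto_sandwich[OF _ _ tendsto_const, rotated 2])
    show "\<forall>\<^sub>F r in at_top. 0 \<le> mean_over (\<lambda>t. h t + k t) r"
      using eventually_ge_at_top[of 0] by eventually_elim (rule mean_over_nonneg)
    show "\<forall>\<^sub>F r in at_top. mean_over (\<lambda>t. h t + k t) r \<le> mean_over h r + mean_over k r"
      using eventually_ge_at_top[of 0]
      by eventually_elim (intro mean_over_add_le AP0_continuous assms)
  qed
qed

lemma AP0_cmult: "\<phi> \<in> AP0 \<Longrightarrow> (\<lambda>t. c * \<phi> t) \<in> AP0" for c :: real
proof -
  assume \<phi>: "\<phi> \<in> AP0"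
  have "mean_over (\<lambda>t. c * \<phi> t) = (\<lambda>r. \<bar>c\<bar> * mean_over \<phi> r)"
    by (simp add: mean_over_def fun_eq_iff abs_mult)
  moreover have "((\<lambda>r. \<bar>c\<bar> * mean_over \<phi> r) \<longlongrightarrow> \<bar>c\<bar> * 0) at_top"
    by (intro tendsto_intros AP0_mean \<phi>)
  moreover have "bounded (range (\<lambda>t. c * \<phi> t))"
    using bounded_scaling[OF AP0_bounded[OF \<phi>], of c] by (simp add: image_image)
  ultimately show ?thesis
    unfolding AP0_iff by (simp add: continuous_on_mult_left AP0_continuous \<phi>)
qed

lemma AP0_zero: "(\<lambda>_. 0) \<in> AP0"
  by (simp add: AP0_def)

lemma AP0_sum:
  assumes "finite F" "\<And>i. i \<in> F \<Longrightarrow> h i \<in> AP0"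
  shows "(\<lambda>t. \<Sum>i\<in>F. h i t) \<in> AP0"
  using assms by (induction F) (simp_all add: AP0_zero AP0_add)

text \<open>One nonzero value forces a lower bound \<open>c\<close> on an interval of length d/2 by
  uniform continuity, and almost periods repeat such an interval in every window of length
  \<open>L\<close>. The means then stay above a positive constant.\<close>

lemma AP_AP0_eq_zero:
  assumes AP: "\<psi> \<in> AP" and AP0: "\<psi> \<in> AP0"
  shows "\<psi> t = 0"
proof (rule ccontr)
  assume "\<psi> t \<noteq> 0"
  \<comment> \<open>A third, because one \<open>c\<close> is lost to the almost period and one to
    uniform continuity.\<close>
  define c where "c = norm (\<psi> t) / 3"
  have c: "c > 0" using \<open>\<psi> t \<noteq> 0\<close> by (simp add: c_def)
  obtain d where d: "d > 0" "\<And>t t'. \<bar>t - t'\<bar> < d \<Longrightarrow> norm (\<psi> t - \<psi> t') < c"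
    using AP_uniformly_continuous[OF AP c] by blast
  obtain l where l: "l > 0" "\<And>a. \<exists>\<tau>\<in>{a..a + l}. \<forall>t. norm (\<psi> (t + \<tau>) - \<psi> t) < c"
    using AP_relatively_dense[OF AP c] unfolding relatively_dense_def by blast
  \<comment> \<open>\<open>l\<close> gives room for the shifted point, and \<open>d\<close> more
    than covers the interval of length d/2 to its right.\<close>
  define L where "L = l + d"
  have L: "L > 0" using l d by (simp add: L_def)
  have int: "(\<lambda>s. norm (\<psi> s)) integrable_on {a..b}" for a b
    by (intro integrable_continuous_interval continuous_intros continuous_on_subset[OF AP_continuous[OF AP]]) auto
  have lower: "c * (d / 2) \<le> integral {a..a + L} (\<lambda>s. norm (\<psi> s))" for a
  proof -
    obtain \<tau> where \<tau>: "\<tau> \<in> {a - t..a - t + l}" "norm (\<psi> (t + \<tau>) - \<psi> t) < c" using l(2) by blast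
    have "c \<le> norm (\<psi> s)" if "s \<in> {t + \<tau>..t + \<tau> + d / 2}" for s
    proof -
      have "norm (\<psi> s - \<psi> (t + \<tau>)) < c" using that d(1) by (intro d(2)) auto
      moreover have "norm (\<psi> t) = 3 * c" by (simp add: c_def)
      ultimately show ?thesis
        using \<tau>(2) norm_triangle_ineq2[of "\<psi> t" "\<psi> (t + \<tau>)"] norm_triangle_ineq2[of "\<psi> (t + \<tau>)" "\<psi> s"]
        by (simp add: norm_minus_commute)
    qed
    then have "integral {t + \<tau>..t + \<tau> + d / 2} (\<lambda>_. c) \<le> integral {t + \<tau>..t + \<tau> + d / 2} (\<lambda>s. norm (\<psi> s))"
      by (intro integral_le int) auto
    also have "\<dots> \<le> integral {a..a + L} (\<lambda>s. norm (\<psi> s))"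
      by (rule integral_subset_le[OF _ int int]) (use \<tau>(1) d(1) in \<open>auto simp: L_def\<close>)
    finally show ?thesis using d(1) by (simp add: mult.commute)
  qed
  have lower_n: "real n * (c * (d / 2)) \<le> integral {0..real n * L} (\<lambda>s. norm (\<psi> s))" for n
  proof (induction n)
    case (Suc n)
    have "integral {0..real n * L} (\<lambda>s. norm (\<psi> s)) + integral {real n * L..real n * L + L} (\<lambda>s. norm (\<psi> s))
        = integral {0..real n * L + L} (\<lambda>s. norm (\<psi> s))"
      using L by (intro Henstock_Kurzweil_Integration.integral_combine int) auto
    then show ?case using Suc lower[of "real n * L"] by (simp add: algebra_simps)
  qed simp
  have "filterlim (\<lambda>n. real n * L) at_top sequentially"
    using L by (rule filterlim_at_top_mult_tendsto_pos[OF tendsto_const _ filterlim_real_sequentially])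
  then have "((\<lambda>n. mean_over \<psi> (real n * L)) \<longlonglongrightarrow> 0)"
    using AP0_mean[OF AP0] by (rule filterlim_compose[rotated])
  \<comment> \<open>Counting only [0, nL] in the mean over [-nL, nL] gives n (c d / 2) / (2 n L) = c
    d / (4 L).\<close>
  moreover have "\<forall>\<^sub>F n in sequentially. c * d / (4 * L) \<le> mean_over \<psi> (real n * L)"
    using eventually_gt_at_top[of 0]
  proof eventually_elim
    fix n :: nat assume n: "0 < n"
    have "integral {0..real n * L} (\<lambda>s. norm (\<psi> s)) \<le> integral {- (real n * L)..real n * L} (\<lambda>s. norm (\<psi> s))"
      using L by (intro integral_subset_le int) auto
    then have "1 / (2 * (real n * L)) * (real n * (c * (d / 2))) \<le> mean_over \<psi> (real n * L)"
      unfolding mean_over_def using lower_n[of n] L by (intro mult_left_mono) auto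
    then show "c * d / (4 * L) \<le> mean_over \<psi> (real n * L)" using n L by (simp add: field_simps)
  qed
  ultimately have "c * d / (4 * L) \<le> 0"
    by (intro tendsto_lowerbound) auto
  then show False using mult_pos_pos[OF c d(1)] L by (simp add: field_simps)
qed

text \<open>The excess max 0 (norm (a t) - M) is almost periodic as a Lipschitz image of
  \<open>a\<close>, and it is at most norm (b t), so it is ergodic too and must vanish.\<close>

lemma AP_part_bound:
  assumes a: "a \<in> AP" and b: "b \<in> AP0" and bound: "\<And>t. norm (a t + b t) \<le> M"
  shows "norm (a t) \<le> M"
proof -
  define \<psi> where "\<psi> t = max 0 (norm (a t) - M)" for t
  have "\<psi> \<in> AP"
    unfolding \<psi>_def
  proof (rule AP_lipschitz_comp[OF a, where L = 1])
    fix x y :: 'a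
    show "norm (max 0 (norm x - M) - max 0 (norm y - M)) \<le> 1 * norm (x - y)"
      using norm_triangle_ineq3[of x y] by (simp add: max_def abs_le_iff)
  qed
  moreover have "\<psi> \<in> AP0"
  proof (rule AP0_dominated)
    show "continuous_on UNIV \<psi>" by (rule AP_continuous[OF \<open>\<psi> \<in> AP\<close>])
    fix \<epsilon> :: real assume "\<epsilon> > 0"
    have "norm (a t) \<le> M + norm (b t)" for t
      using bound[of t] norm_triangle_ineq4[of "a t + b t" "b t"] by simp
    then have "norm (\<psi> t) \<le> \<epsilon> + norm (b t)" for t
      using \<open>\<epsilon> > 0\<close> by (simp add: \<psi>_def max_def add.commute le_diff_eq add_nonneg_nonneg)
        (smt (verit))
    then show "\<exists>\<phi>. \<phi> \<in> (AP0 :: (real \<Rightarrow> real) set) \<and> (\<forall>t. norm (\<psi> t) \<le> \<epsilon> + \<phi> t)"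
      using AP0_norm[OF b] by blast
  qed
  ultimately have "\<psi> t = 0" by (rule AP_AP0_eq_zero)
  then show ?thesis by (simp add: \<psi>_def max_def split: if_splits)
qed

section \<open>Pseudo almost periodic functions\<close>

lemma PAP_I:
  assumes "a \<in> AP" "b \<in> AP0" "\<And>t. h t = a t + b t"
  shows "h \<in> PAP"
proof -
  have h: "h = (\<lambda>t. a t + b t)" using assms(3) by blast
  have "continuous_on UNIV h"
    unfolding h by (intro continuous_intros AP_continuous AP0_continuous assms)
  moreover have "bounded (range h)"
    unfolding h by (intro bounded_plus_comp AP_bounded AP0_bounded assms)
  ultimately show ?thesis
    unfolding PAP_def using assms by (intro CollectI conjI bexI[of _ a] bexI[of _ b]) auto
qed

lemma PAP_E:
  assumes "h \<in> PAP"
  obtains a b where "a \<in> AP" "b \<in> AP0" "\<And>t. h t = a t + b t"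
  using assms unfolding PAP_def by blast

lemma PAP_continuous: "h \<in> PAP \<Longrightarrow> continuous_on UNIV h"
  and PAP_bounded: "h \<in> PAP \<Longrightarrow> bounded (range h)"
  by (simp_all add: PAP_def)

lemma PAP_add:
  assumes "h \<in> PAP" "k \<in> PAP"
  shows "(\<lambda>t. h t + k t) \<in> PAP"
proof -
  obtain a b where ab: "a \<in> AP" "b \<in> AP0" "\<And>t. h t = a t + b t" by (rule PAP_E[OF assms(1)]) blast
  obtain a' b' where ab': "a' \<in> AP" "b' \<in> AP0" "\<And>t. k t = a' t + b' t" by (rule PAP_E[OF assms(2)]) blast
  show ?thesis
    by (rule PAP_I[OF AP_add[OF ab(1) ab'(1)] AP0_add[OF ab(2) ab'(2)]]) (simp add: ab ab')
qed

lemma PAP_bounded_linear: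
  assumes L: "bounded_linear L" and h: "h \<in> PAP"
  shows "(\<lambda>t. L (h t)) \<in> PAP"
proof -
  interpret bounded_linear L by (rule L)
  obtain a b where ab: "a \<in> AP" "b \<in> AP0" "\<And>t. h t = a t + b t" by (rule PAP_E[OF h]) blast
  obtain K where K: "\<And>x. norm (L x) \<le> norm x * K" using bounded by blast
  have "(\<lambda>t. L (a t)) \<in> AP"
    by (rule AP_lipschitz_comp[OF ab(1), where L = K]) (use K in \<open>auto simp: diff[symmetric] mult.commute\<close>)
  moreover have "(\<lambda>t. L (b t)) \<in> AP0"
  proof (rule AP0_dominated)
    show "continuous_on UNIV (\<lambda>t. L (b t))" by (rule continuous_on[OF AP0_continuous[OF ab(2)]])
    fix \<epsilon> :: real assume "\<epsilon> > 0"
    have "norm (L (b t)) \<le> \<epsilon> + K * norm (b t)" for t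
      using K[of "b t"] \<open>\<epsilon> > 0\<close> by (simp add: mult.commute)
    then show "\<exists>\<phi>. \<phi> \<in> (AP0 :: (real \<Rightarrow> real) set) \<and> (\<forall>t. norm (L (b t)) \<le> \<epsilon> + \<phi> t)"
      using AP0_cmult[OF AP0_norm[OF ab(2)], of K] by blast
  qed
  ultimately show ?thesis by (rule PAP_I) (simp add: ab(3) add)
qed

text \<open>The splittings of the \<open>g n\<close> are chosen independently of each other. Applied
  to differences of the \<open>g n\<close>, \<open>AP_part_bound\<close> shows that the almost
  periodic parts are nevertheless uniformly Cauchy. Their limit \<open>a'\<close> is the almost
  periodic part of \<open>h\<close>, and h - a' is within \<epsilon> of an ergodic part
  \<open>b n\<close>.\<close>

lemma PAP_uniform_limit:
  assumes lim: "uniform_limit UNIV g h sequentially" and g: "\<And>n. g n \<in> PAP"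
  shows "h \<in> PAP"
proof -
  have "\<exists>a b. a \<in> AP \<and> b \<in> AP0 \<and> (\<forall>t. g n t = a t + b t)" for n
    by (rule PAP_E[OF g[of n]]) blast
  then obtain a b where ab: "\<And>n. a n \<in> AP" "\<And>n. b n \<in> AP0" "\<And>n t. g n t = a n t + b n t"
    by metis
  have "uniformly_Cauchy_on UNIV a"
    unfolding uniformly_Cauchy_on_def dist_norm
  proof (intro allI impI)
    fix e :: real assume e: "e > 0"
    have "uniformly_Cauchy_on UNIV g"
      using lim by (intro uniformly_convergent_Cauchy) (auto simp: uniformly_convergent_on_def)
    moreover have "e / 2 > 0" using e by simp
    ultimately obtain N where N: "\<And>m n t. m \<ge> N \<Longrightarrow> n \<ge> N \<Longrightarrow> norm (g m t - g n t) < e / 2"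
      unfolding uniformly_Cauchy_on_def dist_norm by blast
    have "norm (a m t - a n t) < e" if "m \<ge> N" "n \<ge> N" for m n t
    proof -
      have "(\<lambda>t. a m t + - a n t) \<in> AP"
        by (intro AP_add AP_lipschitz_comp[OF ab(1), where L = 1] ab) (simp add: norm_minus_commute)
      moreover have "(\<lambda>t. b m t + - b n t) \<in> AP0"
      proof (rule AP0_dominated)
        show "continuous_on UNIV (\<lambda>t. b m t + - b n t)" by (intro continuous_intros AP0_continuous ab)
        fix \<epsilon> :: real assume "\<epsilon> > 0"
        then have "norm (b m t + - b n t) \<le> \<epsilon> + (norm (b m t) + norm (b n t))" for t
          using norm_triangle_ineq4[of "b m t" "b n t"] by simp
        then show "\<exists>\<phi>. \<phi> \<in> (AP0 :: (real \<Rightarrow> real) set) \<and> (\<forall>t. norm (b m t + - b n t) \<le> \<epsilon> + \<phi> t)"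
          using AP0_add[OF AP0_norm[OF ab(2)[of m]] AP0_norm[OF ab(2)[of n]]] by blast
      qed
      moreover have "norm ((a m t + - a n t) + (b m t + - b n t)) \<le> e / 2" for t
        using N[OF that, of t] by (simp add: ab(3) algebra_simps)
      ultimately have "norm (a m t + - a n t) \<le> e / 2" by (rule AP_part_bound)
      then show ?thesis using e by simp
    qed
    then show "\<exists>M. \<forall>x\<in>UNIV. \<forall>m\<ge>M. \<forall>n\<ge>M. norm (a m x - a n x) < e" by blast
  qed
  then obtain a' where a': "uniform_limit UNIV a a' sequentially"
    using Cauchy_uniformly_convergent uniformly_convergent_on_def by blast
  have "a' \<in> AP"
  proof (rule AP_uniform_limit)
    fix \<epsilon> :: real assume "\<epsilon> > 0"
    from uniform_limitD[OF a' this] obtain n where "\<And>t. dist (a n t) (a' t) < \<epsilon>"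
      by (auto simp: eventually_sequentially)
    then show "\<exists>g\<in>AP. \<forall>t. norm (a' t - g t) \<le> \<epsilon>"
      using ab(1)[of n] by (intro bexI[of _ "a n"]) (auto simp: dist_norm norm_minus_commute less_imp_le)
  qed
  moreover have "(\<lambda>t. h t - a' t) \<in> AP0"
  proof (rule AP0_dominated)
    have "continuous_on UNIV h"
      by (rule uniform_limit_theorem[OF _ lim]) (simp_all add: PAP_continuous g)
    then show "continuous_on UNIV (\<lambda>t. h t - a' t)"
      by (intro continuous_intros AP_continuous[OF \<open>a' \<in> AP\<close>])
    fix \<epsilon> :: real assume "\<epsilon> > 0"
    have "uniform_limit UNIV (\<lambda>n t. g n t - a n t) (\<lambda>t. h t - a' t) sequentially"
      by (rule uniform_limit_minus[OF lim a'])
    from uniform_limitD[OF this \<open>\<epsilon> > 0\<close>] obtain n where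
      n: "\<And>t. dist (g n t - a n t) (h t - a' t) < \<epsilon>" by (auto simp: eventually_sequentially)
    have "norm (h t - a' t) \<le> \<epsilon> + norm (b n t)" for t
      using n[of t] norm_triangle_ineq2[of "h t - a' t" "b n t"]
      by (simp add: ab(3) dist_norm norm_minus_commute)
    then show "\<exists>\<phi>. \<phi> \<in> (AP0 :: (real \<Rightarrow> real) set) \<and> (\<forall>t. norm (h t - a' t) \<le> \<epsilon> + \<phi> t)"
      using AP0_norm[OF ab(2)[of n]] by blast
  qed
  ultimately show ?thesis by (rule PAP_I) simp
qed

text \<open>G(t, a(t)) is the almost periodic part. In the remainder, \<Phi>(t, a(t)) is the
  delicate term, since the means of \<Phi> are controlled at fixed arguments. Replacing a(t) by a
  nearby net point y changes \<Phi> by the change of f, small by the Lipschitz condition, minus the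
  change of G, small by equicontinuity; what remains is majorized by the sum of the ergodic
  functions norm (\<Phi> t y) over the finite net.\<close>

lemma PAP_nemytskii:
  assumes f: "f \<in> PAP_unif" and Lip: "\<And>t x y. norm (f t x - f t y) \<le> K * norm (x - y)"
    and v: "v \<in> PAP"
  shows "(\<lambda>t. f t (v t)) \<in> PAP"
proof -
  obtain a b where ab: "a \<in> AP" "b \<in> AP0" "\<And>t. v t = a t + b t" by (rule PAP_E[OF v]) blast
  obtain G \<Phi> where G: "G \<in> AP_unif" and \<Phi>: "\<Phi> \<in> AP0_unif" and fG: "\<And>t y. f t y = G t y + \<Phi> t y"
    using f unfolding PAP_unif_def by blast
  have cont_f: "continuous_on UNIV (\<lambda>(t, y). f t y)" using f by (simp add: PAP_unif_def)
  have cont_\<Phi>: "continuous_on UNIV (\<lambda>(t, y). \<Phi> t y)" using \<Phi> by (simp add: AP0_unif_def)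
  have comp: "continuous_on UNIV (\<lambda>t. F t (w t))"
    if "continuous_on UNIV (\<lambda>(t, y). F t y)" "continuous_on UNIV w" for F :: "real \<Rightarrow> 'a \<Rightarrow> 'b" and w
    using continuous_on_compose2[OF that(1), of UNIV "\<lambda>t. (t, w t)"]
      continuous_on_Pair[OF continuous_on_id that(2)] by simp
  have \<Phi>y: "(\<lambda>t. \<Phi> t y) \<in> AP0" for y
  proof -
    have "bounded (range (\<lambda>t. \<Phi> t y))"
      using \<Phi> unfolding AP0_unif_def by (auto simp: image_def intro: bounded_subset)
    moreover have "((\<lambda>r. 1 / (2 * r) * integral {- r..r} (\<lambda>t. norm (\<Phi> t y))) \<longlongrightarrow> 0) at_top"
      using \<Phi> unfolding AP0_unif_def by (auto dest: tendsto_uniform_limitI)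
    ultimately show ?thesis
      unfolding AP0_def using comp[OF cont_\<Phi>, of "\<lambda>_. y"] by auto
  qed
  define C where "C = closure (range a)"
  have C: "compact C" unfolding C_def by (rule AP_compact_closure_range[OF ab(1)])
  have aC: "a t \<in> C" for t unfolding C_def by (rule subsetD[OF closure_subset]) simp
  have K: "K * norm x \<le> \<bar>K\<bar> * norm x" for x :: 'a by (intro mult_right_mono) auto
  define b' where "b' t = f t (v t) - G t (a t)" for t
  have "b' \<in> AP0"
  proof (rule AP0_dominated)
    have cont_G: "continuous_on UNIV (\<lambda>(t, y). G t y)" using G by (simp add: AP_unif_def)
    show "continuous_on UNIV b'"
      unfolding b'_def
      by (intro continuous_intros comp cont_f cont_G PAP_continuous[OF v] AP_continuous ab)
    fix \<epsilon> :: real assume "\<epsilon> > 0"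
    then have \<epsilon>2: "\<epsilon> / 2 > 0" by simp
    obtain d where d: "d > 0" "\<And>t t' y y'. y \<in> C \<Longrightarrow> y' \<in> C \<Longrightarrow> \<bar>t - t'\<bar> < d \<Longrightarrow>
        norm (y - y') < d \<Longrightarrow> norm (G t y - G t' y') < \<epsilon> / 2"
      using AP_unif_equicontinuous[OF G C \<epsilon>2] by blast
    \<comment> \<open>Fine enough for the oscillation of \<open>G\<close> and for the Lipschitz
      error of \<open>f\<close>, each at most \<epsilon>/2; the 1 guards against a zero
      denominator.\<close>
    define d' where "d' = min d (\<epsilon> / 2 / (\<bar>K\<bar> + 1))"
    have d': "d' > 0" using d(1) \<epsilon>2 by (simp add: d'_def add_nonneg_pos)
    obtain k where k: "finite k" "k \<subseteq> C" "C \<subseteq> (\<Union>x\<in>k. ball x d')"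
      using compactE_image[OF C, of C "\<lambda>x. ball x d'"] d' by (metis (no_types, lifting) UN_iff centre_in_ball open_ball subsetI)
    define \<phi> where "\<phi> t = \<bar>K\<bar> * norm (b t) + (\<Sum>y\<in>k. norm (\<Phi> t y))" for t
    have "norm (b' t) \<le> \<epsilon> + \<phi> t" for t
    proof -
      obtain y where y: "y \<in> k" "norm (a t - y) < d'"
        using k(3) aC[of t] by (auto simp: dist_norm norm_minus_commute)
      then have yC: "y \<in> C" using k(2) by blast
      have "norm (f t (v t) - f t (a t)) \<le> \<bar>K\<bar> * norm (b t)"
        using order_trans[OF Lip K, of t "v t" "a t"] by (simp add: ab(3))
      moreover have "norm (f t (a t) - f t y) \<le> \<epsilon> / 2"
      proof -
        have "norm (f t (a t) - f t y) \<le> \<bar>K\<bar> * norm (a t - y)" by (rule order_trans[OF Lip K])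
        also have "\<dots> \<le> (\<bar>K\<bar> + 1) * d'" using y(2) by (intro mult_mono) auto
        also have "\<dots> \<le> (\<bar>K\<bar> + 1) * (\<epsilon> / 2 / (\<bar>K\<bar> + 1))" unfolding d'_def by (intro mult_left_mono) auto
        also have "\<dots> = \<epsilon> / 2" by (rule trans[OF times_divide_eq_right nonzero_mult_div_cancel_left]) linarith
        finally show ?thesis .
      qed
      moreover have "norm (G t (a t) - G t y) < \<epsilon> / 2"
        using y(2) by (intro d(2) aC yC) (auto simp: d'_def d(1))
      moreover have "norm (\<Phi> t y) \<le> (\<Sum>y\<in>k. norm (\<Phi> t y))"
        by (rule member_le_sum) (use k y in auto)
      moreover have *: "b' t = (f t (v t) - f t (a t)) + (f t (a t) - f t y) - (G t (a t) - G t y) + \<Phi> t y"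
        by (simp add: b'_def fG)
      moreover have "norm (b' t)
          \<le> norm (f t (v t) - f t (a t)) + norm (f t (a t) - f t y) + norm (G t (a t) - G t y) + norm (\<Phi> t y)"
        unfolding * using norm_triangle_ineq[of "f t (v t) - f t (a t) + (f t (a t) - f t y) - (G t (a t) - G t y)" "\<Phi> t y"]
          norm_triangle_ineq4[of "f t (v t) - f t (a t) + (f t (a t) - f t y)" "G t (a t) - G t y"]
          norm_triangle_ineq[of "f t (v t) - f t (a t)" "f t (a t) - f t y"] by linarith
      ultimately show ?thesis unfolding \<phi>_def by linarith
    qed
    moreover have "\<phi> \<in> AP0"
      unfolding \<phi>_def[abs_def]
      by (intro AP0_add AP0_cmult AP0_sum AP0_norm ab \<Phi>y k)
    ultimately show "\<exists>\<phi>. \<phi> \<in> (AP0 :: (real \<Rightarrow> real) set) \<and> (\<forall>t. norm (b' t) \<le> \<epsilon> + \<phi> t)" by blast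
  qed
  with AP_unif_comp[OF G ab(1)] show ?thesis by (rule PAP_I) (simp add: b'_def)
qed

text \<open>The shifted window lies in the centred window of radius |b| + r, and the two
  normalizations differ by the factor 1 + |b|/r, which tends to 1.\<close>

lemma mean_over_shift_tendsto:
  assumes h: "h \<in> AP0"
  shows "(mean_over (\<lambda>t. h (t - b)) \<longlongrightarrow> 0) at_top"
proof -
  have cont: "continuous_on S (\<lambda>t. norm (h t))" for S
    by (intro continuous_intros continuous_on_subset[OF AP0_continuous[OF h]]) auto
  have "((\<lambda>r. (1 + \<bar>b\<bar> / r) * mean_over h (\<bar>b\<bar> + r)) \<longlongrightarrow> 1 * 0) at_top"
  proof (intro tendsto_mult)
    have "((\<lambda>r. 1 + \<bar>b\<bar> / r) \<longlongrightarrow> 1 + 0) at_top"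
      by (intro tendsto_add tendsto_const tendsto_divide_0[OF tendsto_const] filterlim_at_top_imp_at_infinity filterlim_ident)
    then show "((\<lambda>r. 1 + \<bar>b\<bar> / r) \<longlongrightarrow> 1) at_top" by simp
    show "((\<lambda>r. mean_over h (\<bar>b\<bar> + r)) \<longlongrightarrow> 0) at_top"
      by (rule filterlim_compose[OF AP0_mean[OF h] filterlim_tendsto_add_at_top[OF tendsto_const filterlim_ident]])
  qed
  then have "((\<lambda>r. (1 + \<bar>b\<bar> / r) * mean_over h (\<bar>b\<bar> + r)) \<longlongrightarrow> 0) at_top" by simp
  then show ?thesis
  proof (rule tendsto_sandwich[OF _ _ tendsto_const, rotated 2])
    show "\<forall>\<^sub>F r in at_top. 0 \<le> mean_over (\<lambda>t. h (t - b)) r"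
      using eventually_ge_at_top[of 0] by eventually_elim (rule mean_over_nonneg)
    show "\<forall>\<^sub>F r in at_top. mean_over (\<lambda>t. h (t - b)) r \<le> (1 + \<bar>b\<bar> / r) * mean_over h (\<bar>b\<bar> + r)"
      using eventually_gt_at_top[of 0]
    proof eventually_elim
      fix r :: real assume r: "0 < r"
      have "((\<lambda>t. norm (h t)) has_integral integral {- r - b..r - b} (\<lambda>t. norm (h t))) {- r - b..r - b}"
        by (intro integrable_integral integrable_continuous_interval cont)
      from has_integral_affine[OF this, of 1 "- b"]
      have "((\<lambda>t. norm (h (t - b))) has_integral integral {- r - b..r - b} (\<lambda>t. norm (h t))) {t. t - b \<in> {- r - b..r - b}}"
        by simp
      moreover have "{t. t - b \<in> {- r - b..r - b}} = {- r..r}" by auto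
      ultimately have "integral {- r..r} (\<lambda>t. norm (h (t - b))) = integral {- r - b..r - b} (\<lambda>t. norm (h t))"
        by (simp add: integral_unique)
      also have "\<dots> \<le> integral {- (\<bar>b\<bar> + r)..\<bar>b\<bar> + r} (\<lambda>t. norm (h t))"
        by (intro integral_subset_le integrable_continuous_interval cont) auto
      finally have "1 / (2 * r) * integral {- r..r} (\<lambda>t. norm (h (t - b)))
          \<le> 1 / (2 * r) * integral {- (\<bar>b\<bar> + r)..\<bar>b\<bar> + r} (\<lambda>t. norm (h t))"
        using r by (intro mult_left_mono) auto
      also have "\<dots> = (1 + \<bar>b\<bar> / r) * mean_over h (\<bar>b\<bar> + r)"
      proof -
        have "(1 + \<bar>b\<bar> / r) * (1 / (2 * (\<bar>b\<bar> + r))) = 1 / (2 * r)"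
          using r by (simp add: divide_simps)
        then show ?thesis by (simp only: mean_over_def mult.assoc[symmetric])
      qed
      finally show "mean_over (\<lambda>t. h (t - b)) r \<le> (1 + \<bar>b\<bar> / r) * mean_over h (\<bar>b\<bar> + r)"
        unfolding mean_over_def[of "\<lambda>t. h (t - b)"] .
    qed
  qed
qed

section \<open>Convolution with an integrable operator kernel\<close>

text \<open>Continuity is strong, that is, for each fixed argument, and only on the open half-line;
  \<open>m\<close> may be singular at 0 as long as its total mass \<open>I\<close> is
  finite.\<close>

locale convolution_kernel =
  fixes k :: "real \<Rightarrow> 'y::banach \<Rightarrow> 'a::banach" and m :: "real \<Rightarrow> real" and I :: real
  assumes lin: "\<And>s. 0 < s \<Longrightarrow> linear (k s)"
    and bound: "\<And>s y. 0 < s \<Longrightarrow> norm (k s y) \<le> m s * norm y"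
    and cont: "\<And>y. continuous_on {0<..} (\<lambda>s. k s y)"
    and m_nonneg: "\<And>s. 0 < s \<Longrightarrow> 0 \<le> m s"
    and m_cont: "continuous_on {0<..} m"
    and m_integral: "(m has_integral I) {0<..}"
begin

text \<open>The sign \<open>e\<close> lets one integral over the positive half-line cover both
  directions: 1 looks into the past of \<open>t\<close>, and -1 into its future.\<close>

definition conv :: "real \<Rightarrow> (real \<Rightarrow> 'y) \<Rightarrow> real \<Rightarrow> 'a"
  where "conv e h t = integral {0<..} (\<lambda>s. k s (h (t - e * s)))"

section \<open>Integrability, bounds and continuity of the convolution\<close>

lemma I_nonneg: "0 \<le> I"
  by (rule has_integral_nonneg[OF m_integral]) (simp add: m_nonneg)

lemma weighted_integrable:
  fixes \<phi> :: "real \<Rightarrow> real"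
  assumes "continuous_on {0<..} \<phi>" "\<And>s. 0 < s \<Longrightarrow> \<bar>\<phi> s\<bar> \<le> M"
  shows "(\<lambda>s. m s * \<phi> s) integrable_on {0<..}"
proof (rule integrable_Ioi_dominated)
  show "continuous_on {0<..} (\<lambda>s. m s * \<phi> s)"
    by (intro continuous_intros m_cont assms)
  show "(\<lambda>s. m s * M) integrable_on {0<..}"
    using m_integral by (intro integrable_on_mult_left) auto
  show "norm (m s * \<phi> s) \<le> m s * M" if "0 < s" for s
    using assms(2)[OF that] m_nonneg[OF that] by (simp add: abs_mult mult_left_mono)
qed

lemma weighted_integral_le:
  fixes \<phi> :: "real \<Rightarrow> real"
  assumes "continuous_on {0<..} \<phi>" "\<And>s. 0 < s \<Longrightarrow> \<bar>\<phi> s\<bar> \<le> M"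
  shows "integral {0<..} (\<lambda>s. m s * \<phi> s) \<le> I * M"
proof -
  have "integral {0<..} (\<lambda>s. m s * \<phi> s) \<le> integral {0<..} (\<lambda>s. m s * M)"
  proof (rule integral_le)
    show "(\<lambda>s. m s * M) integrable_on {0<..}"
      using m_integral by (intro integrable_on_mult_left) auto
    show "m s * \<phi> s \<le> m s * M" if "s \<in> {0<..}" for s
      using assms(2)[of s] m_nonneg[of s] that by (intro mult_left_mono) auto
  qed (rule weighted_integrable[OF assms])
  then show ?thesis using integral_unique[OF m_integral] by simp
qed

text \<open>Strong continuity handles the change of the kernel at the fixed vector h(t - e s0). The
  change of the vector meets a moving kernel, which the continuous majorant \<open>m\<close> keeps
  locally bounded.\<close>

lemma continuous_on_integrand:
  assumes h: "continuous_on UNIV h"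
  shows "continuous_on {0<..} (\<lambda>s. k s (h (t - e * s)))"
  unfolding continuous_on_def
proof
  fix s\<^sub>0 :: real assume s0: "s\<^sub>0 \<in> {0<..}"
  let ?h = "\<lambda>s. h (t - e * s)"
  have h': "continuous_on {0<..} ?h"
    by (intro continuous_intros continuous_on_compose2[OF h]) auto
  have "((\<lambda>s. m s * norm (?h s - ?h s\<^sub>0) + norm (k s (?h s\<^sub>0) - k s\<^sub>0 (?h s\<^sub>0)))
      \<longlongrightarrow> m s\<^sub>0 * norm (?h s\<^sub>0 - ?h s\<^sub>0) + norm (k s\<^sub>0 (?h s\<^sub>0) - k s\<^sub>0 (?h s\<^sub>0))) (at s\<^sub>0 within {0<..})"
    using m_cont h' cont[of "?h s\<^sub>0"] s0 unfolding continuous_on_def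
    by (intro tendsto_intros) auto
  then have lim: "((\<lambda>s. m s * norm (?h s - ?h s\<^sub>0) + norm (k s (?h s\<^sub>0) - k s\<^sub>0 (?h s\<^sub>0)))
      \<longlongrightarrow> 0) (at s\<^sub>0 within {0<..})" by simp
  have "\<forall>\<^sub>F s in at s\<^sub>0 within {0<..}. norm (k s (?h s) - k s\<^sub>0 (?h s\<^sub>0))
      \<le> m s * norm (?h s - ?h s\<^sub>0) + norm (k s (?h s\<^sub>0) - k s\<^sub>0 (?h s\<^sub>0))"
    unfolding eventually_at_filter
  proof (rule always_eventually, intro allI impI)
    fix s :: real assume "s \<in> {0<..}"
    then have s: "0 < s" by simp
    have eq: "k s (?h s) - k s\<^sub>0 (?h s\<^sub>0) = k s (?h s - ?h s\<^sub>0) + (k s (?h s\<^sub>0) - k s\<^sub>0 (?h s\<^sub>0))"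
      by (simp add: linear_diff[OF lin[OF s]])
    show "norm (k s (?h s) - k s\<^sub>0 (?h s\<^sub>0))
      \<le> m s * norm (?h s - ?h s\<^sub>0) + norm (k s (?h s\<^sub>0) - k s\<^sub>0 (?h s\<^sub>0))"
      unfolding eq by (rule norm_triangle_mono[OF bound[OF s] order_refl])
  qed
  then have "((\<lambda>s. k s (?h s) - k s\<^sub>0 (?h s\<^sub>0)) \<longlongrightarrow> 0) (at s\<^sub>0 within {0<..})"
    using lim by (rule Lim_null_comparison)
  then show "((\<lambda>s. k s (?h s)) \<longlongrightarrow> k s\<^sub>0 (?h s\<^sub>0)) (at s\<^sub>0 within {0<..})"
    by (simp add: LIM_zero_iff)
qed

lemma weight_norm:
  fixes h :: "real \<Rightarrow> 'z::banach"
  assumes h: "continuous_on UNIV h" "bounded (range h)"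
  obtains M where "continuous_on {0<..} (\<lambda>s. norm (h (t - e * s)))" "\<And>s. \<bar>norm (h (t - e * s))\<bar> \<le> M"
proof -
  obtain M where "\<And>s. norm (h s) \<le> M" using h(2) unfolding bounded_iff by blast
  moreover have "continuous_on {0<..} (\<lambda>s. norm (h (t - e * s)))"
    by (intro continuous_intros continuous_on_compose2[OF h(1)]) auto
  ultimately show ?thesis by (intro that[of M]) auto
qed

lemma integrand_integrable:
  assumes h: "continuous_on UNIV h" "bounded (range h)"
  shows "(\<lambda>s. k s (h (t - e * s))) integrable_on {0<..}"
proof -
  obtain M where M: "continuous_on {0<..} (\<lambda>s. norm (h (t - e * s)))"
    "\<And>s. \<bar>norm (h (t - e * s))\<bar> \<le> M" by (rule weight_norm[OF h]) blast
  show ?thesis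
    by (rule integrable_Ioi_dominated[OF continuous_on_integrand[OF h(1)]
          weighted_integrable[OF M]]) (rule bound)
qed

lemma norm_conv_le:
  assumes h: "continuous_on UNIV h" "bounded (range h)"
  shows "norm (conv e h t) \<le> integral {0<..} (\<lambda>s. m s * norm (h (t - e * s)))"
proof -
  obtain M where M: "continuous_on {0<..} (\<lambda>s. norm (h (t - e * s)))"
    "\<And>s. \<bar>norm (h (t - e * s))\<bar> \<le> M" by (rule weight_norm[OF h]) blast
  show ?thesis
    unfolding conv_def
    by (rule integral_norm_bound_integral[OF integrand_integrable[OF h] weighted_integrable[OF M]])
      (simp add: bound)
qed

lemma norm_conv_le_sup:
  assumes h: "continuous_on UNIV h" and M: "\<And>t. norm (h t) \<le> M"
  shows "norm (conv e h t) \<le> I * M"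
proof -
  have b: "bounded (range h)" using M unfolding bounded_iff by blast
  have "continuous_on {0<..} (\<lambda>s. norm (h (t - e * s)))"
    by (intro continuous_intros continuous_on_compose2[OF h]) auto
  from weighted_integral_le[OF this, of M] show ?thesis
    using norm_conv_le[OF h b, of e t] M by simp
qed

lemma conv_diff:
  assumes h: "continuous_on UNIV h" "bounded (range h)"
    and g: "continuous_on UNIV g" "bounded (range g)"
  shows "conv e h t - conv e g t = conv e (\<lambda>t. h t - g t) t"
proof -
  have "conv e h t - conv e g t = integral {0<..} (\<lambda>s. k s (h (t - e * s)) - k s (g (t - e * s)))"
    unfolding conv_def
    by (rule integral_diff[symmetric]) (intro integrand_integrable h g)+
  also have "\<dots> = conv e (\<lambda>t. h t - g t) t"
    unfolding conv_def by (intro integral_cong) (simp add: linear_diff[OF lin])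
  finally show ?thesis .
qed

lemma conv_add:
  assumes h: "continuous_on UNIV h" "bounded (range h)"
    and g: "continuous_on UNIV g" "bounded (range g)"
  shows "conv e (\<lambda>t. h t + g t) t = conv e h t + conv e g t"
proof -
  have "conv e (\<lambda>t. h t + g t) t - conv e g t = conv e h t"
    by (subst conv_diff) (auto intro!: continuous_intros bounded_plus_comp h g)
  then show ?thesis by (simp add: algebra_simps)
qed

lemma conv_shift: "conv e (\<lambda>t. h (t + \<tau>)) t = conv e h (t + \<tau>)"
  unfolding conv_def by (simp add: algebra_simps)

lemma norm_conv_diff_le:
  assumes h: "continuous_on UNIV h" "bounded (range h)"
    and g: "continuous_on UNIV g" "bounded (range g)" and M: "\<And>t. norm (h t - g t) \<le> M"
  shows "norm (conv e h t - conv e g t) \<le> I * M"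
  unfolding conv_diff[OF h g] by (intro norm_conv_le_sup continuous_intros h g M)

text \<open>For a bounded continuous \<open>h\<close> the translates need not converge uniformly, so
  the supremum bound does not suffice. A difference of values is the convolution of a difference of
  translates, and dominated convergence is applied to its scalar majorant.\<close>

lemma continuous_on_conv:
  assumes h: "continuous_on UNIV h" "bounded (range h)"
  shows "continuous_on UNIV (conv e h)"
proof (rule continuous_on_sequentiallyI)
  fix u :: "nat \<Rightarrow> real" and t :: real assume u: "u \<longlonglongrightarrow> t"
  obtain M where M: "\<And>s. norm (h s) \<le> M" using h(2) unfolding bounded_iff by blast
  let ?w = "\<lambda>n s. m s * norm (h (s * - e + u n) - h (s * - e + t))"
  let ?g = "\<lambda>n r. h (r + (u n - t))"
  have g: "continuous_on UNIV (?g n)" "bounded (range (?g n))" for n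
    using M by (auto intro!: continuous_intros continuous_on_compose2[OF h(1)] simp: bounded_iff)
  have w: "?w n integrable_on {0<..}" for n
    by (rule weighted_integrable[where M = "2 * M"])
      (auto intro!: continuous_intros continuous_on_compose2[OF h(1)]
        order_trans[OF norm_triangle_ineq4] add_mono[OF M M, simplified])
  have "(\<lambda>n. integral {0<..} (?w n)) \<longlonglongrightarrow> integral {0<..} (\<lambda>s::real. 0)"
  proof (rule dominated_convergence(2)[OF w])
    show "(\<lambda>s. m s * (2 * M)) integrable_on {0<..}"
      using m_integral by (intro integrable_on_mult_left) auto
    show "norm (?w n s) \<le> m s * (2 * M)" if "s \<in> {0<..}" for n s
      using that m_nonneg[of s] order_trans[OF norm_triangle_ineq4 add_mono[OF M M]]
      by (auto simp: abs_mult intro!: mult_left_mono)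
    show "(\<lambda>n. ?w n s) \<longlonglongrightarrow> 0" for s
    proof -
      have "(\<lambda>n. h (s * - e + u n)) \<longlonglongrightarrow> h (s * - e + t)"
        by (rule continuous_on_tendsto_compose[OF h(1)]) (auto intro!: tendsto_intros u)
      then have "(\<lambda>n. m s * norm (h (s * - e + u n) - h (s * - e + t))) \<longlonglongrightarrow> m s * norm (h (s * - e + t) - h (s * - e + t))"
        by (intro tendsto_intros)
      then show ?thesis by simp
    qed
  qed
  then have lim: "(\<lambda>n. integral {0<..} (?w n)) \<longlonglongrightarrow> 0" by simp
  have le: "norm (conv e h (u n) - conv e h t) \<le> integral {0<..} (?w n)" for n
  proof -
    have "conv e h (u n) - conv e h t = conv e (\<lambda>r. ?g n r - h r) t"
      using conv_shift[of e h "u n - t" t] conv_diff[OF g h, of e n t] by simp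
    moreover have "norm (conv e (\<lambda>r. ?g n r - h r) t) \<le>
        integral {0<..} (\<lambda>s. m s * norm (?g n (t - e * s) - h (t - e * s)))"
      by (rule norm_conv_le) (auto intro!: continuous_intros bounded_minus_comp g h)
    ultimately show ?thesis by (simp add: algebra_simps)
  qed
  have "(\<lambda>n. conv e h (u n) - conv e h t) \<longlonglongrightarrow> 0"
    by (rule Lim_null_comparison[OF always_eventually[OF allI[OF le]] lim])
  then show "(\<lambda>n. conv e h (u n)) \<longlonglongrightarrow> conv e h t" by (simp add: LIM_zero_iff)
qed

lemma bounded_conv:
  assumes h: "continuous_on UNIV h" "bounded (range h)"
  shows "bounded (range (conv e h))"
proof -
  obtain M where M: "\<And>s. norm (h s) \<le> M" using h(2) unfolding bounded_iff by blast
  show ?thesis unfolding bounded_iff using norm_conv_le_sup[OF h(1) M] by blast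
qed

lemma conv_AP:
  assumes h: "h \<in> AP"
  shows "conv e h \<in> AP"
proof (rule AP_I)
  note hcb = AP_continuous[OF h] AP_bounded[OF h]
  show "continuous_on UNIV (conv e h)" by (rule continuous_on_conv[OF hcb])
  fix \<epsilon> :: real assume \<epsilon>: "\<epsilon> > 0"
  \<comment> \<open>\<open>I\<close> may be 0; with I + 1 the quotient is defined and I \<epsilon> /
    (I + 1) remains below \<epsilon>.\<close>
  have I1: "I + 1 > 0" using I_nonneg by simp
  have \<epsilon>': "\<epsilon> / (I + 1) > 0" using \<epsilon> I1 by simp
  have "norm (conv e h (t + \<tau>) - conv e h t) < \<epsilon>"
    if \<tau>: "\<And>t. norm (h (t + \<tau>) - h t) < \<epsilon> / (I + 1)" for \<tau> t
  proof -
    have "norm (conv e (\<lambda>t. h (t + \<tau>)) t - conv e h t) \<le> I * (\<epsilon> / (I + 1))"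
    proof (rule norm_conv_diff_le)
      show "continuous_on UNIV (\<lambda>t. h (t + \<tau>))"
        by (intro continuous_intros continuous_on_compose2[OF hcb(1)]) auto
      show "bounded (range (\<lambda>t. h (t + \<tau>)))"
        by (rule bounded_subset[OF hcb(2)]) auto
    qed (use hcb \<tau> in \<open>auto intro: less_imp_le\<close>)
    also have "\<dots> < \<epsilon>" using I1 \<epsilon> by (simp add: field_simps)
    finally show ?thesis by (simp add: conv_shift)
  qed
  with AP_relatively_dense[OF h \<epsilon>']
  show "\<exists>E. relatively_dense E \<and> (\<forall>\<tau>\<in>E. \<forall>t. norm (conv e h (t + \<tau>) - conv e h t) < \<epsilon>)"
    by (intro exI[of _ "{\<tau>. \<forall>t. norm (h (t + \<tau>) - h t) < \<epsilon> / (I + 1)}"]) simp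
qed

text \<open>The norm is moved inside the convolution first, so the exchange of the two integrations
  concerns nonnegative real functions only: both sides become integrals with values in
  [0, \<infinity>], where Tonelli's theorem applies.\<close>

lemma integral_norm_conv_le:
  assumes h: "continuous_on UNIV h" "bounded (range h)" and r: "0 \<le> r"
  shows "(\<lambda>s. m s * integral {- r..r} (\<lambda>t. norm (h (t - e * s)))) integrable_on {0<..}" (is ?thesis1)
    and "integral {- r..r} (\<lambda>t. norm (conv e h t))
      \<le> integral {0<..} (\<lambda>s. m s * integral {- r..r} (\<lambda>t. norm (h (t - e * s))))" (is ?thesis2)
proof -
  obtain M where M: "\<And>s. norm (h s) \<le> M" using h(2) unfolding bounded_iff by blast
  let ?\<psi> = "\<lambda>s. integral {- r..r} (\<lambda>t. norm (h (t - e * s)))"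
  have int: "(\<lambda>t. norm (h (t - e * s))) integrable_on {- r..r}" for s
    by (intro integrable_continuous_interval continuous_intros continuous_on_compose2[OF h(1)]) auto
  have \<psi>0: "0 \<le> ?\<psi> s" for s by (intro integral_nonneg int) auto
  have \<psi>: "continuous_on {0<..} ?\<psi>"
    by (rule integral_continuous_on_param[of "{0<..}" "- r" r "\<lambda>s t. norm (h (t - e * s))",
          unfolded box_real case_prod_unfold])
      (intro continuous_intros continuous_on_compose2[OF h(1)], auto)
  have "\<bar>?\<psi> s\<bar> \<le> M * (2 * r)" for s
  proof -
    have "?\<psi> s \<le> integral {- r..r} (\<lambda>_. M)" by (intro integral_le int) (auto simp: M)
    then show ?thesis using \<psi>0[of s] r by (simp add: mult.commute)
  qed
  from weighted_integrable[OF \<psi> this] show 1: ?thesis1 .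
  \<comment> \<open>Extension by 0 makes the weight Borel measurable on the whole line, although
    \<open>m\<close> is continuous only on the open half-line.\<close>
  define m' where "m' s = (if s \<in> {0<..} then m s else 0)" for s
  define p where "p t = norm (h t)" for t
  have [measurable]: "m' \<in> borel_measurable borel"
    unfolding m'_def by (intro borel_measurable_continuous_on_if m_cont) auto
  have [measurable]: "p \<in> borel_measurable borel"
    unfolding p_def by (intro borel_measurable_continuous_onI continuous_intros h(1))
  define F where "F t s = ennreal (m' s * p (t - e * s)) * indicator {- r..r} t" for t s
  have "ennreal (integral {- r..r} (\<lambda>t. norm (conv e h t)))
      = (\<integral>\<^sup>+t. ennreal (norm (conv e h t)) * indicator {- r..r} t \<partial>lborel)"
    by (rule nn_integral_has_integral_lebesgue'[symmetric])
      (auto intro!: integrable_integral integrable_continuous_interval continuous_intros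
        continuous_on_subset[OF continuous_on_conv[OF h]])
  also have "\<dots> \<le> (\<integral>\<^sup>+t. (\<integral>\<^sup>+s. F t s \<partial>lborel) \<partial>lborel)"
  proof (rule nn_integral_mono)
    fix t
    obtain M where M: "continuous_on {0<..} (\<lambda>s. norm (h (t - e * s)))"
      "\<And>s. \<bar>norm (h (t - e * s))\<bar> \<le> M" by (rule weight_norm[OF h]) blast
    have "ennreal (norm (conv e h t)) \<le> ennreal (integral {0<..} (\<lambda>s. m s * p (t - e * s)))"
      unfolding p_def by (intro ennreal_leI norm_conv_le h)
    also have "\<dots> = (\<integral>\<^sup>+s. ennreal (m s * p (t - e * s)) * indicator {0<..} s \<partial>lborel)"
      unfolding p_def
      by (rule nn_integral_has_integral_lebesgue'[symmetric])
        (auto intro!: integrable_integral weighted_integrable[OF M] mult_nonneg_nonneg m_nonneg)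
    also have "\<dots> = (\<integral>\<^sup>+s. ennreal (m' s * p (t - e * s)) \<partial>lborel)"
      by (intro nn_integral_cong) (simp add: m'_def indicator_def)
    finally show "ennreal (norm (conv e h t)) * indicator {- r..r} t \<le> (\<integral>\<^sup>+s. F t s \<partial>lborel)"
      unfolding F_def by (simp add: indicator_def split: if_splits)
  qed
  also have "\<dots> = (\<integral>\<^sup>+s. (\<integral>\<^sup>+t. F t s \<partial>lborel) \<partial>lborel)"
    by (rule lborel_pair.Fubini'[symmetric]) (unfold F_def, measurable)
  also have "\<dots> = (\<integral>\<^sup>+s. ennreal (m s * ?\<psi> s) * indicator {0<..} s \<partial>lborel)"
  proof (rule nn_integral_cong)
    fix s
    show "(\<integral>\<^sup>+t. F t s \<partial>lborel) = ennreal (m s * ?\<psi> s) * indicator {0<..} s"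
    proof (cases "0 < s")
      case True
      then have "(\<integral>\<^sup>+t. F t s \<partial>lborel) = (\<integral>\<^sup>+t. ennreal (m s * norm (h (t - e * s))) * indicator {- r..r} t \<partial>lborel)"
        by (simp add: F_def m'_def p_def)
      also have "\<dots> = ennreal (m s * ?\<psi> s)"
        by (rule nn_integral_has_integral_lebesgue')
          (auto intro!: mult_nonneg_nonneg m_nonneg True has_integral_mult_right integrable_integral int)
      finally show ?thesis using True by simp
    qed (simp add: F_def m'_def)
  qed
  also have "\<dots> = ennreal (integral {0<..} (\<lambda>s. m s * ?\<psi> s))"
    by (rule nn_integral_has_integral_lebesgue')
      (auto intro!: mult_nonneg_nonneg m_nonneg \<psi>0 integrable_integral 1)
  finally show ?thesis2
    by (subst (asm) ennreal_le_iff)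
      (auto intro!: integral_nonneg 1 mult_nonneg_nonneg m_nonneg \<psi>0)
qed

text \<open>The mean of the convolution is at most the integral of m(s) times the mean of
  \<open>h\<close> translated by e s. For each fixed \<open>s\<close> that mean tends to 0, and it
  is bounded by a supremum bound of \<open>h\<close>, so the limit passes under the
  integral.\<close>

lemma conv_AP0:
  assumes h: "h \<in> AP0"
  shows "conv e h \<in> AP0"
  unfolding AP0_iff
proof (intro conjI)
  note hcb = AP0_continuous[OF h] AP0_bounded[OF h]
  show "continuous_on UNIV (conv e h)" by (rule continuous_on_conv[OF hcb])
  show "bounded (range (conv e h))" by (rule bounded_conv[OF hcb])
  show "(mean_over (conv e h) \<longlongrightarrow> 0) at_top"
  proof (rule tendsto_at_topI_sequentially)
    fix X :: "nat \<Rightarrow> real" assume X: "filterlim X at_top sequentially"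
    obtain M where M: "\<And>s. norm (h s) \<le> M" using hcb(2) unfolding bounded_iff by blast
    \<comment> \<open>Dominated convergence needs valid radii for every index, whereas a sequence
      tending to infinity may start with nonpositive terms.\<close>
    define Y where "Y n = max 1 (X n)" for n
    have ev: "\<forall>\<^sub>F n in sequentially. Y n = X n"
      using eventually_compose_filterlim[OF eventually_ge_at_top[of 1] X]
      by eventually_elim (simp add: Y_def)
    have Y: "filterlim Y at_top sequentially"
      using X by (rule filterlim_mono_eventually) (use ev in \<open>auto elim: eventually_mono\<close>)
    have Y1: "Y n > 0" for n by (simp add: Y_def)
    let ?w = "\<lambda>n s. m s * mean_over (\<lambda>t. h (t - e * s)) (Y n)"
    have w_eq: "?w n s = 1 / (2 * Y n) * (m s * integral {- Y n..Y n} (\<lambda>t. norm (h (t - e * s))))" for n s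
      by (simp add: mean_over_def)
    have w: "?w n integrable_on {0<..}" for n
      unfolding w_eq by (intro integrable_on_mult_right integral_norm_conv_le hcb) (simp add: Y1 less_imp_le)
    have "(\<lambda>n. integral {0<..} (?w n)) \<longlonglongrightarrow> integral {0<..} (\<lambda>s::real. 0)"
    proof (rule dominated_convergence(2)[OF w])
      show "(\<lambda>s. m s * M) integrable_on {0<..}"
        using m_integral by (intro integrable_on_mult_left) auto
      show "norm (?w n s) \<le> m s * M" if "s \<in> {0<..}" for n s
      proof -
        have "mean_over (\<lambda>t. h (t - e * s)) (Y n) \<le> mean_over (\<lambda>_. M) (Y n)"
          by (rule mean_over_mono)
            (use M Y1[of n] in \<open>auto intro!: continuous_intros continuous_on_compose2[OF hcb(1)] order_trans[OF M]\<close>)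
        moreover have "\<bar>M\<bar> = M" using order_trans[OF norm_ge_zero M] by simp
        ultimately show ?thesis
          using that m_nonneg[of s] mean_over_nonneg[of "Y n" "\<lambda>t. h (t - e * s)"] Y1[of n]
          by (auto simp: abs_mult mean_over_const intro!: mult_left_mono)
      qed
      show "(\<lambda>n. ?w n s) \<longlonglongrightarrow> 0" for s
        using tendsto_mult_right_zero[OF filterlim_compose[OF mean_over_shift_tendsto[OF h] Y]] by auto
    qed
    then have lim: "(\<lambda>n. integral {0<..} (?w n)) \<longlonglongrightarrow> 0" by simp
    have "(\<lambda>n. mean_over (conv e h) (Y n)) \<longlonglongrightarrow> 0"
    proof (rule tendsto_sandwich[OF _ _ tendsto_const lim]; rule always_eventually; rule allI)
      fix n
      show "0 \<le> mean_over (conv e h) (Y n)" using Y1[of n] by (simp add: mean_over_nonneg)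
      have "mean_over (conv e h) (Y n) \<le> 1 / (2 * Y n) *
          integral {0<..} (\<lambda>s. m s * integral {- Y n..Y n} (\<lambda>t. norm (h (t - e * s))))"
        unfolding mean_over_def using Y1[of n]
        by (intro mult_left_mono integral_norm_conv_le hcb) auto
      also have "\<dots> = integral {0<..} (?w n)" unfolding w_eq by simp
      finally show "mean_over (conv e h) (Y n) \<le> integral {0<..} (?w n)" .
    qed
    then show "(\<lambda>n. mean_over (conv e h) (X n)) \<longlonglongrightarrow> 0"
      by (rule Lim_transform_eventually) (use ev in \<open>auto elim: eventually_mono\<close>)
  qed
qed

lemma conv_PAP:
  assumes "h \<in> PAP"
  shows "conv e h \<in> PAP"
proof -
  obtain a b where ab: "a \<in> AP" "b \<in> AP0" "\<And>t. h t = a t + b t" by (rule PAP_E[OF assms]) blast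
  show ?thesis
  proof (rule PAP_I[OF conv_AP[OF ab(1)] conv_AP0[OF ab(2)]])
    have "h = (\<lambda>t. a t + b t)" using ab(3) by blast
    then show "conv e h t = conv e a t + conv e b t" for t
      by (simp add: conv_add AP_continuous AP_bounded AP0_continuous AP0_bounded ab)
  qed
qed

text \<open>With L the inclusion of the intermediate space, this carries the convolution into the
  ambient space, where mild solutions are formulated; the second part is the integrability of the
  norm demanded there.\<close>

lemma has_integral_image:
  assumes L: "bounded_linear L" and h: "continuous_on UNIV h" "bounded (range h)"
  shows "((\<lambda>s. L (k s (h (t - e * s)))) has_integral L (conv e h t)) {0<..}"
    and "(\<lambda>s. norm (L (k s (h (t - e * s))))) integrable_on {0<..}"
proof -
  interpret bounded_linear L by (rule L)
  show "((\<lambda>s. L (k s (h (t - e * s)))) has_integral L (conv e h t)) {0<..}"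
    using has_integral_linear[OF integrable_integral[OF integrand_integrable[OF h]] L]
    by (simp add: o_def conv_def)
  obtain M where M: "\<And>s. norm (h s) \<le> M" using h(2) unfolding bounded_iff by blast
  obtain B where B: "0 \<le> B" "\<And>x. norm (L x) \<le> norm x * B" using nonneg_bounded by blast
  show "(\<lambda>s. norm (L (k s (h (t - e * s))))) integrable_on {0<..}"
  proof (rule integrable_Ioi_dominated)
    show "continuous_on {0<..} (\<lambda>s. norm (L (k s (h (t - e * s)))))"
      by (intro continuous_intros continuous_on continuous_on_integrand h)
    show "(\<lambda>s. m s * M * B) integrable_on {0<..}"
      using m_integral by (intro integrable_on_mult_left) auto
    show "norm (norm (L (k s (h (t - e * s))))) \<le> m s * M * B" if s: "0 < s" for s
    proof -
      have "norm (k s (h (t - e * s))) \<le> m s * M"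
        by (rule order_trans[OF bound[OF s] mult_left_mono[OF M m_nonneg[OF s]]])
      then have "norm (k s (h (t - e * s))) * B \<le> m s * M * B" using B(1) by (rule mult_right_mono)
      then show ?thesis using B(2)[of "k s (h (t - e * s))"] by simp
    qed
  qed
qed

lemma integral_below:
  assumes L: "bounded_linear L" and h: "continuous_on UNIV h" "bounded (range h)"
  shows "norm_integrable_on (\<lambda>s. L (k (t - s) (h s))) {..<t}"
    and "integral {..<t} (\<lambda>s. L (k (t - s) (h s))) = L (conv 1 h t)"
  using has_integral_reflect_below[OF has_integral_image(1)[OF L h, of t 1], of t]
    has_integral_reflect_below[OF integrable_integral[OF has_integral_image(2)[OF L h, of t 1]], of t]
  by (auto simp: norm_integrable_on_def integral_unique)

lemma integral_above:
  assumes L: "bounded_linear L" and h: "continuous_on UNIV h" "bounded (range h)"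
  shows "norm_integrable_on (\<lambda>s. L (k (s - t) (h s))) {t<..}"
    and "integral {t<..} (\<lambda>s. L (k (s - t) (h s))) = L (conv (- 1) h t)"
  using has_integral_shift_above[OF has_integral_image(1)[OF L h, of t "- 1"], of t]
    has_integral_shift_above[OF integrable_integral[OF has_integral_image(2)[OF L h, of t "- 1"]], of t]
  by (auto simp: norm_integrable_on_def integral_unique)

end

section \<open>Hyperbolic analytic semigroups\<close>

lemma bounded_clinear_imp_linear: "bounded_clinear F \<Longrightarrow> bounded_linear F"
  by (simp add: bounded_clinear_def)

locale analytic_semigroup =
  fixes D :: "'x::complex_banach set" and A :: "'x \<Rightarrow> 'x" and T :: "real \<Rightarrow> 'x \<Rightarrow> 'x"
  assumes linear_operator: "linear_operator D A"
    and generates: "generates_analytic_semigroup D A T"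
begin

lemmas generates_unfolded = generates[unfolded generates_analytic_semigroup_def]

lemma bounded_linear_T: "0 \<le> t \<Longrightarrow> bounded_linear (T t)"
  using generates_unfolded[THEN conjunct1] by (simp add: bounded_clinear_imp_linear)

lemma T_zero: "T 0 x = x"
  using generates_unfolded[THEN conjunct2, THEN conjunct1] by simp

lemma T_add: "0 \<le> s \<Longrightarrow> 0 \<le> t \<Longrightarrow> T (s + t) x = T s (T t x)"
  using generates_unfolded[THEN conjunct2, THEN conjunct2, THEN conjunct1] by simp

text \<open>The holomorphic extension is restricted to the positive axis; its complex derivative at
  a real point acts on real increments as an ordinary vector derivative.\<close>

lemma T_differentiable:
  assumes t: "0 < t"
  shows "\<exists>d. ((\<lambda>s. T s x) has_vector_derivative d) (at t)"
proof -
  have "\<exists>\<phi> S. 0 < \<phi> \<and> (\<forall>t>0. S (complex_of_real t) = T t) \<and>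
      (\<forall>z\<in>sector \<phi> 0. \<forall>x. cdifferentiable_at (\<lambda>w. S w x) z)"
    using generates_unfolded[THEN conjunct2, THEN conjunct2, THEN conjunct2, THEN conjunct1]
    by (elim exE conjE, intro exI conjI) (assumption | blast)+
  then obtain \<phi> S where \<phi>: "0 < \<phi>" and S: "\<And>t. 0 < t \<Longrightarrow> S (complex_of_real t) = T t"
    and diff: "\<And>z x. z \<in> sector \<phi> 0 \<Longrightarrow> cdifferentiable_at (\<lambda>w. S w x) z" by blast
  have "complex_of_real t \<in> sector \<phi> 0" using \<phi> t by (simp add: sector_def)
  from diff[OF this, of x] obtain d where
    d: "((\<lambda>w. S w x) has_derivative (\<lambda>h. h *\<^sub>C d)) (at (complex_of_real t))"
    unfolding cdifferentiable_at_def by blast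
  have "(complex_of_real has_derivative complex_of_real) (at t)"
    by (rule bounded_linear.has_derivative[OF bounded_linear_of_real has_derivative_ident])
  from has_derivative_compose[OF this d]
  have "((\<lambda>s. S (complex_of_real s) x) has_vector_derivative d) (at t)"
    by (simp add: has_vector_derivative_def scaleC_of_real)
  then have "((\<lambda>s. T s x) has_vector_derivative d) (at t)"
    by (rule has_vector_derivative_transform_within_open[of _ _ _ "{0<..}"]) (use t S in auto)
  then show ?thesis ..
qed

text \<open>The orbit \<open>t \<mapsto> T t x\<close> runs in the domain because the Laplace transform gives
  \<open>exp (- \<mu> t) R(\<mu>) T(t) x = R(\<mu>) x - \<integral>\<^sub>0\<^sup>t exp (- \<mu> s) T(s) x ds\<close>; differentiating at \<open>t\<close> yields
  \<open>R(\<mu>) (\<mu> T(t) x - T'(t) x) = T(t) x\<close>.\<close>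

lemma T_in_domain_and_derivative:
  assumes t: "0 < t"
  shows "T t x \<in> D" "((\<lambda>s. T s x) has_vector_derivative A (T t x)) (at t)"
proof -
  obtain d where d: "((\<lambda>s. T s x) has_vector_derivative d) (at t)"
    using T_differentiable[OF t] by blast
  obtain \<mu> :: real where \<mu>: "complex_of_real \<mu> \<in> resolvent_set D A"
    and laplace: "\<And>y. ((\<lambda>s. exp (- \<mu> * s) *\<^sub>R T s y) has_integral resolvent D A (of_real \<mu>) y) {0..}"
  proof -
    obtain w where "\<And>\<mu>. \<mu> > w \<Longrightarrow> complex_of_real \<mu> \<in> resolvent_set D A \<and> (\<forall>x.
        ((\<lambda>t. exp (- \<mu> * t) *\<^sub>R T t x) has_integral resolvent D A (of_real \<mu>) x) {0..})"
      using generates_unfolded[THEN conjunct2, THEN conjunct2, THEN conjunct2, THEN conjunct2]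
      by blast
    from this[of "w + 1"] show ?thesis by (intro that[of "w + 1"]) auto
  qed
  define R where "R = resolvent D A (of_real \<mu>)"
  interpret R: bounded_linear R
    using \<mu> by (simp add: R_def resolvent_set_def bounded_clinear_imp_linear)
  define \<phi> where "\<phi> s = exp (- \<mu> * s) *\<^sub>R T s x" for s
  have \<phi>: "(\<phi> has_integral R x) {0..}" using laplace[of x] by (simp add: \<phi>_def[abs_def] R_def)
  have \<phi>_int: "\<phi> integrable_on {0..b}" for b
    by (rule integrable_on_subinterval[of \<phi> "{0..}"]) (use \<phi> in auto)
  have eq: "exp (- \<mu> * r) *\<^sub>R R (T r x) = R x - integral {0..r} \<phi>" if r: "0 < r" for r
  proof -
    \<comment> \<open>The Laplace integral of \<open>T r x\<close> is shifted by \<open>r\<close>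
      and multiplied by exp (- \<mu> r); the semigroup law then turns it into the tail of the
      integral of \<phi> from \<open>r\<close> onwards.\<close>
    have "{s. 1 * s + - r \<in> {0..}} = {r..}" by auto
    with has_integral_affine[OF laplace[of "T r x"], of 1 "- r"]
    have "((\<lambda>s. exp (- \<mu> * (s - r)) *\<^sub>R T (s - r) (T r x)) has_integral R (T r x)) {r..}"
      by (simp add: R_def)
    then have "((\<lambda>s. exp (- \<mu> * r) *\<^sub>R (exp (- \<mu> * (s - r)) *\<^sub>R T (s - r) (T r x)))
        has_integral exp (- \<mu> * r) *\<^sub>R R (T r x)) {r..}"
      by (rule has_integral_cmul)
    moreover have "exp (- \<mu> * r) *\<^sub>R (exp (- \<mu> * (s - r)) *\<^sub>R T (s - r) (T r x)) = \<phi> s"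
      if "s \<in> {r..}" for s
      using T_add[of "s - r" r x] that r by (simp add: \<phi>_def algebra_simps flip: exp_add)
    ultimately have "(\<phi> has_integral exp (- \<mu> * r) *\<^sub>R R (T r x)) {r..}"
      by (rule has_integral_eq[rotated])
    from has_integral_Un[OF integrable_integral[OF \<phi>_int[of r]] this]
    have "(\<phi> has_integral integral {0..r} \<phi> + exp (- \<mu> * r) *\<^sub>R R (T r x)) ({0..r} \<union> {r..})"
      using negligible_subset[OF negligible_sing[of r], of "{0..r} \<inter> {r..}"] by fastforce
    moreover have "{0..r} \<union> {r..} = {0..}" using r by auto
    ultimately show ?thesis using has_integral_unique[OF _ \<phi>] by (metis add_diff_cancel_left')
  qed
  have "((\<lambda>r. exp (- \<mu> * r)) has_real_derivative - \<mu> * exp (- \<mu> * t)) (at t)"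
    by (auto intro!: derivative_eq_intros)
  then have lhs: "((\<lambda>r. exp (- \<mu> * r) *\<^sub>R R (T r x)) has_vector_derivative
      exp (- \<mu> * t) *\<^sub>R R d + (- \<mu> * exp (- \<mu> * t)) *\<^sub>R R (T t x)) (at t)"
    by (intro has_vector_derivative_scaleR R.has_vector_derivative d)
  have "isCont \<phi> t"
    unfolding \<phi>_def using has_vector_derivative_continuous[OF d] by (intro continuous_intros) auto
  have "((\<lambda>r. integral {0..r} \<phi>) has_vector_derivative \<phi> t) (at t within {0..t + 1})"
    by (rule integral_has_vector_derivative_continuous_at[where S = "{}", simplified, OF \<phi>_int])
      (use t \<open>isCont \<phi> t\<close> in \<open>auto intro: continuous_at_imp_continuous_at_within\<close>)
  then have "((\<lambda>r. integral {0..r} \<phi>) has_vector_derivative \<phi> t) (at t)"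
    using at_within_interior[of t "{0..t + 1}"] t by (simp add: interior_atLeastAtMost_real)
  then have "((\<lambda>r. R x - integral {0..r} \<phi>) has_vector_derivative 0 - \<phi> t) (at t)"
    by (intro has_vector_derivative_diff has_vector_derivative_const)
  then have "((\<lambda>r. exp (- \<mu> * r) *\<^sub>R R (T r x)) has_vector_derivative 0 - \<phi> t) (at t)"
    by (rule has_vector_derivative_transform_within_open[of _ _ _ "{0<..}"]) (use t eq in auto)
  from vector_derivative_unique_at[OF lhs this]
  have "exp (- \<mu> * t) *\<^sub>R (R d - \<mu> *\<^sub>R R (T t x)) = exp (- \<mu> * t) *\<^sub>R (- T t x)"
    by (simp add: \<phi>_def algebra_simps)
  then have "R d - \<mu> *\<^sub>R R (T t x) = - T t x" unfolding scaleR_cancel_left by simp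
  then have Ry: "R (\<mu> *\<^sub>R T t x - d) = T t x" by (simp add: R.diff R.scale algebra_simps)
  have bij: "bij_betw (\<lambda>x. complex_of_real \<mu> *\<^sub>C x - A x) D UNIV"
    using \<mu> by (simp add: resolvent_set_def)
  then have "R y \<in> D" "\<mu> *\<^sub>R R y - A (R y) = y" for y
    using inv_into_into[of y "\<lambda>x. complex_of_real \<mu> *\<^sub>C x - A x" D]
      f_inv_into_f[of y "\<lambda>x. complex_of_real \<mu> *\<^sub>C x - A x" D]
    by (auto simp: R_def resolvent_def bij_betw_def scaleC_of_real)
  \<comment> \<open>For this \<open>y\<close> the resolvent value is \<open>T t x\<close>, and the
    second identity becomes \<open>A (T t x) = d\<close>.\<close>
  from this[of "\<mu> *\<^sub>R T t x - d"] show "T t x \<in> D" "((\<lambda>s. T s x) has_vector_derivative A (T t x)) (at t)"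
    using d unfolding Ry by auto
qed

text \<open>\<open>A\<close> is linear on \<open>D\<close> only, and for positive \<open>t\<close>
  the map \<open>T t\<close> takes values there.\<close>

lemma linear_AT:
  assumes t: "0 < t"
  shows "linear (\<lambda>x. A (T t x))"
proof -
  interpret bounded_linear "T t" using t by (intro bounded_linear_T) simp
  show ?thesis
  proof (rule linearI)
    show "A (T t (x + y)) = A (T t x) + A (T t y)" for x y
      using linear_operator T_in_domain_and_derivative(1)[OF t]
      by (simp add: add linear_operator_def)
    show "A (T t (r *\<^sub>R x)) = r *\<^sub>R A (T t x)" for r x
    proof -
      have "A (complex_of_real r *\<^sub>C T t x) = complex_of_real r *\<^sub>C A (T t x)"
        using linear_operator T_in_domain_and_derivative(1)[OF t] by (simp add: linear_operator_def)
      then show ?thesis by (simp add: scaleR scaleC_of_real)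
    qed
  qed
qed

text \<open>The orbit r \<mapsto> T (s + r) x is differentiated at \<open>t\<close> in two ways:
  through the bounded factor \<open>T s\<close>, and as a shifted orbit.\<close>

lemma T_AT:
  assumes s: "0 \<le> s" and t: "0 < t"
  shows "T s (A (T t x)) = A (T (s + t) x)"
proof -
  have "((\<lambda>r. T s (T r x)) has_vector_derivative T s (A (T t x))) (at t)"
    by (rule bounded_linear.has_vector_derivative[OF bounded_linear_T[OF s]
          T_in_domain_and_derivative(2)[OF t]])
  then have 1: "((\<lambda>r. T (s + r) x) has_vector_derivative T s (A (T t x))) (at t)"
    by (rule has_vector_derivative_transform_within_open[of _ _ _ "{0<..}"])
      (use s t in \<open>auto simp: T_add\<close>)
  have "((\<lambda>r. T r x) \<circ> (\<lambda>r. s + r) has_vector_derivative 1 *\<^sub>R A (T (s + t) x)) (at t)"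
    by (intro vector_diff_chain_at T_in_domain_and_derivative)
      (use s t in \<open>auto intro!: derivative_eq_intros\<close>)
  then have 2: "((\<lambda>r. T (s + r) x) has_vector_derivative A (T (s + t) x)) (at t)"
    by (simp add: o_def)
  show ?thesis by (rule vector_derivative_unique_at[OF 1 2])
qed

text \<open>A bounded map that commutes with the semigroup carries orbits to orbits, hence their
  derivatives to derivatives. It is applied to both projections.\<close>

lemma commute_AT:
  assumes L: "bounded_linear L" and comm: "\<And>s x. 0 \<le> s \<Longrightarrow> L (T s x) = T s (L x)" and t: "0 < t"
  shows "L (A (T t x)) = A (T t (L x))"
proof -
  have "((\<lambda>r. L (T r x)) has_vector_derivative L (A (T t x))) (at t)"
    by (rule bounded_linear.has_vector_derivative[OF L T_in_domain_and_derivative(2)[OF t]])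
  then have "((\<lambda>r. T r (L x)) has_vector_derivative L (A (T t x))) (at t)"
    by (rule has_vector_derivative_transform_within_open[of _ _ _ "{0<..}"])
      (use t in \<open>auto simp: comm\<close>)
  from vector_derivative_unique_at[OF this T_in_domain_and_derivative(2)[OF t]] show ?thesis .
qed

lemma continuous_on_T: "continuous_on {0<..} (\<lambda>t. T t x)"
  by (intro continuous_at_imp_continuous_on ballI
      has_vector_derivative_continuous[OF T_in_domain_and_derivative(2)]) simp

text \<open>Near \<open>t\<close> the function equals the orbit of the fixed vector A T(t/2) x, run
  for the time s - t/2, so continuity of orbits suffices.\<close>

lemma continuous_on_AT: "continuous_on {0<..} (\<lambda>t. A (T t x))"
proof (intro continuous_at_imp_continuous_on ballI)
  fix t :: real assume "t \<in> {0<..}"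
  then have t: "0 < t" by simp
  have "continuous_on {t / 2<..} (\<lambda>s. T (s - t / 2) (A (T (t / 2) x)))"
    by (rule continuous_on_compose2[OF continuous_on_T]) (auto intro!: continuous_intros)
  then have "continuous_on {t / 2<..} (\<lambda>s. A (T s x))"
    using t by (subst continuous_on_cong[OF refl]) (auto simp: T_AT)
  then show "isCont (\<lambda>s. A (T s x)) t"
    using t by (simp add: continuous_on_eq_continuous_at)
qed

end

locale hyperbolic_semigroup = analytic_semigroup D A T
  for D :: "'x::complex_banach set" and A and T :: "real \<Rightarrow> 'x \<Rightarrow> 'x" +
  fixes P Q :: "'x \<Rightarrow> 'x" and \<delta> :: real
  assumes hyperbolic: "hyperbolic T P \<delta>" and Q: "Q = compl_proj P"
begin

section \<open>The projections and the backward flow\<close>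

lemma bounded_linear_P: "bounded_linear P"
  and P_P: "P (P x) = P x"
  and T_P: "0 \<le> t \<Longrightarrow> T t (P x) = P (T t x)"
  and bij_T: "0 \<le> t \<Longrightarrow> bij_betw (T t) (range Q) (range Q)"
  using hyperbolic by (simp_all add: hyperbolic_def bounded_clinear_imp_linear Q)

lemma bounded_linear_Q: "bounded_linear Q"
  unfolding Q compl_proj_def by (intro bounded_linear_sub bounded_linear_ident bounded_linear_P)

lemma T_Q:
  assumes "0 \<le> t"
  shows "Q (T t x) = T t (Q x)"
  using linear_diff[OF bounded_linear.linear[OF bounded_linear_T[OF assms]]] assms
  by (simp add: Q compl_proj_def T_P)

lemma Q_Q: "Q (Q x) = Q x"
  using linear_diff[OF bounded_linear.linear[OF bounded_linear_P]]
  by (simp add: Q compl_proj_def P_P)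

lemma range_Q_iff: "z \<in> range Q \<longleftrightarrow> Q z = z"
  by (metis Q_Q rangeE rangeI)

text \<open>T(-s) Q for s \<ge> 0, with the sign of time reversed so that it becomes a kernel on the
  positive half-line.\<close>

definition backward :: "real \<Rightarrow> 'x \<Rightarrow> 'x"
  where "backward s x = group_ext T Q (- s) (Q x)"

lemma
  assumes "0 \<le> s"
  shows Q_backward: "Q (backward s x) = backward s x"
    and T_backward_self: "T s (backward s x) = Q x"
proof -
  have *: "backward s x = inv_into (range Q) (T s) (Q x)"
  \<comment> \<open>At time 0 \<open>group_ext\<close> takes the branch \<open>T 0\<close> instead
    of the inverse; both fix \<open>Q x\<close>.\<close>
  proof (cases "s = 0")
    case True
    have "inv_into (range Q) (T 0) (Q x) = Q x"
      by (intro inv_into_f_eq) (auto simp: T_zero inj_on_def)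
    then show ?thesis using True by (simp add: backward_def group_ext_def T_zero)
  qed (use assms in \<open>simp add: backward_def group_ext_def\<close>)
  have mem: "Q x \<in> T s ` range Q" using bij_T[OF assms] by (simp add: bij_betw_def)
  show "Q (backward s x) = backward s x"
    using inv_into_into[OF mem] unfolding * range_Q_iff .
  show "T s (backward s x) = Q x"
    unfolding * by (rule f_inv_into_f[OF mem])
qed

text \<open>This characterization replaces reasoning about \<open>inv_into\<close>: linearity and
  the semigroup rules of \<open>backward\<close> below follow from it.\<close>

lemma backward_unique:
  assumes "0 \<le> s" "Q z = z" "T s z = Q x"
  shows "backward s x = z"
  using bij_T[OF assms(1)] assms Q_backward[OF assms(1), of x] T_backward_self[OF assms(1), of x]
  by (auto simp: bij_betw_def range_Q_iff intro: inj_onD)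

lemma backward_zero: "backward 0 x = Q x"
  by (rule backward_unique) (simp_all add: Q_Q T_zero)

lemma linear_backward:
  assumes s: "0 \<le> s"
  shows "linear (backward s)"
proof (rule linearI)
  interpret T: bounded_linear "T s" by (rule bounded_linear_T[OF s])
  interpret Q: bounded_linear Q by (rule bounded_linear_Q)
  show "backward s (x + y) = backward s x + backward s y" for x y
    by (rule backward_unique[OF s]) (simp_all add: Q.add T.add Q_backward T_backward_self s)
  show "backward s (r *\<^sub>R x) = r *\<^sub>R backward s x" for r x
    by (rule backward_unique[OF s]) (simp_all add: Q.scaleR T.scaleR Q_backward T_backward_self s)
qed

lemma T_backward:
  assumes "0 \<le> r" "r \<le> s"
  shows "T r (backward s x) = backward (s - r) x"
proof (rule backward_unique[symmetric])
  have "T (s - r) (T r (backward s x)) = T s (backward s x)"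
    using T_add[of "s - r" r "backward s x"] assms by simp
  then show "T (s - r) (T r (backward s x)) = Q x" using assms by (simp add: T_backward_self)
qed (use assms in \<open>simp_all add: T_Q Q_backward\<close>)

lemma T_P_split:
  assumes "0 < r" "r < s"
  shows "T s (P x) = T r (P (T (s - r) x))"
  using T_add[of r "s - r" "P x"] assms by (simp add: T_P)

text \<open>\<open>A\<close> falls on the inner orbit, which is strongly continuous in the ambient
  space, so the outer factor is the same T(r) P as without \<open>A\<close>.\<close>

lemma AT_P_split:
  assumes "0 < r" "r < s"
  shows "A (T s (P x)) = T r (P (A (T (s - r) x)))"
  using T_AT[of r "s - r" "P x"] commute_AT[OF bounded_linear_P, of "s - r" x] assms
  by (simp add: T_P)

text \<open>On the unstable part the fixed outer factor is Q itself, written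
  \<open>backward 0\<close> so that the estimate at time 0 applies. The inner factor is a forward
  orbit started from a point further back in time.\<close>

lemma backward_split:
  assumes "0 < s" "s < r"
  shows "backward s x = backward 0 (T (r - s) (backward r x))"
  using T_backward[of "r - s" r x] assms by (simp add: backward_zero Q_backward)

lemma A_backward_split:
  assumes "0 < s" "s < r"
  shows "A (backward s x) = backward 0 (A (T (r - s) (backward r x)))"
  using T_backward[of "r - s" r x] commute_AT[OF bounded_linear_Q, of "r - s" "backward r x"] assms
  by (simp add: backward_zero Q_backward T_Q)

text \<open>Going back one unit too far and forward again by \<open>T 1\<close> shows that the
  values lie in the domain, where \<open>A\<close> is linear.\<close>

lemma linear_A_backward:
  assumes s: "0 \<le> s"
  shows "linear (\<lambda>x. A (backward s x))"
proof -
  have "backward s x = T 1 (backward (s + 1) x)" for x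
    using T_backward[of 1 "s + 1" x] s by simp
  then have eq: "(\<lambda>x. A (backward s x)) = (\<lambda>x. A (T 1 x)) \<circ> backward (s + 1)"
    by (simp add: fun_eq_iff)
  show ?thesis
    unfolding eq using s by (intro linear_compose linear_backward linear_AT) auto
qed

end

section \<open>Kernels with values in an intermediate space\<close>

lemma norm_le_inD:
  assumes "inj \<iota>" "norm_le_in \<iota> y r"
  shows "\<iota> (inv \<iota> y) = y" "norm (inv \<iota> y) \<le> r"
  using assms unfolding norm_le_in_def by (auto simp: inv_f_f)

text \<open>The inverse of the inclusion is meaningful only on its range; \<open>in_range\<close>
  puts all values of \<open>F\<close> there, and injectivity then identifies sums and
  multiples.\<close>

lemma linear_inv_comp:
  assumes \<iota>: "bounded_linear \<iota>" "inj \<iota>" and F: "linear F" and in_range: "\<And>y. norm_le_in \<iota> (F y) (r y)"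
  shows "linear (\<lambda>y. inv \<iota> (F y))"
proof (rule linearI)
  interpret \<iota>: bounded_linear \<iota> by (rule \<iota>(1))
  note [simp] = norm_le_inD(1)[OF \<iota>(2) in_range]
  show "inv \<iota> (F (x + y)) = inv \<iota> (F x) + inv \<iota> (F y)" for x y
    by (rule inv_f_eq[OF \<iota>(2)]) (simp add: \<iota>.add linear_add[OF F])
  show "inv \<iota> (F (c *\<^sub>R x)) = c *\<^sub>R inv \<iota> (F x)" for c x
    by (rule inv_f_eq[OF \<iota>(2)]) (simp add: \<iota>.scaleR linear_scale[OF F])
qed

lemma bounded_linear_inv_comp:
  assumes \<iota>: "bounded_linear \<iota>" "inj \<iota>" and F: "linear F"
    and in_range: "\<And>y. norm_le_in \<iota> (F y) (c * norm y)"
  shows "bounded_linear (\<lambda>y. inv \<iota> (F y))"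
proof -
  note lin = linear_inv_comp[OF \<iota> F in_range]
  show ?thesis
    by (rule bounded_linear_intro[where K = c])
      (use linear_add[OF lin] linear_scale[OF lin] norm_le_inD(2)[OF \<iota>(2) in_range]
        in \<open>simp_all add: mult.commute\<close>)
qed

text \<open>Continuity in the ambient space does not lift, as the inverse of the inclusion need not
  be continuous. The hypothesis \<open>split\<close> asks that near each \<open>s\<close> the kernel
  be a fixed map \<open>G\<close>, bounded into the smaller space, applied to a curve that is
  continuous in the ambient space.\<close>

lemma convolution_kernel_lift:
  fixes \<iota> :: "'a::complex_banach \<Rightarrow> 'x::complex_banach" and F :: "real \<Rightarrow> 'y::banach \<Rightarrow> 'x"
  assumes \<iota>: "bounded_linear \<iota>" "inj \<iota>" and F: "\<And>s. 0 < s \<Longrightarrow> linear (F s)"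
    and bound: "\<And>s y. 0 < s \<Longrightarrow> norm_le_in \<iota> (F s y) (m s * norm y)"
    and m: "\<And>s. 0 < s \<Longrightarrow> 0 \<le> m s" "continuous_on {0<..} m" "(m has_integral I) {0<..}"
    and split: "\<And>s y. 0 < s \<Longrightarrow> \<exists>a b G c w. s \<in> {a<..<b} \<and> linear G \<and>
      (\<forall>z. norm_le_in \<iota> (G z) (c * norm z)) \<and> continuous_on {a<..<b} w \<and>
      (\<forall>r\<in>{a<..<b}. F r y = G (w r :: 'x))"
  shows "convolution_kernel (\<lambda>s y. inv \<iota> (F s y)) m I"
proof (rule convolution_kernel.intro)
  fix y
  show "continuous_on {0<..} (\<lambda>s. inv \<iota> (F s y))"
  proof (intro continuous_at_imp_continuous_on ballI)
    fix s :: real assume "s \<in> {0<..}"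
    then have "0 < s" by simp
    from split[OF this, of y] obtain a b G c w where s: "s \<in> {a<..<b}" and G: "linear G"
      "\<And>z. norm_le_in \<iota> (G z) (c * norm z)" and w: "continuous_on {a<..<b} w"
      and eq: "\<And>r. r \<in> {a<..<b} \<Longrightarrow> F r y = G (w r :: 'x)"
      by blast
    have "continuous_on {a<..<b} (\<lambda>r. inv \<iota> (G (w r)))"
      by (rule bounded_linear.continuous_on[OF bounded_linear_inv_comp[OF \<iota> G] w])
    then have "continuous_on {a<..<b} (\<lambda>r. inv \<iota> (F r y))"
      by (subst continuous_on_cong[OF refl]) (auto simp: eq)
    then show "isCont (\<lambda>r. inv \<iota> (F r y)) s"
      using s by (simp add: continuous_on_eq_continuous_at)
  qed
next
  fix s :: real and y assume s: "0 < s"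
  show "linear (\<lambda>y. inv \<iota> (F s y))" by (rule linear_inv_comp[OF \<iota> F[OF s] bound[OF s]])
  show "norm (inv \<iota> (F s y)) \<le> m s * norm y" by (rule norm_le_inD(2)[OF \<iota>(2) bound[OF s]])
qed (fact m)+

section \<open>The contraction principle in PAP\<close>

lemma PAP_zero: "(\<lambda>_. 0) \<in> PAP"
proof (rule PAP_I[OF _ AP0_zero])
  have "\<exists>\<tau>\<in>{a..a + 1}. \<tau> \<in> UNIV" for a :: real by (rule bexI[of _ a]) simp_all
  then have "relatively_dense UNIV" unfolding relatively_dense_def by (intro exI[of _ 1]) simp
  then show "(\<lambda>_. 0) \<in> AP" by (intro AP_I) auto
qed simp

text \<open>Banach's theorem in the space of bounded continuous functions with the supremum metric,
  on the subset \<open>S\<close> of pseudo almost periodic ones; \<open>S\<close> is complete by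
  \<open>PAP_uniform_limit\<close>.\<close>

lemma PAP_contraction_fixpoint:
  fixes \<Lambda> :: "(real \<Rightarrow> 'a::banach) \<Rightarrow> real \<Rightarrow> 'a"
  assumes \<Lambda>: "\<And>u. u \<in> PAP \<Longrightarrow> \<Lambda> u \<in> PAP" and c: "0 \<le> c" "c < 1"
    and contr: "\<And>u v d t. u \<in> PAP \<Longrightarrow> v \<in> PAP \<Longrightarrow> (\<And>t. norm (u t - v t) \<le> d) \<Longrightarrow>
      norm (\<Lambda> u t - \<Lambda> v t) \<le> c * d"
  shows "\<exists>!u. u \<in> PAP \<and> \<Lambda> u = u"
proof -
  define S where "S = {v :: real \<Rightarrow>\<^sub>C 'a. apply_bcontfun v \<in> PAP}"
  define \<Phi> where "\<Phi> v = Bcontfun (\<Lambda> (apply_bcontfun v))" for v :: "real \<Rightarrow>\<^sub>C 'a"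
  have bcf: "apply_bcontfun (Bcontfun u) = u" if "u \<in> PAP" for u :: "real \<Rightarrow> 'a"
    by (rule Bcontfun_inverse) (use that in \<open>simp add: bcontfun_def PAP_continuous PAP_bounded\<close>)
  have \<Phi>: "apply_bcontfun (\<Phi> v) = \<Lambda> (apply_bcontfun v)" if "v \<in> S" for v
    unfolding \<Phi>_def using that by (intro bcf \<Lambda>) (simp add: S_def)
  have "closed S"
    unfolding closed_sequential_limits
  proof (intro allI impI, elim conjE)
    fix v l assume v: "\<forall>n. v n \<in> S" and lim: "v \<longlonglongrightarrow> l"
    have "apply_bcontfun l \<in> PAP"
      by (rule PAP_uniform_limit[OF tendsto_bcontfun_uniform_limit[OF lim]]) (use v in \<open>simp add: S_def\<close>)
    then show "l \<in> S" by (simp add: S_def)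
  qed
  then have "complete S" by (simp add: complete_eq_closed)
  moreover have "S \<noteq> {}" using bcf[OF PAP_zero] PAP_zero unfolding S_def by (metis empty_iff mem_Collect_eq)
  moreover have "\<Phi> ` S \<subseteq> S" using \<Phi> \<Lambda> by (auto simp: S_def)
  moreover have "\<forall>x\<in>S. \<forall>y\<in>S. dist (\<Phi> x) (\<Phi> y) \<le> c * dist x y"
  proof (intro ballI dist_bound)
    fix x y t assume xy: "x \<in> S" "y \<in> S"
    then show "dist (apply_bcontfun (\<Phi> x) t) (apply_bcontfun (\<Phi> y) t) \<le> c * dist x y"
      using contr[of x y "dist x y" t] dist_bounded[of x _ y] by (simp add: \<Phi> S_def dist_norm)
  qed
  ultimately have ex1: "\<exists>!v. v \<in> S \<and> \<Phi> v = v" using Banach_fix[of S c \<Phi>] c by auto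
  then obtain v where v: "v \<in> S" "\<Phi> v = v" and uniq: "\<And>v'. v' \<in> S \<Longrightarrow> \<Phi> v' = v' \<Longrightarrow> v' = v" by blast
  show ?thesis
  proof (rule ex1I[of _ "apply_bcontfun v"])
    show "apply_bcontfun v \<in> PAP \<and> \<Lambda> (apply_bcontfun v) = apply_bcontfun v"
      using v \<Phi>[OF v(1)] by (simp add: S_def)
    fix u assume u: "u \<in> PAP \<and> \<Lambda> u = u"
    then have "Bcontfun u \<in> S" "\<Phi> (Bcontfun u) = Bcontfun u"
      by (simp_all add: S_def \<Phi>_def bcf)
    from uniq[OF this] show "u = apply_bcontfun v" using bcf u by metis
  qed
qed

section \<open>The contraction\<close>

lemma norm_integrable_on_cong:
  "(\<And>s. s \<in> S \<Longrightarrow> h s = g s) \<Longrightarrow> norm_integrable_on h S \<longleftrightarrow> norm_integrable_on g S"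
  unfolding norm_integrable_on_def by (simp cong: integrable_cong)

lemma admissible_imp_embedding:
  assumes "admissible D A T \<alpha> \<iota>"
  shows "bounded_linear \<iota>" "inj \<iota>"
  using assms by (auto simp: admissible_def realizes_def bounded_clinear_imp_linear)

theorem theorem3p5:
  fixes D :: "'x::complex_banach set" and A :: "'x \<Rightarrow> 'x"
    and T :: "real \<Rightarrow> 'x \<Rightarrow> 'x" and P Q :: "'x \<Rightarrow> 'x"
    and \<iota>\<^sub>\<alpha> :: "'a::complex_banach \<Rightarrow> 'x" and \<iota>\<^sub>\<beta> :: "'b::complex_banach \<Rightarrow> 'x"
    and B C :: "'a \<Rightarrow> 'x"
    and f :: "real \<Rightarrow> 'x \<Rightarrow> 'b" and g :: "real \<Rightarrow> 'x \<Rightarrow> 'x"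
    and \<alpha> \<beta> \<delta> \<gamma> K c M\<^sub>\<alpha> c\<^sub>\<alpha> k\<^sub>\<alpha> w \<Theta> :: real
  assumes sectorial: "sectorial D A"
    and generates: "generates_analytic_semigroup D A T"
    and hyperbolic: "hyperbolic T P \<delta>"
    and Q: "Q = compl_proj P"
    and orders: "0 < \<alpha>" "\<alpha> < \<beta>" "\<beta> < 1"
    and adm_alpha: "admissible D A T \<alpha> \<iota>\<^sub>\<alpha>"
    and adm_beta: "admissible D A T \<beta> \<iota>\<^sub>\<beta>"
    and B: "bounded_clinear B" and C: "bounded_clinear C"
    and domain_sum: "D \<inter> range \<iota>\<^sub>\<alpha> \<noteq> {0}"
    and f_PAP: "f \<in> PAP_unif" and g_PAP: "g \<in> PAP_unif"
    and K: "0 < K"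
    and f_Lip: "\<And>t u v. norm (f t u - f t v) \<le> K * norm (u - v)"
    and g_Lip: "\<And>t u v. norm (g t u - g t v) \<le> K * norm (u - v)"
    and constants: "0 < c" "0 < \<gamma>" "0 < M\<^sub>\<alpha>" "0 < c\<^sub>\<alpha>" "0 < k\<^sub>\<alpha>"
    and est_TQ: "\<And>t x. t \<le> 0 \<Longrightarrow>
      norm_le_in \<iota>\<^sub>\<alpha> (group_ext T Q t (Q x)) (c\<^sub>\<alpha> * exp (\<delta> * t) * norm x)"
    and est_TP: "\<And>t x. t > 0 \<Longrightarrow>
      norm_le_in \<iota>\<^sub>\<alpha> (T t (P x)) (M\<^sub>\<alpha> * t powr (- \<alpha>) * exp (- \<gamma> * t) * norm x)"
    and est_ATQ: "\<And>t (x :: 'b). t \<le> 0 \<Longrightarrow>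
      norm_le_in \<iota>\<^sub>\<alpha> (A (group_ext T Q t (Q (\<iota>\<^sub>\<beta> x)))) (c * exp (\<delta> * t) * norm x)"
    and est_ATP: "\<And>t (x :: 'b). t > 0 \<Longrightarrow>
      norm_le_in \<iota>\<^sub>\<alpha> (A (T t (P (\<iota>\<^sub>\<beta> x)))) (c * t powr (\<beta> - \<alpha> - 1) * exp (- \<gamma> * t) * norm x)"
    and embedding: "\<And>x :: 'b. norm_le_in \<iota>\<^sub>\<alpha> (\<iota>\<^sub>\<beta> x) (k\<^sub>\<alpha> * norm x)"
    and w: "w = max (onorm B) (onorm C)"
    and Theta: "\<Theta> = K * w * (k\<^sub>\<alpha> + c / \<delta> + c * Gamma (\<beta> - \<alpha>) / \<gamma> powr (\<beta> - \<alpha>)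
              + M\<^sub>\<alpha> * Gamma (1 - \<alpha>) / \<gamma> powr (1 - \<alpha>) + c\<^sub>\<alpha> / \<delta>)"
    and contraction: "\<Theta> < 1"
  shows "\<exists>!u. u \<in> PAP \<and> mild_solution A T P \<iota>\<^sub>\<alpha> \<iota>\<^sub>\<beta> B C f g u"
proof -
  interpret hyperbolic_semigroup D A T P Q \<delta>
    by unfold_locales (use sectorial generates hyperbolic Q in \<open>auto simp: sectorial_def\<close>)
  note \<iota> = admissible_imp_embedding[OF adm_alpha]
  note \<iota>' = admissible_imp_embedding[OF adm_beta]
  interpret \<iota>: bounded_linear \<iota>\<^sub>\<alpha> by (rule \<iota>(1))
  have \<delta>: "0 < \<delta>" using hyperbolic by (simp add: hyperbolic_def)
  note lin_\<iota>' = bounded_linear.linear[OF \<iota>'(1)]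
  note lin_P = bounded_linear.linear[OF bounded_linear_P]
  have lin_TP: "linear (\<lambda>x. T s (P x))" if "0 < s" for s
    using linear_compose[OF lin_P bounded_linear.linear[OF bounded_linear_T[of s]]] that by (simp add: o_def)
  \<comment> \<open>The estimates for nonpositive times are rewritten for \<open>backward\<close>
    with t = -s.\<close>
  have est_Q: "norm_le_in \<iota>\<^sub>\<alpha> (backward s z) (c\<^sub>\<alpha> * exp (- \<delta> * s) * norm z)" if "0 \<le> s" for s z
    using est_TQ[of "- s" z] that by (simp add: backward_def)
  have est_AQ: "norm_le_in \<iota>\<^sub>\<alpha> (A (backward s (\<iota>\<^sub>\<beta> z))) (c * exp (- \<delta> * s) * norm z)"
    if "0 \<le> s" for s z
    using est_ATQ[of "- s" z] that by (simp add: backward_def)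
  have exp_integral: "((\<lambda>s. b * exp (- \<delta> * s)) has_integral b / \<delta>) {0<..}" for b
    using has_integral_mult_right[OF has_integral_exp_minus_to_infinity[OF \<delta>, of 0], of b]
    by (simp add: has_integral_Ioi_iff_Ici)
  have powr_integral: "((\<lambda>s. b * s powr (a - 1) * exp (- \<gamma> * s)) has_integral b * Gamma a / \<gamma> powr a) {0<..}"
    if "0 < a" for a b :: real
    using has_integral_mult_right[OF has_integral_powr_exp[OF that constants(2)], of b]
    by (simp add: mult.assoc)
  have shift_T: "continuous_on {a<..<b} (\<lambda>r. T (r - a) v)" "continuous_on {a<..<b} (\<lambda>r. A (T (r - a) v))"
    "continuous_on {a<..<b} (\<lambda>r. T (b - r) v)" "continuous_on {a<..<b} (\<lambda>r. A (T (b - r) v))" for a b v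
    by (rule continuous_on_compose2[OF continuous_on_T] continuous_on_compose2[OF continuous_on_AT];
        force intro!: continuous_intros)+

  \<comment> \<open>Four kernels: \<open>k1\<close> and \<open>k3\<close> for the stable part,
    \<open>k2\<close> and \<open>k4\<close> for the unstable part; \<open>k1\<close> and
    \<open>k2\<close> act on g, while \<open>k3\<close> and \<open>k4\<close> contain
    \<open>A\<close> and act on f.\<close>
  interpret k1: convolution_kernel "\<lambda>s x. inv \<iota>\<^sub>\<alpha> (T s (P x))"
    "\<lambda>s. M\<^sub>\<alpha> * s powr (- \<alpha>) * exp (- \<gamma> * s)" "M\<^sub>\<alpha> * Gamma (1 - \<alpha>) / \<gamma> powr (1 - \<alpha>)"
  proof (rule convolution_kernel_lift[OF \<iota> lin_TP est_TP])
    show "((\<lambda>s. M\<^sub>\<alpha> * s powr (- \<alpha>) * exp (- \<gamma> * s)) has_integral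
        M\<^sub>\<alpha> * Gamma (1 - \<alpha>) / \<gamma> powr (1 - \<alpha>)) {0<..}"
      using powr_integral[of "1 - \<alpha>" M\<^sub>\<alpha>] orders by simp
    show "continuous_on {0<..} (\<lambda>s. M\<^sub>\<alpha> * s powr - \<alpha> * exp (- \<gamma> * s))"
      by (intro continuous_intros) auto
    fix s :: real and y assume s: "0 < s"
    show "\<exists>a b G c w. s \<in> {a<..<b} \<and> linear G \<and> (\<forall>z. norm_le_in \<iota>\<^sub>\<alpha> (G z) (c * norm z)) \<and>
        continuous_on {a<..<b} w \<and> (\<forall>r\<in>{a<..<b}. T r (P y) = G (w r :: 'x))"
      \<comment> \<open>The outer factor T(s/2) P is the same for all r between s/2 and s + 1; the
        constant left open is read off from \<open>est_TP\<close> at s/2.\<close>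
      by (rule exI[of _ "s / 2"], rule exI[of _ "s + 1"], rule exI[of _ "\<lambda>z. T (s / 2) (P z)"], rule exI,
          rule exI[of _ "\<lambda>r. T (r - s / 2) y"])
        (use s in \<open>auto intro!: lin_TP est_TP shift_T T_P_split\<close>)
  qed (use constants in auto)

  interpret k3: convolution_kernel "\<lambda>s y. inv \<iota>\<^sub>\<alpha> (A (T s (P (\<iota>\<^sub>\<beta> y))))"
    "\<lambda>s. c * s powr (\<beta> - \<alpha> - 1) * exp (- \<gamma> * s)" "c * Gamma (\<beta> - \<alpha>) / \<gamma> powr (\<beta> - \<alpha>)"
  proof (rule convolution_kernel_lift[OF \<iota>])
    show "((\<lambda>s. c * s powr (\<beta> - \<alpha> - 1) * exp (- \<gamma> * s)) has_integral
        c * Gamma (\<beta> - \<alpha>) / \<gamma> powr (\<beta> - \<alpha>)) {0<..}"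
      using powr_integral[of "\<beta> - \<alpha>" c] orders by simp
    show "continuous_on {0<..} (\<lambda>s. c * s powr (\<beta> - \<alpha> - 1) * exp (- \<gamma> * s))"
      by (intro continuous_intros) auto
    fix s :: real and y assume s: "0 < s"
    show "norm_le_in \<iota>\<^sub>\<alpha> (A (T s (P (\<iota>\<^sub>\<beta> y)))) (c * s powr (\<beta> - \<alpha> - 1) * exp (- \<gamma> * s) * norm y)"
      by (rule est_ATP[OF s])
    show "linear (\<lambda>y. A (T s (P (\<iota>\<^sub>\<beta> y))))"
      using linear_compose[OF linear_compose[OF lin_\<iota>' lin_P] linear_AT[OF s]] by (simp add: o_def)
    show "\<exists>a b G c w. s \<in> {a<..<b} \<and> linear G \<and> (\<forall>z. norm_le_in \<iota>\<^sub>\<alpha> (G z) (c * norm z)) \<and>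
        continuous_on {a<..<b} w \<and> (\<forall>r\<in>{a<..<b}. A (T r (P (\<iota>\<^sub>\<beta> y))) = G (w r :: 'x))"
      \<comment> \<open>The outer factor acts on the ambient space, so its bound comes from
        \<open>est_TP\<close>; the curve carries \<open>A\<close>.\<close>
      by (rule exI[of _ "s / 2"], rule exI[of _ "s + 1"], rule exI[of _ "\<lambda>z. T (s / 2) (P z)"], rule exI,
          rule exI[of _ "\<lambda>r. A (T (r - s / 2) (\<iota>\<^sub>\<beta> y))"])
        (use s in \<open>auto intro!: lin_TP est_TP shift_T AT_P_split\<close>)
  qed (use constants in auto)

  interpret k2: convolution_kernel "\<lambda>s x. inv \<iota>\<^sub>\<alpha> (backward s x)" "\<lambda>s. c\<^sub>\<alpha> * exp (- \<delta> * s)" "c\<^sub>\<alpha> / \<delta>"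
  proof (rule convolution_kernel_lift[OF \<iota>])
    fix s :: real and y assume s: "0 < s"
    show "linear (backward s)" using s by (intro linear_backward) simp
    show "norm_le_in \<iota>\<^sub>\<alpha> (backward s y) (c\<^sub>\<alpha> * exp (- \<delta> * s) * norm y)" using s by (intro est_Q) simp
    show "\<exists>a b G c w. s \<in> {a<..<b} \<and> linear G \<and> (\<forall>z. norm_le_in \<iota>\<^sub>\<alpha> (G z) (c * norm z)) \<and>
        continuous_on {a<..<b} w \<and> (\<forall>r\<in>{a<..<b}. backward r y = G (w r :: 'x))"
      \<comment> \<open>The starting point at s + 1 lies strictly further back than
        \<open>s\<close>, so the forward orbit runs for the positive time s + 1 - r on a whole
        neighbourhood of \<open>s\<close>.\<close>
      by (rule exI[of _ 0], rule exI[of _ "s + 1"], rule exI[of _ "backward 0"], rule exI,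
          rule exI[of _ "\<lambda>r. T (s + 1 - r) (backward (s + 1) y)"])
        (use s in \<open>auto intro!: linear_backward est_Q shift_T backward_split\<close>)
  qed (use constants exp_integral in \<open>auto intro!: continuous_intros\<close>)

  interpret k4: convolution_kernel "\<lambda>s y. inv \<iota>\<^sub>\<alpha> (A (backward s (\<iota>\<^sub>\<beta> y)))" "\<lambda>s. c * exp (- \<delta> * s)" "c / \<delta>"
  proof (rule convolution_kernel_lift[OF \<iota>])
    fix s :: real and y assume s: "0 < s"
    show "linear (\<lambda>y. A (backward s (\<iota>\<^sub>\<beta> y)))"
      using linear_compose[OF lin_\<iota>' linear_A_backward[of s]] s by (simp add: o_def)
    show "norm_le_in \<iota>\<^sub>\<alpha> (A (backward s (\<iota>\<^sub>\<beta> y))) (c * exp (- \<delta> * s) * norm y)" using s by (intro est_AQ) simp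
    show "\<exists>a b G c w. s \<in> {a<..<b} \<and> linear G \<and> (\<forall>z. norm_le_in \<iota>\<^sub>\<alpha> (G z) (c * norm z)) \<and>
        continuous_on {a<..<b} w \<and> (\<forall>r\<in>{a<..<b}. A (backward r (\<iota>\<^sub>\<beta> y)) = G (w r :: 'x))"
      by (rule exI[of _ 0], rule exI[of _ "s + 1"], rule exI[of _ "backward 0"], rule exI,
          rule exI[of _ "\<lambda>r. A (T (s + 1 - r) (backward (s + 1) (\<iota>\<^sub>\<beta> y)))"])
        (use s in \<open>auto intro!: linear_backward est_Q shift_T A_backward_split\<close>)
  qed (use constants exp_integral in \<open>auto intro!: continuous_intros\<close>)

  \<comment> \<open>The embedding between the two intermediate spaces, recovered from their
    inclusions in the ambient space.\<close>
  define j where "j y = inv \<iota>\<^sub>\<alpha> (\<iota>\<^sub>\<beta> y)" for y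
  have j: "bounded_linear j"
    unfolding j_def by (rule bounded_linear_inv_comp[OF \<iota> lin_\<iota>' embedding])
  have \<iota>_j: "\<iota>\<^sub>\<alpha> (j y) = \<iota>\<^sub>\<beta> y" and norm_j: "norm (j y) \<le> k\<^sub>\<alpha> * norm y" for y
    unfolding j_def by (rule norm_le_inD[OF \<iota>(2) embedding])+

  define F where "F u s = f s (B (u s))" for u s
  define G where "G u s = g s (C (u s))" for u s
  \<comment> \<open>The right-hand side of the mild solution equation, read in the space of order
    \<alpha>: sign 1 for the integrals over the past, -1 for those over the future.\<close>
  define \<Lambda> where "\<Lambda> u t = - j (F u t) - k3.conv 1 (F u) t + k4.conv (- 1) (F u) t
      + k1.conv 1 (G u) t - k2.conv (- 1) (G u) t" for u t

  note BL = bounded_clinear_imp_linear[OF B] and CL = bounded_clinear_imp_linear[OF C]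
  have F: "F u \<in> PAP" and G: "G u \<in> PAP" if "u \<in> PAP" for u
    unfolding F_def[abs_def] G_def[abs_def]
    by (rule PAP_nemytskii[OF f_PAP f_Lip PAP_bounded_linear[OF BL that]]
        PAP_nemytskii[OF g_PAP g_Lip PAP_bounded_linear[OF CL that]])+
  note cb = PAP_continuous PAP_bounded

  have \<Lambda>_PAP: "\<Lambda> u \<in> PAP" if u: "u \<in> PAP" for u
  proof -
    have neg: "(\<lambda>t. - h t) \<in> PAP" if "h \<in> PAP" for h :: "real \<Rightarrow> 'a"
      by (rule PAP_bounded_linear[OF bounded_linear_minus[OF bounded_linear_ident] that])
    show ?thesis
      unfolding \<Lambda>_def[abs_def] diff_conv_add_uminus
      by (intro PAP_add neg PAP_bounded_linear[OF j] k1.conv_PAP k2.conv_PAP k3.conv_PAP k4.conv_PAP F G u)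
  qed

  \<comment> \<open>For \<open>u\<close> in PAP all integrability conditions hold automatically. The
    estimates place every integrand in the range of the inclusion, so each integral is the image of
    a convolution, and injectivity removes the inclusion from the equation.\<close>
  have mild_iff: "mild_solution A T P \<iota>\<^sub>\<alpha> \<iota>\<^sub>\<beta> B C f g u \<longleftrightarrow> \<Lambda> u = u" if u: "u \<in> PAP" for u
  proof -
    note FG = cb[OF F[OF u]] cb[OF G[OF u]]
    have in\<iota>: "norm_le_in \<iota>\<^sub>\<alpha> y r \<Longrightarrow> y = \<iota>\<^sub>\<alpha> (inv \<iota>\<^sub>\<alpha> y)" for y r
      using norm_le_inD(1)[OF \<iota>(2)] by simp
    have e3: "A (T (t - s) (P (\<iota>\<^sub>\<beta> (f s (B (u s)))))) =
        \<iota>\<^sub>\<alpha> (inv \<iota>\<^sub>\<alpha> (A (T (t - s) (P (\<iota>\<^sub>\<beta> (F u s))))))" if "s \<in> {..<t}" for s t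
      unfolding F_def using that by (intro in\<iota>[OF est_ATP]) simp
    have e4: "A (group_ext T Q (t - s) (Q (\<iota>\<^sub>\<beta> (f s (B (u s)))))) =
        \<iota>\<^sub>\<alpha> (inv \<iota>\<^sub>\<alpha> (A (backward (s - t) (\<iota>\<^sub>\<beta> (F u s)))))" if "s \<in> {t<..}" for s t
      using that in\<iota>[OF est_AQ[of "s - t" "F u s"]] by (simp add: F_def backward_def)
    have e1: "T (t - s) (P (g s (C (u s)))) = \<iota>\<^sub>\<alpha> (inv \<iota>\<^sub>\<alpha> (T (t - s) (P (G u s))))"
      if "s \<in> {..<t}" for s t
      unfolding G_def using that by (intro in\<iota>[OF est_TP]) simp
    have e2: "group_ext T Q (t - s) (Q (g s (C (u s)))) = \<iota>\<^sub>\<alpha> (inv \<iota>\<^sub>\<alpha> (backward (s - t) (G u s)))"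
      if "s \<in> {t<..}" for s t
      using that in\<iota>[OF est_Q[of "s - t" "G u s"]] by (simp add: G_def backward_def)
    have n3: "norm_integrable_on (\<lambda>s. A (T (t - s) (P (\<iota>\<^sub>\<beta> (f s (B (u s))))))) {..<t}" for t
      by (subst norm_integrable_on_cong[OF e3]) (assumption, rule k3.integral_below(1)[OF \<iota>(1) FG(1,2)])
    have n4: "norm_integrable_on (\<lambda>s. A (group_ext T Q (t - s) (Q (\<iota>\<^sub>\<beta> (f s (B (u s))))))) {t<..}" for t
      by (subst norm_integrable_on_cong[OF e4]) (assumption, rule k4.integral_above(1)[OF \<iota>(1) FG(1,2)])
    have i3: "integral {..<t} (\<lambda>s. A (T (t - s) (P (\<iota>\<^sub>\<beta> (f s (B (u s))))))) = \<iota>\<^sub>\<alpha> (k3.conv 1 (F u) t)" for t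
      by (subst integral_cong[OF e3]) (assumption, rule k3.integral_below(2)[OF \<iota>(1) FG(1,2)])
    have i4: "integral {t<..} (\<lambda>s. A (group_ext T Q (t - s) (Q (\<iota>\<^sub>\<beta> (f s (B (u s)))))))
        = \<iota>\<^sub>\<alpha> (k4.conv (- 1) (F u) t)" for t
      by (subst integral_cong[OF e4]) (assumption, rule k4.integral_above(2)[OF \<iota>(1) FG(1,2)])
    have i1: "integral {..<t} (\<lambda>s. T (t - s) (P (g s (C (u s))))) = \<iota>\<^sub>\<alpha> (k1.conv 1 (G u) t)" for t
      by (subst integral_cong[OF e1]) (assumption, rule k1.integral_below(2)[OF \<iota>(1) FG(3,4)])
    have i2: "integral {t<..} (\<lambda>s. group_ext T Q (t - s) (Q (g s (C (u s))))) = \<iota>\<^sub>\<alpha> (k2.conv (- 1) (G u) t)" for t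
      by (subst integral_cong[OF e2]) (assumption, rule k2.integral_above(2)[OF \<iota>(1) FG(3,4)])
    have rhs: "- \<iota>\<^sub>\<beta> (f t (B (u t))) - \<iota>\<^sub>\<alpha> (k3.conv 1 (F u) t) + \<iota>\<^sub>\<alpha> (k4.conv (- 1) (F u) t)
        + \<iota>\<^sub>\<alpha> (k1.conv 1 (G u) t) - \<iota>\<^sub>\<alpha> (k2.conv (- 1) (G u) t) = \<iota>\<^sub>\<alpha> (\<Lambda> u t)" for t
      by (simp add: \<Lambda>_def \<iota>.add \<iota>.diff \<iota>.neg \<iota>_j F_def)
    have "mild_solution A T P \<iota>\<^sub>\<alpha> \<iota>\<^sub>\<beta> B C f g u \<longleftrightarrow> (\<forall>t. \<iota>\<^sub>\<alpha> (u t) = \<iota>\<^sub>\<alpha> (\<Lambda> u t))"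
      unfolding mild_solution_def Let_def Q[symmetric] i1 i2 i3 i4 rhs using n3 n4 cb[OF u] by simp
    also have "\<dots> \<longleftrightarrow> \<Lambda> u = u" using injD[OF \<iota>(2)] by (auto simp: fun_eq_iff)
    finally show ?thesis .
  qed

  have w0: "0 \<le> w" using onorm_pos_le[OF BL] w by simp
  have \<Theta>0: "0 \<le> \<Theta>"
    using K w0 constants \<delta> orders Gamma_real_pos[of "\<beta> - \<alpha>"] Gamma_real_pos[of "1 - \<alpha>"]
    unfolding Theta by (intro mult_nonneg_nonneg add_nonneg_nonneg divide_nonneg_nonneg) auto
  \<comment> \<open>Stated for a general pair of a nonlinearity and a bounded operator, since w
    bounds both operator norms and the argument serves f with B as well as g with C.\<close>
  have lip: "norm (h t (L x) - h t (L y)) \<le> K * w * d"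
    if h: "\<And>t u v. norm (h t u - h t v) \<le> K * norm (u - v)" and L: "bounded_linear L" "onorm L \<le> w"
      and d: "norm (x - y) \<le> d" for h :: "real \<Rightarrow> 'x \<Rightarrow> 'z::banach" and L :: "'a \<Rightarrow> 'x" and x y t d
  proof -
    have "norm (L x - L y) \<le> onorm L * norm (x - y)"
      using onorm[OF L(1), of "x - y"] by (simp add: linear_diff bounded_linear.linear[OF L(1)])
    also have "\<dots> \<le> w * d" using L(2) d w0 by (intro mult_mono) auto
    finally show ?thesis
      using order_trans[OF h mult_left_mono] K by (simp add: mult.assoc)
  qed
  have contr: "norm (\<Lambda> u t - \<Lambda> v t) \<le> \<Theta> * d"
    if u: "u \<in> PAP" and v: "v \<in> PAP" and d: "\<And>t. norm (u t - v t) \<le> d" for u v d t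
  proof -
    have Fd: "norm (F u t - F v t) \<le> K * w * d" for t
      unfolding F_def by (rule lip[OF f_Lip BL _ d]) (simp add: w)
    have Gd: "norm (G u t - G v t) \<le> K * w * d" for t
      unfolding G_def by (rule lip[OF g_Lip CL _ d]) (simp add: w)
    note FF = cb[OF F[OF u]] cb[OF F[OF v]] and GG = cb[OF G[OF u]] cb[OF G[OF v]]
    have "norm (j (F u t) - j (F v t)) \<le> k\<^sub>\<alpha> * norm (F u t - F v t)"
      using norm_j[of "F u t - F v t"] by (simp add: linear_diff[OF bounded_linear.linear[OF j]])
    also have "\<dots> \<le> k\<^sub>\<alpha> * (K * w * d)" using Fd constants by (intro mult_left_mono) auto
    finally have d0: "norm (j (F u t) - j (F v t)) \<le> k\<^sub>\<alpha> * (K * w * d)" .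
    \<comment> \<open>Together with \<open>d0\<close> these bounds account for the five summands of
      \<Theta>: each is the mass of a kernel, or the embedding constant, times the common factor K w
      d.\<close>
    note d3 = k3.norm_conv_diff_le[OF FF Fd, of 1 t] and d4 = k4.norm_conv_diff_le[OF FF Fd, of "- 1" t]
      and d1 = k1.norm_conv_diff_le[OF GG Gd, of 1 t] and d2 = k2.norm_conv_diff_le[OF GG Gd, of "- 1" t]
    have "\<Lambda> u t - \<Lambda> v t = (k4.conv (- 1) (F u) t - k4.conv (- 1) (F v) t)
        + (k1.conv 1 (G u) t - k1.conv 1 (G v) t) - (j (F u t) - j (F v t))
        - (k3.conv 1 (F u) t - k3.conv 1 (F v) t) - (k2.conv (- 1) (G u) t - k2.conv (- 1) (G v) t)"
      by (simp add: \<Lambda>_def)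
    also have "norm \<dots> \<le> c / \<delta> * (K * w * d) + M\<^sub>\<alpha> * Gamma (1 - \<alpha>) / \<gamma> powr (1 - \<alpha>) * (K * w * d)
        + k\<^sub>\<alpha> * (K * w * d) + c * Gamma (\<beta> - \<alpha>) / \<gamma> powr (\<beta> - \<alpha>) * (K * w * d) + c\<^sub>\<alpha> / \<delta> * (K * w * d)"
      by (intro order_trans[OF norm_triangle_ineq4 add_mono[OF _ d2]]
          order_trans[OF norm_triangle_ineq4 add_mono[OF _ d3]]
          order_trans[OF norm_triangle_ineq4 add_mono[OF _ d0]]
          norm_triangle_mono d4 d1)
    also have "\<dots> = \<Theta> * d" unfolding Theta by (simp add: algebra_simps)
    finally show ?thesis .
  qed
  have "\<exists>!u. u \<in> PAP \<and> \<Lambda> u = u"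
    by (rule PAP_contraction_fixpoint[OF \<Lambda>_PAP \<Theta>0 contraction contr])
  \<comment> \<open>The equivalence is available only for \<open>u\<close> in PAP; the congruence
    rule for conjunctions provides this membership.\<close>
  then show ?thesis using mild_iff by (simp cong: conj_cong)
qed

end
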